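(* Let $\alpha>0$ and let $D(\beta)$, $\beta\ge0$, be defined by $$D(\beta)=\inf_{g\in L^\infty(\mathbb{P})}\mathbb{E}\Big\{\sum_{i\in\mathbb{Z}}c_{0,x_i}(\omega)\big(x_i+\nabla_{x_i}g(\omega)\big)^2\Big\},\qquad c_{x_i,x_j}(\omega)=\exp\{-|x_i-x_j|^\alpha-\beta u(E_i,E_j)\}\ (i\ne j).$$ Suppose that $\mathbb{E}[Z_j^2]<\infty$. (1) If $\mathbb{E}[\exp(Z_j^\alpha)]<\infty$, then there exist $C,\kappa>0$ such that for all $\beta\ge0$ $$D(\beta)\ge C\exp[-\kappa\beta].$$ (2) Suppose that $\alpha\ge1$ and that $\{Z_j\}$ are positive i.i.d. random variables. Then $$D(\beta)>0\quad\Longleftrightarrow\quad\mathbb{E}[\exp(Z_j^\alpha)]<\infty .$$ If in addition to the bound $\mathbb{E}[\exp(Z_j^\alpha)]<\infty$ the law $\nu$ has no mass at zero, that is, $\nu[-E,E]\to0$ as $E\searrow0$, then $$C_1\exp[-\kappa_1\beta]\le D(\beta)\le C_2\exp[-\kappa_2\beta]$$ for suitable positive constants $C_1,C_2,\kappa_1,\kappa_2$, for all $\beta\ge0$. (3) Suppose that $\alpha<1$ and that $\{Z_j\}$ are positive i.i.d. random variables. (i) If $\mathbb{E}[\exp(\gamma Z_j^\alpha)]=\infty$ for some $\gamma\in(0,1)$, then $D(\beta)=0$. (ii) If $\mathbb{E}[\exp(\varepsilon Z_j)]<\infty$ for some $\varepsilon>0$ and $\nu[-E,E]\sim E^\delta$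 as $E\searrow0$ for some constant $\delta>0$, then $$C_1\exp\big[-\kappa_1\beta^{\delta\alpha/(1-\alpha+\delta\alpha)}\big]\le D(\beta)\le C_2\exp\big[-\kappa_2\beta^{\delta\alpha/(1-\alpha+\delta\alpha)}\big]$$ for suitable positive constants $C_1,C_2,\kappa_1,\kappa_2$, for all $\beta\ge0$.
   Context: Environment: $\{Z_j\}_{j\in\mathbb{Z}}$ is a stationary and ergodic sequence of positive random variables with finite mean. Set $x_0=0$, $x_k=x_{k-1}+Z_{k-1}$ for $k\in\mathbb{Z}$, and $\xi=\{x_k\}_{k\in\mathbb{Z}}$. $\Theta=\{E_k\}_{k\in\mathbb{Z}}$ are i.i.d. random variables in $[-1,1]$ with law $\nu$, independent of $\xi$. The environment is $\omega=(\xi,\Theta)$, identified with $\{(x_i,E_i)\}_{i\in\mathbb Z}$; $\mathbb{P},\mathbb{E}$ denote its law and expectation. Standing assumption: $\mathbb{E}(\xi[0,1])<\infty$, where $\xi[0,1]$ is the number of points of $\xi$ in $[0,1]$ (automatic when the $Z_j$ are i.i.d.). The (measurable) function $u$ satisfies $c_1(|E|+|E'|)\le u(E,E')=u(E',E)\le c_2(|E|+|E'|)$ for all $E,E'\in[-1,1]$, for some constants $0<c_1\le c_2$. We set $c_{x_i,x_i}(\omega)=0$. For $y\in\xi$, $\tau_y\omega=\{(x_i-y,E_i)\}_{i\in\mathbb Z}$ (relabelled so that the point at the origin has index $0$) and $\nabla_yg(\omega)=g(\tau_y\omega)-g(\omega)$. $D(\beta)$ is the diffusion coefficient of the limiting Brownian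 motion (variance $D(\beta)t$ at time $t$) of the diffusively rescaled continuous-time random walk on $\xi$ started at $0$ with jump rates $c_{x_i,x_j}(\omega)$. Notation: $f(E)\sim g(E)$ as $E\searrow0$ means that there are constants $a_1,a_2>0$ with $a_1g(E)\le f(E)\le a_2g(E)$ for all sufficiently small $E>0$. The constants in the bounds do not depend on $\beta$. *)

theory Defs
  imports "HOL-Probability.Probability"
begin

definition stationary_seq :: "'a measure \<Rightarrow> (int \<Rightarrow> 'a \<Rightarrow> real) \<Rightarrow> bool" where
  "stationary_seq M Z \<longleftrightarrow>
     (\<forall>n. distr M (Pi\<^sub>M UNIV (\<lambda>_. borel)) (\<lambda>w j. Z (j + n) w)
        = distr M (Pi\<^sub>M UNIV (\<lambda>_. borel)) (\<lambda>w j. Z j w))"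

text \<open>Ergodicity of the law of the sequence under the unit shift of \<open>int \<Rightarrow> real\<close>.\<close>

definition ergodic_seq :: "'a measure \<Rightarrow> (int \<Rightarrow> 'a \<Rightarrow> real) \<Rightarrow> bool" where
  "ergodic_seq M Z \<longleftrightarrow>
     (\<forall>A \<in> sets (Pi\<^sub>M UNIV (\<lambda>_. borel)).
        (\<lambda>z j. z (j + 1)) -` A = A \<longrightarrow>
        measure M {w \<in> space M. (\<lambda>j. Z j w) \<in> A} \<in> {0, 1})"

definition iid_seq :: "'a measure \<Rightarrow> (int \<Rightarrow> 'a \<Rightarrow> real) \<Rightarrow> bool" where
  "iid_seq M Z \<longleftrightarrow>
     prob_space.indep_vars M (\<lambda>_. borel) Z UNIV \<and>
     (\<forall>i j. distr M borel (Z i) = distr M borel (Z j))"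

text \<open>The points \<open>x\<^sub>k\<close> determined by the gaps \<open>z\<close>: the unique solution of
  \<open>x\<^sub>0 = 0\<close>, \<open>x\<^sub>k = x\<^sub>k\<^sub>-\<^sub>1 + z\<^sub>k\<^sub>-\<^sub>1\<close>, see \<open>points_eqI\<close>.\<close>

definition points :: "(int \<Rightarrow> real) \<Rightarrow> int \<Rightarrow> real" where
  "points z k = (if 0 \<le> k then \<Sum>j\<in>{0..<k}. z j else - (\<Sum>j\<in>{k..<0}. z j))"

lemma points_0: "points z 0 = 0"
  by (simp add: points_def)

lemma points_rec: "points z k = points z (k - 1) + z (k - 1)"
proof -
  consider "k \<ge> 1" | "k = 0" | "k < 0" by linarith
  then show ?thesis
  proof cases
    case 1
    then have "{0..<k} = insert (k - 1) {0..<k - 1}" by auto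
    with 1 show ?thesis by (simp add: points_def)
  next
    case 2
    have "{-1..<0} = {-1::int}" by auto
    with 2 show ?thesis by (simp add: points_def)
  next
    case 3
    then have "{k - 1..<0} = insert (k - 1) {k..<0}" by auto
    with 3 show ?thesis by (simp add: points_def)
  qed
qed

lemma points_eqI:
  assumes "x 0 = 0" and "\<And>k. x k = x (k - 1) + z (k - 1)"
  shows "x = points z"
proof
  fix k :: int
  show "x k = points z k"
  proof (induction k rule: int_induct[where k = 0])
    case base
    show ?case by (simp add: assms(1) points_0)
  next
    case (step1 i)
    then show ?case using assms(2)[of "i + 1"] points_rec[of z "i + 1"] by simp
  next
    case (step2 i)
    then show ?case using assms(2)[of i] points_rec[of z i] by simp
  qed
qed

text \<open>
  A realisation \<open>\<omega> = {(x\<^sub>i, E\<^sub>i)}\<close> is represented by the labelled family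
  \<open>i \<mapsto> (x\<^sub>i, E\<^sub>i)\<close>, with the point at the origin carrying the label 0 and the labels
  increasing along the line.
\<close>

type_synonym env = "int \<Rightarrow> real \<times> real"

abbreviation pos :: "env \<Rightarrow> int \<Rightarrow> real" where
  "pos \<omega> i \<equiv> fst (\<omega> i)"

abbreviation mark :: "env \<Rightarrow> int \<Rightarrow> real" where
  "mark \<omega> i \<equiv> snd (\<omega> i)"

definition env_of ::
    "(int \<Rightarrow> 'a \<Rightarrow> real) \<Rightarrow> (int \<Rightarrow> 'a \<Rightarrow> real) \<Rightarrow> 'a \<Rightarrow> env" where
  "env_of Z E w = (\<lambda>k. (points (\<lambda>j. Z j w) k, E k w))"

definition env_law ::
    "'a measure \<Rightarrow> (int \<Rightarrow> 'a \<Rightarrow> real) \<Rightarrow> (int \<Rightarrow> 'a \<Rightarrow> real) \<Rightarrow> env measure" where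
  "env_law M Z E = distr M (Pi\<^sub>M UNIV (\<lambda>_. borel \<Otimes>\<^sub>M borel)) (env_of Z E)"

text \<open>\<open>env_shift i \<omega>\<close> is \<open>\<tau>\<^sub>y \<omega>\<close> for the point \<open>y = x\<^sub>i\<close>, relabelled so that the
  point at the origin has label 0.\<close>

definition env_shift :: "int \<Rightarrow> env \<Rightarrow> env" where
  "env_shift i \<omega> = (\<lambda>k. (pos \<omega> (k + i) - pos \<omega> i, mark \<omega> (k + i)))"

definition grad :: "int \<Rightarrow> (env \<Rightarrow> real) \<Rightarrow> env \<Rightarrow> real" where
  "grad i g \<omega> = g (env_shift i \<omega>) - g \<omega>"

definition jump_rate ::
    "real \<Rightarrow> (real \<Rightarrow> real \<Rightarrow> real) \<Rightarrow> real \<Rightarrow> env \<Rightarrow> int \<Rightarrow> int \<Rightarrow> real" where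
  "jump_rate \<alpha> u \<beta> \<omega> i j =
     (if i = j then 0
      else exp (- (\<bar>pos \<omega> i - pos \<omega> j\<bar> powr \<alpha>) - \<beta> * u (mark \<omega> i) (mark \<omega> j)))"

definition L_infinity :: "'b measure \<Rightarrow> ('b \<Rightarrow> real) set" where
  "L_infinity P = {g \<in> borel_measurable P. \<exists>B. AE \<omega> in P. \<bar>g \<omega>\<bar> \<le> B}"

text \<open>The expectations of the nonnegative energies are taken in \<open>[0, \<infinity>]\<close>, so that the
  infimum is meaningful without any integrability side condition.\<close>

definition diffusion_coeff ::
    "env measure \<Rightarrow> real \<Rightarrow> (real \<Rightarrow> real \<Rightarrow> real) \<Rightarrow> real \<Rightarrow> ennreal" where
  "diffusion_coeff P \<alpha> u \<beta> =
     (INF g \<in> L_infinity P.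
        \<integral>\<^sup>+ \<omega>. (\<Sum>\<^sub>\<infinity>i\<in>UNIV.
               ennreal (jump_rate \<alpha> u \<beta> \<omega> 0 i * (pos \<omega> i + grad i g \<omega>)\<^sup>2)) \<partial>P)"

text \<open>The environment with its standing assumptions; \<open>finite_density\<close> says that
  the expected number of points in \<open>[0, 1]\<close> is finite, where the counting measure
  assigns \<open>\<infinity>\<close> to infinite sets.\<close>

locale environment = prob_space M
  for M :: "'a measure" +
  fixes Z E :: "int \<Rightarrow> 'a \<Rightarrow> real" and \<nu> :: "real measure"
  assumes Z_measurable: "\<And>j. Z j \<in> borel_measurable M"
    and Z_pos: "\<And>j. AE w in M. 0 < Z j w"
    and Z_mean: "\<And>j. integrable M (Z j)"
    and Z_stationary: "stationary_seq M Z"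
    and Z_ergodic: "ergodic_seq M Z"
    and E_iid: "iid_seq M E"
    and E_law: "\<And>k. distr M borel (E k) = \<nu>"
    and E_range: "\<And>k. AE w in M. E k w \<in> {-1..1}"
    and indep_points_marks:
      "indep_var (Pi\<^sub>M UNIV (\<lambda>_. borel)) (\<lambda>w. points (\<lambda>j. Z j w))
                 (Pi\<^sub>M UNIV (\<lambda>_. borel)) (\<lambda>w k. E k w)"
    and finite_density:
      "(\<integral>\<^sup>+ w. emeasure (count_space UNIV) (range (points (\<lambda>j. Z j w)) \<inter> {0..1}) \<partial>M) < \<infinity>"

text \<open>\<open>u\<close> is only constrained on \<open>[-1, 1]\<^sup>2\<close>, where the marks live.\<close>

definition mark_interaction :: "(real \<Rightarrow> real \<Rightarrow> real) \<Rightarrow> bool" where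
  "mark_interaction u \<longleftrightarrow>
     (\<lambda>(a, b). u a b) \<in> borel_measurable (restrict_space (borel \<Otimes>\<^sub>M borel) ({-1..1} \<times> {-1..1})) \<and>
     (\<exists>c\<^sub>1 c\<^sub>2. 0 < c\<^sub>1 \<and> c\<^sub>1 \<le> c\<^sub>2 \<and>
        (\<forall>a \<in> {-1..1}. \<forall>b \<in> {-1..1}.
           c\<^sub>1 * (\<bar>a\<bar> + \<bar>b\<bar>) \<le> u a b \<and> u a b = u b a \<and> u a b \<le> c\<^sub>2 * (\<bar>a\<bar> + \<bar>b\<bar>)))"

text \<open>\<open>f(e) \<sim> g(e)\<close> as \<open>e \<down> 0\<close>, in the sense of two-sided bounds up to constants.\<close>

definition comparable_at_0 :: "(real \<Rightarrow> real) \<Rightarrow> (real \<Rightarrow> real) \<Rightarrow> bool" where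
  "comparable_at_0 f g \<longleftrightarrow>
     (\<exists>a\<^sub>1>0. \<exists>a\<^sub>2>0. eventually (\<lambda>e. a\<^sub>1 * g e \<le> f e \<and> f e \<le> a\<^sub>2 * g e) (at_right 0))"

end

theory Submission
  imports Defs
begin

text \<open>
  The model lives on a line, so everything can be read off the stationary sequence of marked gaps
  \<open>(Z\<^sub>k, E\<^sub>k)\<close>. A corrector \<open>g\<close> replaces the displacement \<open>Z\<^sub>0\<close> across the first gap by the
  increment \<open>a = Z\<^sub>0 + g \<circ> \<tau> - g\<close>, and the modified displacement of a longer jump is the sum of the
  shifted increments over the gaps that it crosses. Increments are stationary and have mean
  \<open>\<E> Z\<^sub>0\<close>, so that computing \<open>D(\<beta>)\<close> amounts to minimising a quadratic form over increments with
  prescribed mean.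

  Lower bounds come from flows, that is, from weights \<open>\<theta>\<close> on the jumps for which the weights of the
  jumps over any given gap add up to one. For such weights the expectation of \<open>\<Sum> \<theta> X\<close>, where \<open>X\<close> are
  the modified displacements, equals \<open>\<E> Z\<^sub>0\<close> for every corrector, and the Cauchy-Schwarz inequality
  gives \<open>D \<ge> (\<E> Z\<^sub>0)\<^sup>2 / \<E> (\<Sum> \<theta>\<^sup>2 / c)\<close> (\<open>D_ge_flow\<close>). Nearest neighbour jumps have expected resistance at
  most \<open>\<E> exp (Z\<^sub>0\<^sup>\<alpha>)\<close> times \<open>exp (2 c\<^sub>2 \<beta>)\<close>, which is the first claim. If \<open>\<alpha> < 1\<close> and
  the gaps have an exponential moment, it is cheaper to jump only between consecutive points with marks in \<open>[-e, e]\<close>: this costs \<open>\<beta> e\<close> for the marks,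
  while the length of the jump is a geometric sum of gaps with an exponential tail at scale \<open>1 / q\<close>,
  \<open>q = \<nu> [-e, e]\<close>, so that the expected resistance of these jumps is at most
  \<open>exp (2 c\<^sub>2 \<beta> e + M q powr (- \<alpha> / (1 - \<alpha>)))\<close> up to a constant factor (\<open>D_ge_low_marks\<close>).

  Upper bounds need test functions. The square of a modified displacement over \<open>n\<close> gaps is at most
  \<open>n\<close> times the sum of the squares of its increments, so the energy is dominated by that of a nearest
  neighbour network (\<open>crossing_energy\<close>), whose conductances are finite on average because the sum of
  \<open>n\<close> gaps is at least of order \<open>n\<close> with exponentially small exceptional probability. In this network every
  bounded stationary \<open>\<psi>\<close> with mean \<open>\<E> Z\<^sub>0\<close> and weak enough correlations is, up to an arbitrarily
  small error and a factor 3, the increment of a bounded corrector (\<open>D_le_crossing_energy\<close>). Two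
  choices of \<open>\<psi>\<close> give all upper bounds. Displacing points only across long gaps, with weight
  proportional to \<open>exp (\<gamma> Z\<^sub>0\<^sup>\<alpha>)\<close> cut off at height \<open>N\<close>, costs at most a constant divided by the mean of the
  weight, hence \<open>D = 0\<close> if \<open>\<E> exp (\<gamma> Z\<^sub>0\<^sup>\<alpha>) = \<infinity>\<close> (\<open>D_eq_0_if_long_gaps\<close>). Displacing points only in the
  middle of runs of \<open>2 m\<close> marks outside \<open>[-e, e]\<close> forces every contributing jump either to
  start at such a mark or to cross more than \<open>m\<close> gaps (\<open>D_le_high_marks\<close>).

  The stretched exponent comes from the balance of three costs. If \<open>\<nu> [-e, e]\<close> is of order \<open>e\<^sup>\<delta>\<close>, a run
  of \<open>x\<close> marks outside \<open>[-e, e]\<close> has probability about \<open>exp (- e\<^sup>\<delta> x)\<close>, jumping over it costs about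
  \<open>x\<^sup>\<alpha>\<close> and jumping into it at least about \<open>\<beta> e\<close>. The three are equal to \<open>T\<close> for
  \<open>T = \<beta> powr (\<delta> \<alpha> / (1 - \<alpha> + \<delta> \<alpha>))\<close>, \<open>e = T / \<beta>\<close> and \<open>x = T powr (1 / \<alpha>)\<close>.
\<close>

section \<open>Sums over the integers as integrals\<close>

lemma finite_sum_le_infsum_int:
  fixes f :: "int \<Rightarrow> ennreal"
  assumes "finite F"
  shows "sum f F \<le> (\<Sum>\<^sub>\<infinity>i\<in>UNIV. f i)"
  unfolding nonneg_infsum_complete[of UNIV f, simplified]
  using assms by (intro SUP_upper) simp

text \<open>As an integral, the sum over all jumps can be interchanged with expectations and with limits.\<close>

lemma infsum_int_eq_nn_integral:
  fixes f :: "int \<Rightarrow> ennreal"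
  shows "(\<Sum>\<^sub>\<infinity>i\<in>UNIV. f i) = (\<integral>\<^sup>+ i. f i \<partial>count_space UNIV)"
proof (rule antisym)
  have "infsum f UNIV = (SUP F\<in>{F. finite F \<and> F \<subseteq> UNIV}. sum f F)"
    by (rule nonneg_infsum_complete) simp
  also have "\<dots> \<le> (\<integral>\<^sup>+ i. f i \<partial>count_space UNIV)"
  proof (rule SUP_least)
    fix F :: "int set" assume "F \<in> {F. finite F \<and> F \<subseteq> UNIV}"
    then have "sum f F = (\<integral>\<^sup>+ i. f i * indicator F i \<partial>count_space UNIV)"
      by (simp add: nn_integral_count_space_indicator[symmetric] nn_integral_count_space_finite)
    also have "\<dots> \<le> (\<integral>\<^sup>+ i. f i \<partial>count_space UNIV)"
      by (intro nn_integral_mono) (auto simp: indicator_def)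
    finally show "sum f F \<le> (\<integral>\<^sup>+ i. f i \<partial>count_space UNIV)" .
  qed
  finally show "infsum f UNIV \<le> (\<integral>\<^sup>+ i. f i \<partial>count_space UNIV)" .
next
  have "(\<integral>\<^sup>+ i. f i \<partial>count_space UNIV) = (\<integral>\<^sup>+ n. f (int_decode n) \<partial>count_space UNIV)"
    by (rule nn_integral_bij_count_space[symmetric]) (rule bij_int_decode)
  also have "\<dots> = (\<Sum>n. f (int_decode n))"
    by (rule nn_integral_count_space_nat)
  also have "\<dots> = (SUP n. \<Sum>i<n. f (int_decode i))"
    by (simp add: suminf_eq_SUP)
  also have "\<dots> \<le> infsum f UNIV"
  proof (rule SUP_least)
    fix n
    have "(\<Sum>i<n. f (int_decode i)) = sum f (int_decode ` {..<n})"
      by (subst sum.reindex) (auto intro: inj_on_subset[OF inj_int_decode])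
    also have "\<dots> \<le> infsum f UNIV"
      by (rule finite_sum_le_infsum_int) simp
    finally show "(\<Sum>i<n. f (int_decode i)) \<le> infsum f UNIV" .
  qed
  finally show "(\<integral>\<^sup>+ i. f i \<partial>count_space UNIV) \<le> infsum f UNIV" .
qed

lemma nn_integral_int_abs_finite:
  fixes g :: "nat \<Rightarrow> real"
  assumes "summable g" "\<And>n. 0 \<le> g n"
  shows "(\<integral>\<^sup>+ i. ennreal (g (nat \<bar>i\<bar>)) \<partial>count_space (UNIV :: int set)) < \<infinity>"
proof -
  have fin: "(\<Sum>n. ennreal (g n)) < \<infinity>"
    using assms by (subst suminf_ennreal2) auto
  have half: "(\<integral>\<^sup>+ i. ennreal (g (nat \<bar>i\<bar>)) \<partial>count_space (range h)) < \<infinity>"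
    if "inj h" "\<And>n. nat \<bar>h n\<bar> = n" for h :: "nat \<Rightarrow> int"
  proof -
    have "(\<integral>\<^sup>+ i. ennreal (g (nat \<bar>i\<bar>)) \<partial>count_space (range h))
        = (\<integral>\<^sup>+ n. ennreal (g (nat \<bar>h n\<bar>)) \<partial>count_space UNIV)"
      by (rule nn_integral_bij_count_space[symmetric]) (simp add: bij_betw_def that)
    then show ?thesis using fin that by (simp add: nn_integral_count_space_nat)
  qed
  have "(\<integral>\<^sup>+ i. ennreal (g (nat \<bar>i\<bar>)) \<partial>count_space (UNIV :: int set))
     \<le> (\<integral>\<^sup>+ i. ennreal (g (nat \<bar>i\<bar>)) * indicator (range int) i
             + ennreal (g (nat \<bar>i\<bar>)) * indicator (range (\<lambda>n. - int n)) i \<partial>count_space UNIV)"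
  proof (rule nn_integral_mono)
    fix i :: int
    have "i \<in> range int \<or> i \<in> range (\<lambda>n. - int n)"
      by (metis int_cases2 rangeI)
    then show "ennreal (g (nat \<bar>i\<bar>)) \<le> ennreal (g (nat \<bar>i\<bar>)) * indicator (range int) i
             + ennreal (g (nat \<bar>i\<bar>)) * indicator (range (\<lambda>n. - int n)) i"
      by (auto simp: indicator_def)
  qed
  also have "\<dots> = (\<integral>\<^sup>+ i. ennreal (g (nat \<bar>i\<bar>)) \<partial>count_space (range int))
      + (\<integral>\<^sup>+ i. ennreal (g (nat \<bar>i\<bar>)) \<partial>count_space (range (\<lambda>n. - int n)))"
    by (subst nn_integral_add)
       (simp_all add: nn_integral_count_space_indicator[symmetric])
  also have "\<dots> < \<infinity>"
    using half[of int] half[of "\<lambda>n. - int n"] by (simp add: inj_on_def)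
  finally show ?thesis .
qed

section \<open>Sequences of marked gaps\<close>

text \<open>A point of this space is the sequence of pairs of a gap and the mark at its left end.\<close>

abbreviation gap_seqs :: "(int \<Rightarrow> real \<times> real) measure" where
  "gap_seqs \<equiv> Pi\<^sub>M UNIV (\<lambda>_. borel \<Otimes>\<^sub>M borel)"

abbreviation gap :: "(int \<Rightarrow> real \<times> real) \<Rightarrow> int \<Rightarrow> real" where
  "gap y k \<equiv> fst (y k)"

abbreviation gmark :: "(int \<Rightarrow> real \<times> real) \<Rightarrow> int \<Rightarrow> real" where
  "gmark y k \<equiv> snd (y k)"

definition seq_shift :: "int \<Rightarrow> (int \<Rightarrow> 'b) \<Rightarrow> int \<Rightarrow> 'b" where
  "seq_shift i y = (\<lambda>k. y (k + i))"

definition env_of_gaps :: "(int \<Rightarrow> real \<times> real) \<Rightarrow> env" where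
  "env_of_gaps y = (\<lambda>k. (points (gap y) k, gmark y k))"

definition gaps_of_env :: "env \<Rightarrow> int \<Rightarrow> real \<times> real" where
  "gaps_of_env \<omega> = (\<lambda>k. (pos \<omega> (k + 1) - pos \<omega> k, mark \<omega> k))"

lemma seq_shift_apply: "seq_shift i y k = y (k + i)"
  by (simp add: seq_shift_def)

lemma seq_shift_seq_shift [simp]: "seq_shift i (seq_shift j y) = seq_shift (i + j) y"
  by (simp add: seq_shift_def add_ac)

lemma seq_shift_0 [simp]: "seq_shift 0 y = y"
  by (simp add: seq_shift_def)

lemma points_diff: "points z (k + 1) - points z k = z k"
  using points_rec[of z "k + 1"] by simp

lemma gaps_of_env_of_gaps: "gaps_of_env (env_of_gaps y) = y"
  by (simp add: gaps_of_env_def env_of_gaps_def points_diff)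

lemma points_seq_shift: "points (seq_shift i z) k = points z (k + i) - points z i"
proof -
  have "(\<lambda>k. points z (k + i) - points z i) = points (seq_shift i z)"
  proof (rule points_eqI)
    show "points z (k + i) - points z i = points z (k - 1 + i) - points z i + seq_shift i z (k - 1)" for k
      using points_rec[of z "k + i"] by (simp add: seq_shift_def algebra_simps)
  qed simp
  then show ?thesis by metis
qed

lemma env_shift_env_of_gaps: "env_shift i (env_of_gaps y) = env_of_gaps (seq_shift i y)"
proof -
  have "gap (seq_shift i y) = seq_shift i (gap y)" by (simp add: seq_shift_def)
  then show ?thesis
    by (simp add: env_shift_def env_of_gaps_def points_seq_shift seq_shift_apply)
qed

lemma pos_env_of_gaps [simp]: "pos (env_of_gaps y) i = points (gap y) i"
  by (simp add: env_of_gaps_def)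

text \<open>Correctors telescope: modifying each gap by a difference of a function of the position modifies the
  points by that function itself.\<close>

lemma points_coboundary:
  "points (\<lambda>k. z k + h (k + 1) - h k) i = points z i + h i - h 0"
proof -
  have "(\<lambda>i. points z i + h i - h 0) = points (\<lambda>k. z k + h (k + 1) - h k)"
  proof (rule points_eqI)
    show "points z k + h k - h 0 = points z (k - 1) + h (k - 1) - h 0 + (z (k - 1) + h (k - 1 + 1) - h (k - 1))" for k
      using points_diff[of z "k - 1"] by simp
  qed (simp add: points_0)
  then show ?thesis by metis
qed

text \<open>The labels of the gaps crossed by a jump from the point with label 0 to the one with
  label \<open>i\<close>.\<close>

definition crossed :: "int \<Rightarrow> int set" where
  "crossed i = {0..<i} \<union> {i..<0}"

lemma finite_crossed [simp]: "finite (crossed i)"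
  by (simp add: crossed_def)

lemma card_crossed: "card (crossed i) = nat \<bar>i\<bar>"
  by (cases "0 \<le> i") (simp_all add: crossed_def)

lemma points_eq_sum_crossed:
  "points z i = (if 0 \<le> i then 1 else - 1) * (\<Sum>k\<in>crossed i. z k)"
  by (simp add: points_def crossed_def)

text \<open>The Cauchy-Schwarz inequality that splits a jump into the gaps it crosses. It loses a factor equal
  to the number of gaps, which is harmless since the rates of long jumps decay fast enough.\<close>

lemma points_square_le:
  "(points z i)\<^sup>2 \<le> real_of_int \<bar>i\<bar> * (\<Sum>k\<in>crossed i. (z k)\<^sup>2)"
proof -
  have "(points z i)\<^sup>2 = (\<Sum>k\<in>crossed i. z k)\<^sup>2"
    by (simp add: points_eq_sum_crossed power2_eq_square)
  also have "\<dots> \<le> (\<Sum>k\<in>crossed i. (z k)\<^sup>2) * card (crossed i)"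
    by (rule sum_squared_le_sum_of_squares) 
  finally show ?thesis by (simp add: card_crossed mult.commute)
qed

lemma measurable_points [measurable]:
  "(\<lambda>y. points (gap y) i) \<in> borel_measurable gap_seqs"
  unfolding points_def by measurable

lemma measurable_seq_shift [measurable]: "seq_shift i \<in> gap_seqs \<rightarrow>\<^sub>M gap_seqs"
  unfolding seq_shift_def by (rule measurable_PiM_single') (auto simp: space_pair_measure)

lemma measurable_env_of_gaps [measurable]: "env_of_gaps \<in> gap_seqs \<rightarrow>\<^sub>M gap_seqs"
  unfolding env_of_gaps_def
  by (rule measurable_PiM_single') (auto simp: space_pair_measure)

lemma measurable_gaps_of_env [measurable]: "gaps_of_env \<in> gap_seqs \<rightarrow>\<^sub>M gap_seqs"
  unfolding gaps_of_env_def
  by (rule measurable_PiM_single') (auto simp: space_pair_measure)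

section \<open>The energy of a corrector in terms of the gaps\<close>

definition rate :: "real \<Rightarrow> (real \<Rightarrow> real \<Rightarrow> real) \<Rightarrow> real \<Rightarrow> int \<Rightarrow> (int \<Rightarrow> real \<times> real) \<Rightarrow> real" where
  "rate \<alpha> u \<beta> i y = jump_rate \<alpha> u \<beta> (env_of_gaps y) 0 i"

lemma rate_eq:
  "rate \<alpha> u \<beta> i y = (if i = 0 then 0
     else exp (- (\<bar>points (gap y) i\<bar> powr \<alpha>) - \<beta> * u (gmark y 0) (gmark y i)))"
  by (simp add: rate_def jump_rate_def env_of_gaps_def points_0)

lemma rate_nonneg: "0 \<le> rate \<alpha> u \<beta> i y"
  by (simp add: rate_eq)

definition energy ::
  "(int \<Rightarrow> real \<times> real) measure \<Rightarrow> real \<Rightarrow> (real \<Rightarrow> real \<Rightarrow> real) \<Rightarrow> real \<Rightarrow> ((int \<Rightarrow> real \<times> real) \<Rightarrow> real) \<Rightarrow> ennreal"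
  where "energy Q \<alpha> u \<beta> G = (\<integral>\<^sup>+ y. (\<Sum>\<^sub>\<infinity>i\<in>UNIV.
     ennreal (rate \<alpha> u \<beta> i y * (points (gap y) i + G (seq_shift i y) - G y)\<^sup>2)) \<partial>Q)"

lemma borel_measurable_infsum_int [measurable (raw)]:
  fixes f :: "int \<Rightarrow> 'b \<Rightarrow> ennreal"
  assumes [measurable]: "\<And>i. f i \<in> borel_measurable N"
  shows "(\<lambda>x. \<Sum>\<^sub>\<infinity>i\<in>UNIV. f i x) \<in> borel_measurable N"
proof -
  have "(\<Sum>\<^sub>\<infinity>i\<in>UNIV. f i x) = (\<Sum>n. f (int_decode n) x)" for x
  proof -
    have "(\<Sum>\<^sub>\<infinity>i\<in>UNIV. f i x) = (\<integral>\<^sup>+ n. f (int_decode n) x \<partial>count_space UNIV)"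
      unfolding infsum_int_eq_nn_integral
      by (rule nn_integral_bij_count_space[symmetric]) (rule bij_int_decode)
    then show ?thesis by (simp add: nn_integral_count_space_nat)
  qed
  then show ?thesis by simp
qed

text \<open>The interaction is only measurable on the square where the marks live, so the
  integrand in the energy is only almost everywhere equal to a measurable function. The left-hand
  side does not see the values of \<open>u\<close> off the square, which allows one to pass to a measurable
  interaction \<open>v\<close>. Environments and sequences of gaps determine each other, so both infima range
  over the same test functions.\<close>

lemma diffusion_coeff_eq_INF_energy:
  assumes Q: "sets Q = sets gap_seqs"
    and marks: "AE y in Q. \<forall>k. gmark y k \<in> {-1..1}"
    and v [measurable]: "(\<lambda>(a, b). v a b) \<in> borel_measurable (borel \<Otimes>\<^sub>M borel)"
    and uv: "\<And>a b. a \<in> {-1..1} \<Longrightarrow> b \<in> {-1..1} \<Longrightarrow> u a b = v a b"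
  shows "diffusion_coeff (distr Q gap_seqs env_of_gaps) \<alpha> u \<beta>
    = (INF G\<in>L_infinity Q. energy Q \<alpha> v \<beta> G)"
proof -
  note [measurable_cong] = Q
  let ?P = "distr Q gap_seqs env_of_gaps"
  have AE_P: "AE \<omega> in ?P. \<forall>k. mark \<omega> k \<in> {-1..1}"
    using marks by (subst AE_distr_iff) (simp_all add: env_of_gaps_def)
  define F where "F g \<omega> = (\<Sum>\<^sub>\<infinity>i\<in>UNIV.
      ennreal (jump_rate \<alpha> v \<beta> \<omega> 0 i * (pos \<omega> i + grad i g \<omega>)\<^sup>2))" for g \<omega>
  have es [measurable]: "env_shift i \<in> gap_seqs \<rightarrow>\<^sub>M gap_seqs" for i
    unfolding env_shift_def by (rule measurable_PiM_single') (auto simp: space_pair_measure)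
  have v' [measurable (raw)]: "(\<lambda>\<omega>. v (f \<omega>) (h \<omega>)) \<in> borel_measurable N"
    if [measurable]: "f \<in> borel_measurable N" "h \<in> borel_measurable N"
    for f h and N :: "env measure"
  proof -
    have "(\<lambda>\<omega>. (\<lambda>(a, b). v a b) (f \<omega>, h \<omega>)) \<in> borel_measurable N" by measurable
    then show ?thesis by simp
  qed
  have [measurable]: "F g \<in> borel_measurable gap_seqs" if [measurable]: "g \<in> borel_measurable gap_seqs" for g
    unfolding F_def grad_def jump_rate_def by measurable
  have eq: "(\<integral>\<^sup>+ \<omega>. (\<Sum>\<^sub>\<infinity>i\<in>UNIV.
      ennreal (jump_rate \<alpha> u \<beta> \<omega> 0 i * (pos \<omega> i + grad i g \<omega>)\<^sup>2)) \<partial>?P)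
      = energy Q \<alpha> v \<beta> (\<lambda>y. g (env_of_gaps y))"
    if [measurable]: "g \<in> borel_measurable gap_seqs" for g
  proof -
    have "(\<integral>\<^sup>+ \<omega>. (\<Sum>\<^sub>\<infinity>i\<in>UNIV.
        ennreal (jump_rate \<alpha> u \<beta> \<omega> 0 i * (pos \<omega> i + grad i g \<omega>)\<^sup>2)) \<partial>?P) = (\<integral>\<^sup>+ \<omega>. F g \<omega> \<partial>?P)"
      unfolding F_def
      by (rule nn_integral_cong_AE, rule AE_mp[OF AE_P], rule AE_I2) (auto simp: jump_rate_def uv intro!: infsum_cong)
    also have "\<dots> = (\<integral>\<^sup>+ y. F g (env_of_gaps y) \<partial>Q)"
      by (rule nn_integral_distr) simp_all
    also have "\<dots> = energy Q \<alpha> v \<beta> (\<lambda>y. g (env_of_gaps y))"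
      by (simp add: F_def energy_def rate_def grad_def env_shift_env_of_gaps add_diff_eq)
    finally show ?thesis .
  qed
  show ?thesis unfolding diffusion_coeff_def
  proof (rule antisym)
    show "(INF g\<in>L_infinity ?P. \<integral>\<^sup>+ \<omega>. (\<Sum>\<^sub>\<infinity>i\<in>UNIV.
        ennreal (jump_rate \<alpha> u \<beta> \<omega> 0 i * (pos \<omega> i + grad i g \<omega>)\<^sup>2)) \<partial>?P)
      \<le> (INF G\<in>L_infinity Q. energy Q \<alpha> v \<beta> G)"
    proof (rule INF_greatest)
      fix G assume "G \<in> L_infinity Q"
      then have [measurable]: "G \<in> borel_measurable gap_seqs" and bd: "\<exists>B. AE y in Q. \<bar>G y\<bar> \<le> B"
        by (auto simp: L_infinity_def measurable_cong_sets[OF Q refl])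
      let ?g = "\<lambda>\<omega>. G (gaps_of_env \<omega>)"
      have "?g \<in> L_infinity ?P"
      proof -
        obtain B where B: "AE y in Q. \<bar>G y\<bar> \<le> B" using bd by blast
        have "AE \<omega> in ?P. \<bar>?g \<omega>\<bar> \<le> B"
          by (subst AE_distr_iff) (simp_all add: gaps_of_env_of_gaps B)
        moreover have "?g \<in> borel_measurable ?P" by measurable
        ultimately show ?thesis unfolding L_infinity_def by blast
      qed
      moreover have "energy Q \<alpha> v \<beta> (\<lambda>y. ?g (env_of_gaps y)) = energy Q \<alpha> v \<beta> G"
        by (simp add: gaps_of_env_of_gaps)
      ultimately show "(INF g\<in>L_infinity ?P. \<integral>\<^sup>+ \<omega>. (\<Sum>\<^sub>\<infinity>i\<in>UNIV.
        ennreal (jump_rate \<alpha> u \<beta> \<omega> 0 i * (pos \<omega> i + grad i g \<omega>)\<^sup>2)) \<partial>?P) \<le> energy Q \<alpha> v \<beta> G"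
        using eq[of ?g] by (intro INF_lower2[of ?g]) auto
    qed
  next
    show "(INF G\<in>L_infinity Q. energy Q \<alpha> v \<beta> G) \<le> (INF g\<in>L_infinity ?P. \<integral>\<^sup>+ \<omega>. (\<Sum>\<^sub>\<infinity>i\<in>UNIV.
        ennreal (jump_rate \<alpha> u \<beta> \<omega> 0 i * (pos \<omega> i + grad i g \<omega>)\<^sup>2)) \<partial>?P)"
    proof (rule INF_greatest)
      fix g assume g: "g \<in> L_infinity ?P"
      then have [measurable]: "g \<in> borel_measurable gap_seqs"
        and "\<exists>B. AE \<omega> in ?P. \<bar>g \<omega>\<bar> \<le> B"
        by (auto simp: L_infinity_def)
      then obtain B where B: "AE \<omega> in ?P. \<bar>g \<omega>\<bar> \<le> B" by blast
      have "AE y in Q. \<bar>g (env_of_gaps y)\<bar> \<le> B"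
        using B by (subst (asm) AE_distr_iff) simp_all
      moreover have "(\<lambda>y. g (env_of_gaps y)) \<in> borel_measurable Q" by measurable
      ultimately have "(\<lambda>y. g (env_of_gaps y)) \<in> L_infinity Q"
        unfolding L_infinity_def by blast
      then show "(INF G\<in>L_infinity Q. energy Q \<alpha> v \<beta> G) \<le> (\<integral>\<^sup>+ \<omega>. (\<Sum>\<^sub>\<infinity>i\<in>UNIV.
        ennreal (jump_rate \<alpha> u \<beta> \<omega> 0 i * (pos \<omega> i + grad i g \<omega>)\<^sup>2)) \<partial>?P)"
        using eq[of g] by (intro INF_lower2[of "\<lambda>y. g (env_of_gaps y)"]) auto
    qed
  qed
qed

section \<open>Stationary environments and the lower bound\<close>

lemma points_of_nat: "points z (int n) = (\<Sum>k<n. z (int k))"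
proof (induction n)
  case 0
  show ?case by (simp add: points_0)
next
  case (Suc n)
  then show ?case using points_rec[of z "int n + 1"] by (simp add: add.commute)
qed

lemma ennreal_integral_le_nn_integral:
  assumes "integrable N f"
  shows "ennreal (\<integral>x. f x \<partial>N) \<le> (\<integral>\<^sup>+ x. ennreal (f x) \<partial>N)"
proof -
  have int: "integrable N (\<lambda>x. max 0 (f x))"
    using assms by (intro integrable_max) simp_all
  have "ennreal (\<integral>x. f x \<partial>N) \<le> ennreal (\<integral>x. max 0 (f x) \<partial>N)"
    using assms int by (intro ennreal_leI integral_mono) simp_all
  also have "\<dots> = (\<integral>\<^sup>+ x. ennreal (max 0 (f x)) \<partial>N)"
    using int by (intro nn_integral_eq_integral[symmetric]) simp_all
  also have "\<dots> = (\<integral>\<^sup>+ x. ennreal (f x) \<partial>N)"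
    by (intro nn_integral_cong) (simp add: max_def ennreal_neg)
  finally show ?thesis .
qed

locale stationary_gaps = prob_space Q for Q :: "(int \<Rightarrow> real \<times> real) measure" +
  fixes \<alpha> :: real and u :: "real \<Rightarrow> real \<Rightarrow> real" and c\<^sub>1 c\<^sub>2 :: real
  assumes sets_Q: "sets Q = sets gap_seqs"
    and shift_invariant: "distr Q gap_seqs (seq_shift 1) = Q"
    and gaps_pos: "AE y in Q. \<forall>k. 0 < gap y k"
    and gap_integrable: "integrable Q (\<lambda>y. gap y 0)"
    and marks_range: "AE y in Q. \<forall>k. gmark y k \<in> {-1..1}"
    and exponent_pos: "0 < \<alpha>"
    and u_measurable: "(\<lambda>(a, b). u a b) \<in> borel_measurable (borel \<Otimes>\<^sub>M borel)"
    and c\<^sub>1_pos: "0 < c\<^sub>1"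
    and u_lower: "\<And>a b. a \<in> {-1..1} \<Longrightarrow> b \<in> {-1..1} \<Longrightarrow> c\<^sub>1 * (\<bar>a\<bar> + \<bar>b\<bar>) \<le> u a b"
    and u_upper: "\<And>a b. a \<in> {-1..1} \<Longrightarrow> b \<in> {-1..1} \<Longrightarrow> u a b \<le> c\<^sub>2 * (\<bar>a\<bar> + \<bar>b\<bar>)"
begin

abbreviation nn_expectation :: "((int \<Rightarrow> real \<times> real) \<Rightarrow> ennreal) \<Rightarrow> ennreal" (binder "\<E>" 10)
  where "nn_expectation f \<equiv> integral\<^sup>N Q f"

lemmas [measurable_cong] = sets_Q

lemma u_measurable' [measurable (raw)]:
  assumes [measurable]: "f \<in> borel_measurable N" "h \<in> borel_measurable N"
  shows "(\<lambda>x. u (f x) (h x)) \<in> borel_measurable N"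
proof -
  note u_measurable [measurable]
  have "(\<lambda>x. (\<lambda>(a, b). u a b) (f x, h x)) \<in> borel_measurable N" by measurable
  then show ?thesis by simp
qed

abbreviation R :: "real \<Rightarrow> int \<Rightarrow> (int \<Rightarrow> real \<times> real) \<Rightarrow> real" where
  "R \<beta> i y \<equiv> rate \<alpha> u \<beta> i y"

lemma rate_measurable [measurable]: "R \<beta> i \<in> borel_measurable gap_seqs"
  unfolding rate_eq[abs_def] by measurable

lemma L_infinityD:
  assumes "G \<in> L_infinity Q"
  shows "G \<in> borel_measurable gap_seqs" and "\<exists>B. AE y in Q. \<bar>G y\<bar> \<le> B"
  using assms by (auto simp: L_infinity_def measurable_cong_sets[OF sets_Q refl])

lemma distr_shift: "distr Q gap_seqs (seq_shift i) = Q"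
proof -
  have *: "distr (distr Q gap_seqs (seq_shift i)) gap_seqs (seq_shift j) = distr Q gap_seqs (seq_shift (j + i))" for i j
    by (subst distr_distr) (simp_all add: comp_def)
  have id: "distr Q gap_seqs (seq_shift 0) = Q"
    using distr_id2[of gap_seqs Q] sets_Q by (simp add: seq_shift_0[abs_def])
  have inv: "distr Q gap_seqs (seq_shift (- 1)) = Q"
    using *[of 1 "-1"] shift_invariant id by simp
  show ?thesis
  proof (induction i rule: int_induct[where k = 0])
    case base
    show ?case by (rule id)
  next
    case (step1 i)
    then show ?case using *[of i 1] shift_invariant by (simp add: add.commute)
  next
    case (step2 i)
    then show ?case using *[of i "-1"] inv by simp
  qed
qed

lemma nn_integral_shift:
  assumes [measurable]: "f \<in> borel_measurable gap_seqs"
  shows "(\<E> y. f (seq_shift i y)) = (\<E> y. f y)"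
proof -
  have "(\<integral>\<^sup>+ y. f y \<partial>distr Q gap_seqs (seq_shift i)) = (\<E> y. f (seq_shift i y))"
    by (rule nn_integral_distr) simp_all
  then show ?thesis by (simp add: distr_shift)
qed

lemma integral_shift:
  fixes f :: "_ \<Rightarrow> real"
  assumes [measurable]: "f \<in> borel_measurable gap_seqs"
  shows "(\<integral>y. f (seq_shift i y) \<partial>Q) = (\<integral>y. f y \<partial>Q)"
proof -
  have "(\<integral>y. f y \<partial>distr Q gap_seqs (seq_shift i)) = (\<integral>y. f (seq_shift i y) \<partial>Q)"
    by (rule integral_distr) simp_all
  then show ?thesis by (simp add: distr_shift)
qed

lemma integrable_shift:
  fixes f :: "_ \<Rightarrow> real"
  assumes [measurable]: "f \<in> borel_measurable gap_seqs" and "integrable Q f"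
  shows "integrable Q (\<lambda>y. f (seq_shift i y))"
proof -
  have "integrable (distr Q gap_seqs (seq_shift i)) f = integrable Q (\<lambda>y. f (seq_shift i y))"
    by (rule integrable_distr_eq) simp_all
  with assms show ?thesis by (simp add: distr_shift)
qed

lemma AE_shift:
  assumes "AE y in Q. P y" and [measurable]: "Measurable.pred gap_seqs P"
  shows "AE y in Q. P (seq_shift i y)"
proof -
  have "AE y in distr Q gap_seqs (seq_shift i). P y" unfolding distr_shift by (rule assms)
  then show ?thesis by (subst (asm) AE_distr_iff) simp_all
qed

definition mean_gap :: real where "mean_gap = (\<integral>y. gap y 0 \<partial>Q)"

lemma mean_gap_pos: "0 < mean_gap"
proof -
  have "0 \<le> mean_gap" unfolding mean_gap_def
    using gaps_pos by (intro integral_nonneg_AE) (auto elim: eventually_mono simp: less_imp_le)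
  moreover have "mean_gap \<noteq> 0"
  proof
    assume "mean_gap = 0"
    then have "AE y in Q. gap y 0 = 0"
      unfolding mean_gap_def
      using gaps_pos
      by (subst (asm) integral_nonneg_eq_0_iff_AE[OF gap_integrable])
         (auto elim: eventually_mono simp: less_imp_le)
    with gaps_pos have "AE y in Q. False" by eventually_elim (metis less_irrefl)
    then show False by simp
  qed
  ultimately show ?thesis by simp
qed

text \<open>The diffusion coefficient, by \<open>diffusion_coeff_eq_INF_energy\<close>.\<close>

definition D :: "real \<Rightarrow> ennreal" where
  "D \<beta> = (INF G\<in>L_infinity Q. energy Q \<alpha> u \<beta> G)"

text \<open>The modified displacement across a single gap.\<close>

definition increment :: "((int \<Rightarrow> real \<times> real) \<Rightarrow> real) \<Rightarrow> (int \<Rightarrow> real \<times> real) \<Rightarrow> real" where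
  "increment G y = gap y 0 + G (seq_shift 1 y) - G y"

lemma increment_measurable [measurable]:
  assumes [measurable]: "G \<in> borel_measurable gap_seqs"
  shows "increment G \<in> borel_measurable gap_seqs"
  unfolding increment_def by measurable

text \<open>The modified displacement of a jump is the sum of the increments of the gaps that it crosses.\<close>

lemma points_increment:
  "points (\<lambda>k. increment G (seq_shift k y)) i = points (gap y) i + G (seq_shift i y) - G y"
  using points_coboundary[of "gap y" "\<lambda>k. G (seq_shift k y)" i]
  by (simp add: increment_def seq_shift_apply add.commute)

lemma integrable_bounded:
  fixes G :: "_ \<Rightarrow> real"
  assumes "G \<in> L_infinity Q"
  shows "integrable Q G"
proof -
  obtain B where "AE y in Q. \<bar>G y\<bar> \<le> B" and [measurable]: "G \<in> borel_measurable gap_seqs"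
    using L_infinityD[OF assms] by blast
  then show ?thesis by (intro integrable_const_bound[of _ B]) simp_all
qed

lemma increment_integrable:
  assumes "G \<in> L_infinity Q"
  shows "integrable Q (increment G)"
  unfolding increment_def
  using gap_integrable integrable_bounded[OF assms] integrable_shift L_infinityD[OF assms]
  by (intro Bochner_Integration.integrable_diff Bochner_Integration.integrable_add) simp_all

lemma integral_increment:
  assumes "G \<in> L_infinity Q"
  shows "(\<integral>y. increment G y \<partial>Q) = mean_gap"
  unfolding increment_def mean_gap_def
  using gap_integrable integrable_bounded[OF assms] integrable_shift L_infinityD[OF assms]
  by (simp add: integral_shift)

text \<open>This is Thomson's principle in its elementary direction. The weight \<open>\<theta> n\<close> is put on the jump from
  the origin to the point with label \<open>n\<close>; by stationarity \<open>\<theta> n \<circ> \<tau>\<^sub>-\<^sub>k\<close> is the weight of the jump of \<open>n\<close>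
  gaps for which the gap at the origin is the one with number \<open>k\<close>, and the double sum below is the total weight of
  the jumps over that gap. Only jumps of at most \<open>N\<close> gaps are used, so that all sums are finite,
  and \<open>N\<close> tends to infinity at the end.\<close>

theorem D_ge_flow:
  fixes \<theta> :: "nat \<Rightarrow> (int \<Rightarrow> real \<times> real) \<Rightarrow> real"
  assumes [measurable]: "\<And>n. \<theta> n \<in> borel_measurable gap_seqs"
    and \<theta>_nonneg: "\<And>n y. 0 \<le> \<theta> n y" and \<theta>_le_1: "\<And>n y. \<theta> n y \<le> 1"
    and traffic_le_1: "\<And>N. AE y in Q. (\<Sum>n\<in>{1..N}. \<Sum>k<n. \<theta> n (seq_shift (- int k) y)) \<le> 1"
    and traffic_lim: "AE y in Q. (\<lambda>N. \<Sum>n\<in>{1..N}. \<Sum>k<n. \<theta> n (seq_shift (- int k) y)) \<longlonglongrightarrow> 1"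
    and K: "0 < K" "\<And>N. (\<Sum>n\<in>{1..N}. \<E> y. ennreal (\<theta> n y / R \<beta> (int n) y)) \<le> ennreal K"
  shows "ennreal (mean_gap\<^sup>2 / K) \<le> D \<beta>"
  unfolding D_def
proof (rule INF_greatest)
  fix G assume G: "G \<in> L_infinity Q"
  note [measurable] = L_infinityD(1)[OF G]
  let ?a = "increment G"
  let ?X = "\<lambda>n y. points (gap y) (int n) + G (seq_shift (int n) y) - G y"
  let ?M = "\<lambda>N y. \<Sum>n\<in>{1..N}. \<Sum>k<n. \<theta> n (seq_shift (- int k) y)"
  let ?F = "\<lambda>y. \<Sum>\<^sub>\<infinity>i\<in>UNIV. ennreal (R \<beta> i y * (points (gap y) i + G (seq_shift i y) - G y)\<^sup>2)"
  have a_int: "integrable Q ?a" by (rule increment_integrable[OF G])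
  have prod_int: "integrable Q (\<lambda>y. \<theta> n (seq_shift i y) * ?a (seq_shift j y))" for n i j
    by (rule Bochner_Integration.integrable_bound[OF integrable_shift[OF _ a_int, of j]])
       (auto simp: abs_mult \<theta>_nonneg \<theta>_le_1 intro!: mult_left_le_one_le)
  have X: "?X n y = (\<Sum>k<n. ?a (seq_shift (int k) y))" for n y
    using points_increment[of G y "int n"] points_of_nat[of "\<lambda>k. ?a (seq_shift k y)" n] by simp
  have sum_int: "integrable Q (\<lambda>y. \<Sum>n\<in>{1..N}. \<theta> n y * ?X n y)" for N
    unfolding X sum_distrib_left
    using prod_int[of _ 0] by (intro Bochner_Integration.integrable_sum) simp
  \<comment> \<open>Moving each increment to the origin turns the flow through jumps into the traffic over one gap.\<close>
  have flow: "(\<integral>y. (\<Sum>n\<in>{1..N}. \<theta> n y * ?X n y) \<partial>Q) = (\<integral>y. ?M N y * ?a y \<partial>Q)" for N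
  proof -
    have "(\<integral>y. \<theta> n y * ?a (seq_shift (int k) y) \<partial>Q)
        = (\<integral>y. \<theta> n (seq_shift (- int k) y) * ?a y \<partial>Q)" for n k
      using integral_shift[of "\<lambda>y. \<theta> n (seq_shift (- int k) y) * ?a y" "int k"] by simp
    then show ?thesis
      unfolding X sum_distrib_left sum_distrib_right
      using prod_int[of _ 0] prod_int[of _ _ 0]
      by (subst Bochner_Integration.integral_sum, simp,
          subst Bochner_Integration.integral_sum, simp,
          subst Bochner_Integration.integral_sum, simp,
          subst Bochner_Integration.integral_sum) simp_all
  qed
  have lim: "(\<lambda>N. \<integral>y. ?M N y * ?a y \<partial>Q) \<longlonglongrightarrow> (\<integral>y. 1 * ?a y \<partial>Q)"
  proof (rule integral_dominated_convergence[where w = "\<lambda>y. \<bar>?a y\<bar>"])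
    show "AE y in Q. (\<lambda>N. ?M N y * ?a y) \<longlonglongrightarrow> 1 * ?a y"
      using traffic_lim by eventually_elim (rule tendsto_mult_right)
    show "AE y in Q. norm (?M N y * ?a y) \<le> \<bar>?a y\<bar>" for N
      using traffic_le_1[of N]
      by eventually_elim
         (auto simp: abs_mult intro!: mult_left_le_one_le sum_nonneg abs_leI \<theta>_nonneg
            intro: order_trans[of _ 0])
  qed (use a_int in simp_all)
  \<comment> \<open>The Cauchy-Schwarz inequality in linearised form; \<open>t\<close> is optimised at the end.\<close>
  have key: "ennreal (2 * t * mean_gap) \<le> (\<E> y. ?F y) + ennreal (t\<^sup>2 * K)" for t
  proof -
    have step: "ennreal (2 * t * (\<integral>y. ?M N y * ?a y \<partial>Q)) \<le> (\<E> y. ?F y) + ennreal (t\<^sup>2 * K)" for N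
    proof -
      have pt: "2 * t * (\<theta> n y * ?X n y) \<le> R \<beta> (int n) y * (?X n y)\<^sup>2 + t\<^sup>2 * (\<theta> n y / R \<beta> (int n) y)"
        if "n \<in> {1..N}" for n y
      proof -
        let ?c = "R \<beta> (int n) y"
        have c: "0 < ?c" using that by (simp add: rate_eq)
        have "0 \<le> (?c * ?X n y - t * \<theta> n y)\<^sup>2 / ?c" using c by simp
        also have "\<dots> = ?c * (?X n y)\<^sup>2 + t\<^sup>2 * ((\<theta> n y)\<^sup>2 / ?c) - 2 * t * (\<theta> n y * ?X n y)"
          using c by (simp add: power2_eq_square field_simps)
        finally have "2 * t * (\<theta> n y * ?X n y) \<le> ?c * (?X n y)\<^sup>2 + t\<^sup>2 * ((\<theta> n y)\<^sup>2 / ?c)" by simp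
        moreover have "(\<theta> n y)\<^sup>2 \<le> \<theta> n y"
          using \<theta>_nonneg[of n y] \<theta>_le_1[of n y]
          by (simp add: power2_eq_square mult_left_le_one_le)
        then have "t\<^sup>2 * ((\<theta> n y)\<^sup>2 / ?c) \<le> t\<^sup>2 * (\<theta> n y / ?c)"
          using c by (intro mult_left_mono divide_right_mono) simp_all
        ultimately show ?thesis by linarith
      qed
      have "ennreal (2 * t * (\<integral>y. ?M N y * ?a y \<partial>Q)) = ennreal (\<integral>y. 2 * t * (\<Sum>n\<in>{1..N}. \<theta> n y * ?X n y) \<partial>Q)"
        by (simp only: flow[symmetric] integral_mult_right_zero)
      also have "\<dots> \<le> (\<E> y. ennreal (2 * t * (\<Sum>n\<in>{1..N}. \<theta> n y * ?X n y)))"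
        using sum_int by (intro ennreal_integral_le_nn_integral) simp
      also have "\<dots> \<le> (\<E> y. ?F y + (\<Sum>n\<in>{1..N}. ennreal (t\<^sup>2) * ennreal (\<theta> n y / R \<beta> (int n) y)))"
      proof (rule nn_integral_mono)
        fix y
        have "2 * t * (\<Sum>n\<in>{1..N}. \<theta> n y * ?X n y)
            \<le> (\<Sum>n\<in>{1..N}. R \<beta> (int n) y * (?X n y)\<^sup>2) + (\<Sum>n\<in>{1..N}. t\<^sup>2 * (\<theta> n y / R \<beta> (int n) y))"
          unfolding sum_distrib_left sum.distrib[symmetric] by (rule sum_mono) (rule pt)
        then have "ennreal (2 * t * (\<Sum>n\<in>{1..N}. \<theta> n y * ?X n y))
            \<le> ennreal ((\<Sum>n\<in>{1..N}. R \<beta> (int n) y * (?X n y)\<^sup>2) + (\<Sum>n\<in>{1..N}. t\<^sup>2 * (\<theta> n y / R \<beta> (int n) y)))"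
          by (rule ennreal_leI)
        also have "\<dots> = ennreal (\<Sum>n\<in>{1..N}. R \<beta> (int n) y * (?X n y)\<^sup>2)
            + ennreal (\<Sum>n\<in>{1..N}. t\<^sup>2 * (\<theta> n y / R \<beta> (int n) y))"
          by (intro ennreal_plus sum_nonneg) (simp_all add: rate_nonneg \<theta>_nonneg)
        also have "\<dots> = (\<Sum>n\<in>{1..N}. ennreal (R \<beta> (int n) y * (?X n y)\<^sup>2))
            + (\<Sum>n\<in>{1..N}. ennreal (t\<^sup>2) * ennreal (\<theta> n y / R \<beta> (int n) y))"
          by (simp add: rate_nonneg \<theta>_nonneg ennreal_mult[symmetric])
        also have "(\<Sum>n\<in>{1..N}. ennreal (R \<beta> (int n) y * (?X n y)\<^sup>2))
            = (\<Sum>i\<in>int ` {1..N}. ennreal (R \<beta> i y * (points (gap y) i + G (seq_shift i y) - G y)\<^sup>2))"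
          by (subst sum.reindex) simp_all
        also have "\<dots> \<le> ?F y" by (rule finite_sum_le_infsum_int) simp
        finally show "ennreal (2 * t * (\<Sum>n\<in>{1..N}. \<theta> n y * ?X n y))
            \<le> ?F y + (\<Sum>n\<in>{1..N}. ennreal (t\<^sup>2) * ennreal (\<theta> n y / R \<beta> (int n) y))"
          by (simp add: add_right_mono)
      qed
      also have "\<dots> = (\<E> y. ?F y)
          + ennreal (t\<^sup>2) * (\<Sum>n\<in>{1..N}. \<E> y. ennreal (\<theta> n y / R \<beta> (int n) y))"
        by (simp add: nn_integral_add nn_integral_sum nn_integral_cmult sum_distrib_left)
      also have "\<dots> \<le> (\<E> y. ?F y) + ennreal (t\<^sup>2) * ennreal K"
        by (intro add_left_mono mult_left_mono K) simp
      finally show ?thesis by (simp add: ennreal_mult' )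
    qed
    have "(\<lambda>N. ennreal (2 * t * (\<integral>y. ?M N y * ?a y \<partial>Q))) \<longlonglongrightarrow> ennreal (2 * t * mean_gap)"
      using lim integral_increment[OF G] by (intro tendsto_ennrealI tendsto_mult_left) simp
    then show ?thesis
      by (rule LIMSEQ_le_const2) (use step in blast)
  qed
  show "ennreal (mean_gap\<^sup>2 / K) \<le> energy Q \<alpha> u \<beta> G"
  proof (cases "energy Q \<alpha> u \<beta> G")
    case (real r)
    have "ennreal (2 * (mean_gap / K) * mean_gap) \<le> ennreal (r + (mean_gap / K)\<^sup>2 * K)"
      using key[of "mean_gap / K"] real K(1) by (simp add: energy_def)
    then have "2 * (mean_gap / K) * mean_gap \<le> r + (mean_gap / K)\<^sup>2 * K"
      using real K(1) by (subst (asm) ennreal_le_iff) simp_all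
    then have "mean_gap\<^sup>2 / K \<le> r"
      using K(1) by (simp add: power2_eq_square field_simps)
    then show ?thesis using real by (simp add: ennreal_leI)
  qed simp
qed

lemma inverse_rate_le:
  assumes "0 \<le> \<beta>" "i \<noteq> 0" "\<forall>k. gmark y k \<in> {-1..1}" "\<bar>gmark y 0\<bar> \<le> e" "\<bar>gmark y i\<bar> \<le> e"
  shows "1 / R \<beta> i y \<le> exp (\<bar>points (gap y) i\<bar> powr \<alpha> + 2 * c\<^sub>2 * (\<beta> * e))"
proof -
  have "0 \<le> c\<^sub>2" using u_lower[of 1 1] u_upper[of 1 1] c\<^sub>1_pos by simp
  then have "u (gmark y 0) (gmark y i) \<le> c\<^sub>2 * (2 * e)"
    using assms u_upper[of "gmark y 0" "gmark y i"]
      mult_left_mono[of "\<bar>gmark y 0\<bar> + \<bar>gmark y i\<bar>" "2 * e" c\<^sub>2] by force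
  then have "\<beta> * u (gmark y 0) (gmark y i) \<le> \<beta> * (c\<^sub>2 * (2 * e))"
    using assms(1) by (rule mult_left_mono)
  then show ?thesis
    using assms(2) by (simp add: rate_eq exp_minus[symmetric] divide_inverse algebra_simps)
qed

text \<open>The flow of weight one on the jumps to the right neighbour. The marks contribute at most a
  factor \<open>exp (2 c\<^sub>2 \<beta>)\<close> to the resistance.\<close>

theorem D_ge_nearest_neighbour:
  assumes "(\<E> y. ennreal (exp (gap y 0 powr \<alpha>))) < \<infinity>"
  shows "\<exists>C>0. \<exists>\<kappa>>0. \<forall>\<beta>\<ge>0. ennreal (C * exp (- \<kappa> * \<beta>)) \<le> D \<beta>"
proof -
  define L where "L = enn2real (\<E> y. ennreal (exp (gap y 0 powr \<alpha>)))"
  have L: "(\<E> y. ennreal (exp (gap y 0 powr \<alpha>))) = ennreal L"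
    using assms by (simp add: L_def)
  have "ennreal 1 \<le> (\<E> y. ennreal (exp (gap y 0 powr \<alpha>)))"
    using nn_integral_mono[of Q "\<lambda>_. 1" "\<lambda>y. ennreal (exp (gap y 0 powr \<alpha>))"]
    by (simp add: emeasure_space_1)
  then have L1: "1 \<le> L" unfolding L by (metis L_def enn2real_nonneg ennreal_le_iff)
  have c2: "0 < c\<^sub>2" using u_lower[of 1 1] u_upper[of 1 1] c\<^sub>1_pos by simp
  have "ennreal (mean_gap\<^sup>2 / L * exp (- (2 * c\<^sub>2) * \<beta>)) \<le> D \<beta>" if \<beta>: "0 \<le> \<beta>" for \<beta>
  proof -
    define \<theta> :: "nat \<Rightarrow> (int \<Rightarrow> real \<times> real) \<Rightarrow> real" where "\<theta> n y = (if n = 1 then 1 else 0)" for n y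
    have traffic: "(\<Sum>n\<in>{1..N}. \<Sum>k<n. \<theta> n (seq_shift (- int k) y)) = (if 1 \<le> N then 1 else 0)" for N y
    proof -
      have "(\<Sum>n\<in>{1..N}. \<Sum>k<n. \<theta> n (seq_shift (- int k) y)) = (\<Sum>n\<in>{1..N}. if n = 1 then 1 else 0)"
        by (rule sum.cong) (simp_all add: \<theta>_def)
      then show ?thesis by simp
    qed
    let ?K = "L * exp (2 * c\<^sub>2 * \<beta>)"
    have "ennreal (mean_gap\<^sup>2 / ?K) \<le> D \<beta>"
    proof (rule D_ge_flow[where \<theta> = \<theta>])
      show "AE y in Q. (\<lambda>N. \<Sum>n\<in>{1..N}. \<Sum>k<n. \<theta> n (seq_shift (- int k) y)) \<longlonglongrightarrow> 1"
        unfolding traffic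
        by (intro AE_I2 tendsto_eventually eventually_sequentiallyI[of 1]) simp
      show "AE y in Q. (\<Sum>n\<in>{1..N}. \<Sum>k<n. \<theta> n (seq_shift (- int k) y)) \<le> 1" for N
        unfolding traffic by simp
      show "0 < ?K" using L1 by simp
      show "(\<Sum>n\<in>{1..N}. \<E> y. ennreal (\<theta> n y / R \<beta> (int n) y)) \<le> ennreal ?K" for N
      proof -
        have "(\<E> y. ennreal (1 / R \<beta> 1 y))
            \<le> (\<E> y. ennreal (exp (gap y 0 powr \<alpha>)) * ennreal (exp (2 * c\<^sub>2 * \<beta>)))"
        proof (rule nn_integral_mono_AE)
          show "AE y in Q. ennreal (1 / R \<beta> 1 y)
              \<le> ennreal (exp (gap y 0 powr \<alpha>)) * ennreal (exp (2 * c\<^sub>2 * \<beta>))"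
            using gaps_pos marks_range
          proof eventually_elim
            case (elim y)
            have "points (gap y) 1 = gap y 0" using points_of_nat[of "gap y" 1] by simp
            moreover have "\<bar>gmark y 0\<bar> \<le> 1" "\<bar>gmark y 1\<bar> \<le> 1"
              using elim(2)[rule_format, of 0] elim(2)[rule_format, of 1] by auto
            ultimately have "1 / R \<beta> 1 y \<le> exp (gap y 0 powr \<alpha> + 2 * c\<^sub>2 * (\<beta> * 1))"
              using inverse_rate_le[OF \<beta>, of 1 y 1] elim(1)[rule_format, of 0] elim(2) by simp
            then show ?case by (simp add: ennreal_mult[symmetric] exp_add[symmetric] ennreal_leI)
          qed
        qed
        also have "\<dots> = ennreal ?K"
          using L1 by (subst nn_integral_multc) (simp_all add: L ennreal_mult)
        finally have *: "(\<E> y. ennreal (1 / R \<beta> 1 y)) \<le> ennreal ?K" .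
        have "(\<Sum>n\<in>{1..N}. \<E> y. ennreal (\<theta> n y / R \<beta> (int n) y))
            = (\<Sum>n\<in>{1..N}. if n = 1 then (\<E> y. ennreal (1 / R \<beta> 1 y)) else 0)"
          by (rule sum.cong) (simp_all add: \<theta>_def)
        then show ?thesis using * by simp
      qed
    qed (simp_all add: \<theta>_def[abs_def])
    then show ?thesis by (simp add: exp_minus field_simps)
  qed
  moreover have "0 < mean_gap\<^sup>2 / L" using L1 mean_gap_pos by simp
  ultimately show ?thesis using c2 by (intro exI[of _ "mean_gap\<^sup>2 / L"] conjI exI[of _ "2 * c\<^sub>2"]) simp_all
qed

end

section \<open>Stretched exponentials\<close>

text \<open>With \<open>N \<ge> p / a\<close> and \<open>t = \<kappa> x\<^sup>a\<close>, the power \<open>x\<^sup>p\<close> is at most a constant times \<open>t\<^sup>N\<close> for \<open>x \<ge> 1\<close>, and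
  \<open>(t / N)\<^sup>N \<le> exp t\<close>.\<close>

lemma power_times_stretched_exp_bounded:
  fixes \<kappa> a :: real and p :: nat
  assumes "0 < \<kappa>" "0 < a"
  shows "\<exists>C>0. \<forall>x\<ge>0. x ^ p * exp (- \<kappa> * x powr a) \<le> C"
proof -
  obtain N :: nat where N: "real p / a + 1 \<le> real N" by (meson real_arch_simple)
  have "0 \<le> real p / a" using assms by simp
  then have N0: "0 < N" using N by (cases "N = 0") simp_all
  let ?C = "max 1 ((real N / \<kappa>) ^ N)"
  have "x ^ p * exp (- \<kappa> * x powr a) \<le> ?C" if x: "0 \<le> x" for x
  proof (cases "x \<le> 1")
    case True
    have "x ^ p * exp (- \<kappa> * x powr a) \<le> 1 * 1"
      using x True assms by (intro mult_mono power_le_one) simp_all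
    then show ?thesis by simp
  next
    case False
    let ?t = "\<kappa> * x powr a"
    have "real p / a \<le> real N" using N by simp
    then have pN: "real p \<le> a * real N" using assms(2) by (simp add: field_simps)
    have "x ^ p = x powr real p" using False by (simp add: powr_realpow)
    also have "\<dots> \<le> x powr (a * real N)" using False pN by (intro powr_mono) simp_all
    also have "\<dots> = (x powr a) ^ N" using False by (simp add: powr_powr[symmetric] powr_realpow)
    also have "\<dots> = (real N / \<kappa>) ^ N * (?t / real N) ^ N"
      using N0 assms by (simp add: power_mult_distrib[symmetric])
    also have "\<dots> \<le> (real N / \<kappa>) ^ N * exp (?t / real N) ^ N"
    proof (intro mult_left_mono power_mono)
      show "?t / real N \<le> exp (?t / real N)"
        using exp_ge_add_one_self[of "?t / real N"] by linarith
    qed (use assms in simp_all)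
    also have "exp (?t / real N) ^ N = exp ?t" using N0 by (simp add: exp_of_nat_mult[symmetric])
    finally have "x ^ p * exp (- ?t) \<le> (real N / \<kappa>) ^ N * exp ?t * exp (- ?t)"
      by (intro mult_right_mono) simp_all
    also have "\<dots> = (real N / \<kappa>) ^ N" by (simp add: exp_minus field_simps)
    finally show ?thesis by simp
  qed
  then show ?thesis by (intro exI[of _ ?C]) auto
qed

lemma summable_square_stretched_exp:
  fixes \<kappa> a :: real
  assumes "0 < \<kappa>" "0 < a"
  shows "summable (\<lambda>n. (real n)\<^sup>2 * exp (- \<kappa> * real n powr a))"
proof -
  obtain C where C: "0 < C" "\<And>x. 0 \<le> x \<Longrightarrow> x ^ 4 * exp (- \<kappa> * x powr a) \<le> C"
    using power_times_stretched_exp_bounded[OF assms, of 4] by blast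
  show ?thesis
  proof (rule summable_comparison_test_ev)
    show "summable (\<lambda>n. C * (1 / (real n)\<^sup>2))"
      using inverse_power_summable[of 2, where 'a = real]
      by (intro summable_mult) (simp add: inverse_eq_divide)
    show "eventually (\<lambda>n. norm ((real n)\<^sup>2 * exp (- \<kappa> * real n powr a)) \<le> C * (1 / (real n)\<^sup>2)) sequentially"
    proof (rule eventually_sequentiallyI[of 1])
      fix n :: nat assume "1 \<le> n"
      then have "(real n)\<^sup>2 * exp (- \<kappa> * real n powr a) = (real n ^ 4 * exp (- \<kappa> * real n powr a)) / (real n)\<^sup>2"
        by (simp add: field_simps flip: power_add)
      also have "\<dots> \<le> C / (real n)\<^sup>2"
        using C(2)[of "real n"] by (intro divide_right_mono) simp_all
      finally show "norm ((real n)\<^sup>2 * exp (- \<kappa> * real n powr a)) \<le> C * (1 / (real n)\<^sup>2)" by simp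
    qed
  qed
qed

lemma nn_integral_int_stretched_exp_finite:
  fixes \<kappa> a :: real
  assumes "0 < \<kappa>" "0 < a"
  shows "(\<integral>\<^sup>+ i. ennreal ((real_of_int i)\<^sup>2 * exp (- \<kappa> * real (nat \<bar>i\<bar>) powr a)) \<partial>count_space UNIV) < \<infinity>"
proof -
  have "(real_of_int i)\<^sup>2 = (real (nat \<bar>i\<bar>))\<^sup>2" for i by simp
  then show ?thesis
    using nn_integral_int_abs_finite[OF summable_square_stretched_exp[OF assms]] by simp
qed

section \<open>Splitting jumps into the gaps they cross\<close>

context stationary_gaps
begin

text \<open>The energy of the stationary increments \<open>h\<close> in the network in which a jump over \<open>n\<close> gaps is
  replaced by \<open>n\<close> resistors in series, one for each gap. The increments need not come from a
  corrector.\<close>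

definition crossing_energy :: "real \<Rightarrow> ((int \<Rightarrow> real \<times> real) \<Rightarrow> real) \<Rightarrow> ennreal" where
  "crossing_energy \<beta> h = (\<integral>\<^sup>+ i. (\<Sum>k\<in>crossed i.
     \<E> y. ennreal (real_of_int \<bar>i\<bar> * (R \<beta> i y * (h (seq_shift k y))\<^sup>2))) \<partial>count_space UNIV)"

lemma energy_le_crossing_energy:
  assumes [measurable]: "G \<in> borel_measurable gap_seqs"
  shows "energy Q \<alpha> u \<beta> G \<le> crossing_energy \<beta> (increment G)"
proof -
  have "energy Q \<alpha> u \<beta> G = (\<integral>\<^sup>+ i. \<integral>\<^sup>+ y.
      ennreal (R \<beta> i y * (points (gap y) i + G (seq_shift i y) - G y)\<^sup>2) \<partial>Q \<partial>count_space UNIV)"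
    unfolding energy_def infsum_int_eq_nn_integral
    by (rule nn_integral_count_space_nn_integral) simp_all
  also have "\<dots> \<le> crossing_energy \<beta> (increment G)"
    unfolding crossing_energy_def
  proof (rule nn_integral_mono)
    fix i :: int
    let ?a = "\<lambda>k y. increment G (seq_shift k y)"
    have "(\<E> y. ennreal (R \<beta> i y * (points (gap y) i + G (seq_shift i y) - G y)\<^sup>2))
        \<le> (\<E> y. (\<Sum>k\<in>crossed i. ennreal (real_of_int \<bar>i\<bar> * (R \<beta> i y * (?a k y)\<^sup>2))))"
    proof (rule nn_integral_mono)
      fix y
      have "R \<beta> i y * (points (gap y) i + G (seq_shift i y) - G y)\<^sup>2
          \<le> R \<beta> i y * (real_of_int \<bar>i\<bar> * (\<Sum>k\<in>crossed i. (?a k y)\<^sup>2))"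
        unfolding points_increment[symmetric]
        by (intro mult_left_mono points_square_le rate_nonneg)
      also have "\<dots> = (\<Sum>k\<in>crossed i. real_of_int \<bar>i\<bar> * (R \<beta> i y * (?a k y)\<^sup>2))"
        by (simp add: sum_distrib_left mult_ac)
      finally show "ennreal (R \<beta> i y * (points (gap y) i + G (seq_shift i y) - G y)\<^sup>2)
          \<le> (\<Sum>k\<in>crossed i. ennreal (real_of_int \<bar>i\<bar> * (R \<beta> i y * (?a k y)\<^sup>2)))"
        by (subst sum_ennreal) (simp_all add: rate_nonneg ennreal_leI)
    qed
    also have "\<dots> = (\<Sum>k\<in>crossed i. \<E> y. ennreal (real_of_int \<bar>i\<bar> * (R \<beta> i y * (?a k y)\<^sup>2)))"
      by (rule nn_integral_sum) simp
    finally show "(\<E> y. ennreal (R \<beta> i y * (points (gap y) i + G (seq_shift i y) - G y)\<^sup>2)) \<le> \<dots>" .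
  qed
  finally show ?thesis .
qed

lemma crossing_energy_mono:
  assumes "\<And>y. \<bar>h y\<bar> \<le> \<bar>h' y\<bar>"
  shows "crossing_energy \<beta> h \<le> crossing_energy \<beta> h'"
  unfolding crossing_energy_def
  by (intro nn_integral_mono sum_mono ennreal_leI mult_left_mono)
     (simp_all add: rate_nonneg assms abs_le_square_iff[symmetric])

lemma crossing_energy_add3:
  assumes [measurable]: "f \<in> borel_measurable gap_seqs" "g \<in> borel_measurable gap_seqs" "h \<in> borel_measurable gap_seqs"
  shows "crossing_energy \<beta> (\<lambda>y. f y + g y + h y)
    \<le> 3 * (crossing_energy \<beta> f + crossing_energy \<beta> g + crossing_energy \<beta> h)"
proof -
  let ?t = "\<lambda>i k y w. ennreal (real_of_int \<bar>i\<bar> * (R \<beta> i y * (w (seq_shift k y))\<^sup>2))"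
  have pt: "?t i k y (\<lambda>y. f y + g y + h y) \<le> 3 * (?t i k y f + ?t i k y g + ?t i k y h)" for i k y
  proof -
    have sq: "(a + b + c)\<^sup>2 \<le> 3 * (a\<^sup>2 + b\<^sup>2 + c\<^sup>2)" for a b c :: real
    proof -
      have "0 \<le> (a - b)\<^sup>2 + (a - c)\<^sup>2 + (b - c)\<^sup>2" by simp
      then show ?thesis by (simp add: power2_eq_square algebra_simps)
    qed
    let ?c = "real_of_int \<bar>i\<bar> * R \<beta> i y"
    have "?c * (f (seq_shift k y) + g (seq_shift k y) + h (seq_shift k y))\<^sup>2
        \<le> ?c * (3 * ((f (seq_shift k y))\<^sup>2 + (g (seq_shift k y))\<^sup>2 + (h (seq_shift k y))\<^sup>2))"
      by (intro mult_left_mono sq) (simp add: rate_nonneg)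
    then have "ennreal (?c * (f (seq_shift k y) + g (seq_shift k y) + h (seq_shift k y))\<^sup>2)
        \<le> ennreal (3 * (?c * (f (seq_shift k y))\<^sup>2 + ?c * (g (seq_shift k y))\<^sup>2 + ?c * (h (seq_shift k y))\<^sup>2))"
      by (intro ennreal_leI) (simp add: algebra_simps)
    also have "\<dots> = 3 * (ennreal (?c * (f (seq_shift k y))\<^sup>2) + ennreal (?c * (g (seq_shift k y))\<^sup>2) + ennreal (?c * (h (seq_shift k y))\<^sup>2))"
      by (simp add: rate_nonneg ennreal_mult)
    finally show ?thesis by (simp add: mult.assoc)
  qed
  have "crossing_energy \<beta> (\<lambda>y. f y + g y + h y)
      \<le> (\<integral>\<^sup>+ i. (\<Sum>k\<in>crossed i. \<E> y. 3 * (?t i k y f + ?t i k y g + ?t i k y h)) \<partial>count_space UNIV)"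
    unfolding crossing_energy_def by (intro nn_integral_mono sum_mono pt)
  also have "\<dots> = (\<integral>\<^sup>+ i. 3 * ((\<Sum>k\<in>crossed i. \<E> y. ?t i k y f)
      + (\<Sum>k\<in>crossed i. \<E> y. ?t i k y g) + (\<Sum>k\<in>crossed i. \<E> y. ?t i k y h)) \<partial>count_space UNIV)"
    by (subst nn_integral_cmult, simp, subst nn_integral_add, simp, simp, subst nn_integral_add, simp, simp)
       (simp add: sum.distrib sum_distrib_left)
  also have "\<dots> = 3 * (crossing_energy \<beta> f + crossing_energy \<beta> g + crossing_energy \<beta> h)"
    unfolding crossing_energy_def
    by (subst nn_integral_cmult, simp, subst nn_integral_add, simp, simp, subst nn_integral_add, simp, simp, simp)
  finally show ?thesis .
qed

lemma crossing_energy_le: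
  assumes "\<And>i k. k \<in> crossed i \<Longrightarrow> (\<E> y. ennreal (R \<beta> i y * (h (seq_shift k y))\<^sup>2)) \<le> F i"
    and [measurable]: "h \<in> borel_measurable gap_seqs"
  shows "crossing_energy \<beta> h \<le> (\<integral>\<^sup>+ i. ennreal ((real_of_int i)\<^sup>2) * F i \<partial>count_space UNIV)"
  unfolding crossing_energy_def
proof (rule nn_integral_mono)
  fix i :: int
  have "(\<Sum>k\<in>crossed i. \<E> y. ennreal (real_of_int \<bar>i\<bar> * (R \<beta> i y * (h (seq_shift k y))\<^sup>2)))
      = (\<Sum>k\<in>crossed i. ennreal (real_of_int \<bar>i\<bar>) * (\<E> y. ennreal (R \<beta> i y * (h (seq_shift k y))\<^sup>2)))"
    by (rule sum.cong[OF refl], subst ennreal_mult) (simp_all add: rate_nonneg nn_integral_cmult)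
  also have "\<dots> \<le> (\<Sum>k\<in>crossed i. ennreal (real_of_int \<bar>i\<bar>) * F i)"
    by (intro sum_mono mult_left_mono assms) simp_all
  also have "\<dots> = of_nat (card (crossed i)) * (ennreal (real_of_int \<bar>i\<bar>) * F i)" by simp
  also have "of_nat (card (crossed i)) = ennreal (real_of_int \<bar>i\<bar>)"
    by (simp add: card_crossed ennreal_of_nat_eq_real_of_nat)
  also have "ennreal (real_of_int \<bar>i\<bar>) * (ennreal (real_of_int \<bar>i\<bar>) * F i) = ennreal ((real_of_int i)\<^sup>2) * F i"
    by (simp add: mult.assoc[symmetric] ennreal_mult[symmetric] power2_eq_square)
  finally show "(\<Sum>k\<in>crossed i. \<E> y. ennreal (real_of_int \<bar>i\<bar> * (R \<beta> i y * (h (seq_shift k y))\<^sup>2)))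
      \<le> ennreal ((real_of_int i)\<^sup>2) * F i" .
qed

lemma u_nonneg: "\<forall>k. gmark y k \<in> {-1..1} \<Longrightarrow> 0 \<le> u (gmark y i) (gmark y j)"
  using u_lower[of "gmark y i" "gmark y j"] c\<^sub>1_pos
  by (meson abs_ge_zero add_nonneg_nonneg mult_nonneg_nonneg less_imp_le order_trans)

lemma abs_points_eq_sum:
  assumes "\<forall>k. 0 < gap y k"
  shows "\<bar>points (gap y) i\<bar> = (\<Sum>k\<in>crossed i. gap y k)"
proof -
  have "0 \<le> (\<Sum>k\<in>crossed i. gap y k)" using assms by (intro sum_nonneg) (simp add: less_imp_le)
  then show ?thesis by (simp add: points_eq_sum_crossed)
qed

lemma rate_le_exp_sum:
  assumes "\<forall>k. 0 < gap y k" "\<forall>k. gmark y k \<in> {-1..1}" "0 \<le> \<beta>"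
  shows "R \<beta> i y \<le> exp (- ((\<Sum>k\<in>crossed i. gap y k) powr \<alpha>))"
  using u_nonneg[OF assms(2), of 0 i] assms(3)
  by (simp add: rate_eq abs_points_eq_sum[OF assms(1)])

lemma rate_le_1: "AE y in Q. R \<beta> i y \<le> 1" if "0 \<le> \<beta>" for \<beta> i
  using gaps_pos marks_range
proof eventually_elim
  case (elim y)
  show ?case using rate_le_exp_sum[OF elim that, of i] by (rule order_trans) simp
qed

section \<open>Averages along the orbit\<close>

definition cesaro :: "((int \<Rightarrow> real \<times> real) \<Rightarrow> real) \<Rightarrow> nat \<Rightarrow> (int \<Rightarrow> real \<times> real) \<Rightarrow> real" where
  "cesaro f n y = (\<Sum>m<n. f (seq_shift (int m) y)) / real n"

lemma cesaro_measurable [measurable]: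
  assumes [measurable]: "f \<in> borel_measurable gap_seqs"
  shows "cesaro f n \<in> borel_measurable gap_seqs"
  unfolding cesaro_def by measurable

text \<open>The mean ergodic theorem for \<open>f\<close> as a property; it is established below for the few functions that are
  needed, by means of independence.\<close>

definition cesaro_null :: "((int \<Rightarrow> real \<times> real) \<Rightarrow> real) \<Rightarrow> bool" where
  "cesaro_null f \<longleftrightarrow> (\<lambda>n. \<E> y. ennreal ((cesaro f n y)\<^sup>2)) \<longlonglongrightarrow> 0"

lemma abs_cesaro_le:
  assumes "\<And>y. \<bar>f y\<bar> \<le> F"
  shows "\<bar>cesaro f n y\<bar> \<le> F"
proof -
  have F0: "0 \<le> F" using assms[of undefined] by simp
  have "\<bar>\<Sum>m<n. f (seq_shift (int m) y)\<bar> \<le> (\<Sum>m<n. F)"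
    by (rule order_trans[OF sum_abs]) (intro sum_mono assms)
  then show ?thesis
    using F0 by (cases "n = 0") (simp_all add: cesaro_def field_simps)
qed

lemma cesaro_null_diff:
  assumes "cesaro_null f" "cesaro_null g"
    and [measurable]: "f \<in> borel_measurable gap_seqs" "g \<in> borel_measurable gap_seqs"
  shows "cesaro_null (\<lambda>y. f y - c * g y)"
  unfolding cesaro_null_def
proof (rule tendsto_sandwich[where f = "\<lambda>_. 0"])
  let ?I = "\<lambda>f n. \<E> y. ennreal ((cesaro f n y)\<^sup>2)"
  show "(\<lambda>n. 2 * ?I f n + ennreal (2 * c\<^sup>2) * ?I g n) \<longlonglongrightarrow> 0"
  proof -
    have "(\<lambda>n. 2 * ?I f n + ennreal (2 * c\<^sup>2) * ?I g n) \<longlonglongrightarrow> 2 * 0 + ennreal (2 * c\<^sup>2) * 0"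
      using assms(1,2) unfolding cesaro_null_def
      by (intro tendsto_add ennreal_tendsto_cmult) simp_all
    then show ?thesis by simp
  qed
  show "\<forall>\<^sub>F n in sequentially. ?I (\<lambda>y. f y - c * g y) n \<le> 2 * ?I f n + ennreal (2 * c\<^sup>2) * ?I g n"
  proof (rule always_eventually, rule allI)
    fix n
    have pt: "ennreal ((cesaro (\<lambda>y. f y - c * g y) n y)\<^sup>2)
        \<le> 2 * ennreal ((cesaro f n y)\<^sup>2) + ennreal (2 * c\<^sup>2) * ennreal ((cesaro g n y)\<^sup>2)" for y
    proof -
      have "cesaro (\<lambda>y. f y - c * g y) n y = cesaro f n y - c * cesaro g n y"
        by (simp add: cesaro_def sum_subtractf sum_distrib_left diff_divide_distrib)
      moreover have "(a - b)\<^sup>2 \<le> 2 * a\<^sup>2 + 2 * b\<^sup>2" for a b :: real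
      proof -
        have "0 \<le> (a + b)\<^sup>2" by simp
        then show ?thesis by (simp add: power2_eq_square algebra_simps)
      qed
      ultimately have "(cesaro (\<lambda>y. f y - c * g y) n y)\<^sup>2 \<le> 2 * (cesaro f n y)\<^sup>2 + 2 * c\<^sup>2 * (cesaro g n y)\<^sup>2"
        by (metis mult.assoc power_mult_distrib)
      then have "ennreal ((cesaro (\<lambda>y. f y - c * g y) n y)\<^sup>2)
          \<le> ennreal (2 * (cesaro f n y)\<^sup>2 + 2 * c\<^sup>2 * (cesaro g n y)\<^sup>2)" by (rule ennreal_leI)
      also have "\<dots> = 2 * ennreal ((cesaro f n y)\<^sup>2) + ennreal (2 * c\<^sup>2) * ennreal ((cesaro g n y)\<^sup>2)"
        by (simp add: ennreal_mult)
      finally show ?thesis .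
    qed
    have "?I (\<lambda>y. f y - c * g y) n
        \<le> (\<E> y. 2 * ennreal ((cesaro f n y)\<^sup>2) + ennreal (2 * c\<^sup>2) * ennreal ((cesaro g n y)\<^sup>2))"
      by (intro nn_integral_mono pt)
    also have "\<dots> = 2 * ?I f n + ennreal (2 * c\<^sup>2) * ?I g n"
      by (simp add: nn_integral_add nn_integral_cmult)
    finally show "?I (\<lambda>y. f y - c * g y) n \<le> 2 * ?I f n + ennreal (2 * c\<^sup>2) * ?I g n" .
  qed
qed simp_all

text \<open>Only about \<open>2 r n\<close> of the \<open>n\<^sup>2\<close> covariances in the variance of the sum are different from zero.\<close>

lemma cesaro_null_if_uncorrelated:
  assumes [measurable]: "f \<in> borel_measurable gap_seqs" and F: "\<And>y. \<bar>f y\<bar> \<le> F"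
    and uncorr: "\<And>k l :: nat. k + r \<le> l \<Longrightarrow> (\<integral>y. f (seq_shift (int k) y) * f (seq_shift (int l) y) \<partial>Q) = 0"
  shows "cesaro_null f"
  unfolding cesaro_null_def
proof (rule tendsto_sandwich[where f = "\<lambda>_. 0"])
  let ?f = "\<lambda>m y. f (seq_shift (int m) y)"
  have F0: "0 \<le> F" using F[of undefined] by simp
  have prod_le: "\<bar>?f m y * ?f l y\<bar> \<le> F\<^sup>2" for m l y
    using F[of "seq_shift (int m) y"] F[of "seq_shift (int l) y"] F0
    by (simp add: abs_mult power2_eq_square mult_mono)
  have prod_int: "integrable Q (\<lambda>y. ?f m y * ?f l y)" for m l
    using prod_le by (intro integrable_const_bound[of _ "F\<^sup>2"]) simp_all
  have cov_le: "(\<integral>y. ?f m y * ?f l y \<partial>Q) \<le> (if m < l + r \<and> l < m + r then F\<^sup>2 else 0)" for m l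
  proof (cases "m < l + r \<and> l < m + r")
    case True
    have "(\<integral>y. ?f m y * ?f l y \<partial>Q) \<le> (\<integral>y. F\<^sup>2 \<partial>Q)"
      using prod_int prod_le by (intro integral_mono) (auto intro: abs_le_D1)
    then show ?thesis using True by (simp add: prob_space)
  next
    case False
    then show ?thesis using uncorr[of m l] uncorr[of l m] by (auto simp: mult.commute not_less)
  qed
  have bound: "(\<E> y. ennreal ((cesaro f n y)\<^sup>2)) \<le> ennreal (2 * real r * F\<^sup>2 / real n)" for n
  proof -
    have sq: "(cesaro f n y)\<^sup>2 = (\<Sum>m<n. \<Sum>l<n. ?f m y * ?f l y) / (real n)\<^sup>2" for y
      by (simp add: cesaro_def power_divide power2_eq_square sum_product)
    have int: "integrable Q (\<lambda>y. (cesaro f n y)\<^sup>2)"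
      unfolding sq using prod_int by (intro integrable_divide Bochner_Integration.integrable_sum)
    have count: "(\<Sum>l<n. if m < l + r \<and> l < m + r then F\<^sup>2 else 0) \<le> 2 * real r * F\<^sup>2" for m
    proof -
      have "(\<Sum>l<n. if m < l + r \<and> l < m + r then F\<^sup>2 else 0)
          = real (card {l\<in>{..<n}. m < l + r \<and> l < m + r}) * F\<^sup>2"
        by (subst sum.inter_filter[symmetric]) simp_all
      moreover have "card {l\<in>{..<n}. m < l + r \<and> l < m + r} \<le> card {m - r..<m + r}"
        by (rule card_mono) auto
      then have "card {l\<in>{..<n}. m < l + r \<and> l < m + r} \<le> 2 * r" by simp
      then have "real (card {l\<in>{..<n}. m < l + r \<and> l < m + r}) \<le> 2 * real r" by linarith
      ultimately show ?thesis by (simp add: mult_right_mono)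
    qed
    have "(\<E> y. ennreal ((cesaro f n y)\<^sup>2)) = ennreal (\<integral>y. (cesaro f n y)\<^sup>2 \<partial>Q)"
      using int by (intro nn_integral_eq_integral) simp_all
    also have "(\<integral>y. (cesaro f n y)\<^sup>2 \<partial>Q) = (\<Sum>m<n. \<Sum>l<n. \<integral>y. ?f m y * ?f l y \<partial>Q) / (real n)\<^sup>2"
      unfolding sq using prod_int by (simp add: Bochner_Integration.integral_sum)
    also have "\<dots> \<le> (\<Sum>m<n. 2 * real r * F\<^sup>2) / (real n)\<^sup>2"
    proof (intro divide_right_mono sum_mono)
      fix m
      show "(\<Sum>l<n. \<integral>y. ?f m y * ?f l y \<partial>Q) \<le> 2 * real r * F\<^sup>2"
        by (rule order_trans[OF sum_mono count]) (rule cov_le)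
    qed simp
    also have "\<dots> = 2 * real r * F\<^sup>2 / real n" by (simp add: power2_eq_square)
    finally show ?thesis by (simp add: ennreal_leI)
  qed
  show "(\<lambda>n. ennreal (2 * real r * F\<^sup>2 / real n)) \<longlonglongrightarrow> 0"
    using tendsto_ennrealI[OF tendsto_divide_0[OF tendsto_const filterlim_real_sequentially[THEN filterlim_at_top_imp_at_infinity]]]
    by (simp add: ennreal_0)
  show "\<forall>\<^sub>F n in sequentially. (\<E> y. ennreal ((cesaro f n y)\<^sup>2)) \<le> ennreal (2 * real r * F\<^sup>2 / real n)"
    using bound by simp
qed simp_all

end

section \<open>Independent gaps\<close>

locale iid_gaps = stationary_gaps +
  assumes gaps_indep: "indep_vars (\<lambda>_. borel) (\<lambda>k y. gap y k) UNIV"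
    and marks_indep: "indep_vars (\<lambda>_. borel) (\<lambda>k y. gmark y k) UNIV"
    and gaps_marks_indep: "indep_var (Pi\<^sub>M UNIV (\<lambda>_. borel)) (\<lambda>y. gap y) (Pi\<^sub>M UNIV (\<lambda>_. borel)) (\<lambda>y. gmark y)"

lemma (in prob_space) indep_var_nn_integral_mult:
  assumes "indep_var S X T Y"
    and [measurable]: "f \<in> borel_measurable S" "g \<in> borel_measurable T"
  shows "(\<integral>\<^sup>+ x. f (X x) * g (Y x) \<partial>M) = (\<integral>\<^sup>+ x. f (X x) \<partial>M) * (\<integral>\<^sup>+ x. g (Y x) \<partial>M)"
proof -
  have [measurable]: "X \<in> M \<rightarrow>\<^sub>M S" "Y \<in> M \<rightarrow>\<^sub>M T"
    and joint: "distr M S X \<Otimes>\<^sub>M distr M T Y = distr M (S \<Otimes>\<^sub>M T) (\<lambda>x. (X x, Y x))"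
    using assms(1) by (auto simp: indep_var_distribution_eq)
  interpret Y: prob_space "distr M T Y" by (rule prob_space_distr) simp
  have "(\<integral>\<^sup>+ x. f (X x) * g (Y x) \<partial>M) = (\<integral>\<^sup>+ p. f (fst p) * g (snd p) \<partial>distr M (S \<Otimes>\<^sub>M T) (\<lambda>x. (X x, Y x)))"
    by (subst nn_integral_distr) simp_all
  also have "\<dots> = (\<integral>\<^sup>+ p. f (fst p) * g (snd p) \<partial>(distr M S X \<Otimes>\<^sub>M distr M T Y))"
    by (simp only: joint)
  also have "\<dots> = (\<integral>\<^sup>+ a. \<integral>\<^sup>+ b. f a * g b \<partial>distr M T Y \<partial>distr M S X)"
    by (subst Y.nn_integral_fst[symmetric]) simp_all
  also have "\<dots> = (\<integral>\<^sup>+ a. f a \<partial>distr M S X) * (\<integral>\<^sup>+ b. g b \<partial>distr M T Y)"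
    by (simp add: nn_integral_cmult nn_integral_multc)
  also have "\<dots> = (\<integral>\<^sup>+ x. f (X x) \<partial>M) * (\<integral>\<^sup>+ x. g (Y x) \<partial>M)"
    by (simp add: nn_integral_distr)
  finally show ?thesis .
qed

context iid_gaps
begin

lemma nn_integral_gap:
  assumes [measurable]: "f \<in> borel_measurable borel"
  shows "(\<E> y. f (gap y k)) = (\<E> y. f (gap y 0))"
  using nn_integral_shift[of "\<lambda>y. f (gap y 0)" k] by (simp add: seq_shift_apply)

lemma nn_integral_prod_gaps:
  fixes f :: "real \<Rightarrow> ennreal"
  assumes "finite B" and [measurable]: "f \<in> borel_measurable borel"
  shows "(\<E> y. (\<Prod>k\<in>B. f (gap y k))) = (\<E> y. f (gap y 0)) ^ card B"
proof -
  have "indep_vars (\<lambda>_. borel) (\<lambda>k y. f (gap y k)) B"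
    using indep_vars_compose2[OF indep_vars_subset[OF gaps_indep], of B "\<lambda>_. f" "\<lambda>_. borel"] by simp
  then have "(\<E> y. (\<Prod>k\<in>B. f (gap y k))) = (\<Prod>k\<in>B. \<E> y. f (gap y k))"
    by (intro indep_vars_nn_integral assms(1)) simp_all
  then show ?thesis by (subst (asm) nn_integral_gap) simp_all
qed

lemma nn_integral_exp_sum_gaps:
  assumes "finite B"
  shows "(\<E> y. ennreal (exp (t * (\<Sum>k\<in>B. gap y k))))
    = (\<E> y. ennreal (exp (t * gap y 0))) ^ card B"
proof -
  have "ennreal (exp (t * (\<Sum>k\<in>B. gap y k))) = (\<Prod>k\<in>B. ennreal (exp (t * gap y k)))" for y
    using assms by (simp add: prod_ennreal exp_sum sum_distrib_left)
  then show ?thesis using nn_integral_prod_gaps[OF assms, of "\<lambda>x. ennreal (exp (t * x))"] by simp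
qed

lemma laplace_lt_1: "\<exists>r>0. (\<E> y. ennreal (exp (- 1 * gap y 0))) = ennreal (exp (- r))"
proof -
  have int: "integrable Q (\<lambda>y. exp (- gap y 0))"
    using gaps_pos by (intro integrable_const_bound[of _ 1]) (auto elim: eventually_mono simp: less_imp_le)
  let ?\<rho> = "\<integral>y. exp (- gap y 0) \<partial>Q"
  have pos: "0 < ?\<rho>"
    using int by (rule integral_less_AE_space[of "\<lambda>_. 0", simplified]) (simp_all add: emeasure_space_1)
  have "?\<rho> < (\<integral>y. 1 \<partial>Q)"
  proof (rule integral_less_AE_space)
    show "AE y in Q. exp (- gap y 0) < 1" using gaps_pos by eventually_elim simp
  qed (use int in \<open>simp_all add: emeasure_space_1\<close>)
  then have "?\<rho> < 1" by (simp add: prob_space)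
  then have "0 < - ln ?\<rho>" using pos by simp
  moreover have "(\<E> y. ennreal (exp (- 1 * gap y 0))) = ennreal (exp (- (- ln ?\<rho>)))"
    using int pos by (simp add: nn_integral_eq_integral)
  ultimately show ?thesis by blast
qed

text \<open>Sums of many gaps grow linearly, with exponentially small exceptional probability. Hence the rate
  of a jump over \<open>n\<close> gaps decays like a stretched exponential in \<open>n\<close> with exponent \<open>\<alpha>\<close>, but for \<open>\<alpha> > 1\<close>
  the exceptional event dominates and limits the exponent to \<open>1\<close>.\<close>

definition stretch :: real where "stretch = min \<alpha> 1"

lemma stretch_pos: "0 < stretch" and stretch_le: "stretch \<le> \<alpha>" "stretch \<le> 1"
  using exponent_pos by (simp_all add: stretch_def)

text \<open>If \<open>exp (- r)\<close> is the Laplace transform of a gap at \<open>1\<close>, Markov's inequality gives probability at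
  most \<open>exp (- r n / 2)\<close> to the event that the sum of \<open>n\<close> gaps is below \<open>r n / 2\<close>.\<close>

lemma sum_gaps_decay:
  assumes s: "0 < s"
  shows "\<exists>C>0. \<exists>\<kappa>>0. \<forall>B. finite B \<longrightarrow>
    (\<E> y. ennreal (exp (- s * (\<Sum>k\<in>B. gap y k) powr \<alpha>)))
      \<le> ennreal (C * exp (- \<kappa> * real (card B) powr stretch))"
proof -
  obtain r where r: "0 < r" "(\<E> y. ennreal (exp (- 1 * gap y 0))) = ennreal (exp (- r))"
    using laplace_lt_1 by blast
  define \<kappa> where "\<kappa> = min (s * (r / 2) powr stretch) (r / 2)"
  have \<kappa>: "0 < \<kappa>" "\<kappa> \<le> s * (r / 2) powr stretch" "\<kappa> \<le> r / 2" using s r by (simp_all add: \<kappa>_def)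
  have "(\<E> y. ennreal (exp (- s * (\<Sum>k\<in>B. gap y k) powr \<alpha>)))
      \<le> ennreal ((exp s + 1) * exp (- \<kappa> * real (card B) powr stretch))" if B: "finite B" for B
  proof -
    let ?n = "real (card B)"
    let ?S = "\<lambda>y. \<Sum>k\<in>B. gap y k"
    have pt: "exp (- s * (x powr \<alpha>)) \<le> exp s * exp (- \<kappa> * ?n powr stretch) + exp (r / 2 * ?n) * exp (- 1 * x)"
      if x: "0 \<le> x" for x
    proof (cases "r / 2 * ?n \<le> x")
      case True
      have "x powr stretch - 1 \<le> x powr \<alpha>"
      proof (cases "1 \<le> x")
        case True
        then have "x powr stretch \<le> x powr \<alpha>" using stretch_le by (intro powr_mono)
        then show ?thesis by simp
      next
        case False
        then have "x powr stretch \<le> 1" using x stretch_pos powr_mono2[of stretch x 1] by simp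
        then show ?thesis using powr_ge_zero[of x \<alpha>] by linarith
      qed
      moreover have "(r / 2) powr stretch * ?n powr stretch \<le> x powr stretch"
        using True r x stretch_pos by (subst powr_mult[symmetric]) (auto intro: powr_mono2)
      ultimately have "s * ((r / 2) powr stretch * ?n powr stretch - 1) \<le> s * x powr \<alpha>"
        using s by (intro mult_left_mono) auto
      moreover have "\<kappa> * ?n powr stretch \<le> s * (r / 2) powr stretch * ?n powr stretch"
        using \<kappa> by (intro mult_right_mono) simp_all
      ultimately have "- s * x powr \<alpha> \<le> s + - \<kappa> * ?n powr stretch" by (simp add: algebra_simps)
      then have "exp (- s * x powr \<alpha>) \<le> exp s * exp (- \<kappa> * ?n powr stretch)"
        by (simp add: exp_add[symmetric])
      then show ?thesis by (smt (verit) exp_gt_zero mult_pos_pos)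
    next
      case False
      have "exp (- s * (x powr \<alpha>)) \<le> 1" using s by simp
      also have "1 \<le> exp (r / 2 * ?n + - 1 * x)" using False by simp
      also have "\<dots> = exp (r / 2 * ?n) * exp (- 1 * x)" by (rule exp_add)
      also have "\<dots> \<le> exp s * exp (- \<kappa> * ?n powr stretch) + \<dots>" by simp
      finally show ?thesis .
    qed
    have "(\<E> y. ennreal (exp (- s * (?S y powr \<alpha>))))
        \<le> (\<E> y. ennreal (exp s * exp (- \<kappa> * ?n powr stretch)) + ennreal (exp (r / 2 * ?n)) * ennreal (exp (- 1 * ?S y)))"
      using gaps_pos
    proof (intro nn_integral_mono_AE, eventually_elim)
      case (elim y)
      then have "0 \<le> ?S y" by (intro sum_nonneg) (simp add: less_imp_le)
      from pt[OF this] show ?case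
        by (simp add: ennreal_leI flip: ennreal_mult ennreal_plus)
    qed
    also have "\<dots> = ennreal (exp s * exp (- \<kappa> * ?n powr stretch)) + ennreal (exp (r / 2 * ?n)) * ennreal (exp (- r)) ^ card B"
      using nn_integral_exp_sum_gaps[OF B, of "-1"] r(2)
      by (simp add: nn_integral_add nn_integral_cmult emeasure_space_1)
    also have "\<dots> = ennreal (exp s * exp (- \<kappa> * ?n powr stretch) + exp (r / 2 * ?n) * exp (- r * ?n))"
      by (simp add: ennreal_power exp_of_nat_mult[symmetric] mult.commute flip: ennreal_mult ennreal_plus)
    also have "\<dots> \<le> ennreal ((exp s + 1) * exp (- \<kappa> * ?n powr stretch))"
    proof (rule ennreal_leI)
      have "?n powr stretch \<le> ?n"
        using stretch_pos stretch_le powr_mono[of stretch 1 ?n] by (cases "card B = 0") simp_all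
      then have "\<kappa> * ?n powr stretch \<le> r / 2 * ?n" using \<kappa> by (intro mult_mono) simp_all
      then have "exp (r / 2 * ?n) * exp (- r * ?n) \<le> exp (- \<kappa> * ?n powr stretch)"
        by (simp add: exp_add[symmetric])
      then show "exp s * exp (- \<kappa> * ?n powr stretch) + exp (r / 2 * ?n) * exp (- r * ?n)
          \<le> (exp s + 1) * exp (- \<kappa> * ?n powr stretch)" by (simp add: algebra_simps)
    qed
    finally show ?thesis .
  qed
  moreover have "0 < exp s + 1" by (simp add: add_pos_pos)
  ultimately show ?thesis using \<kappa> by blast
qed

lemma rate_decay:
  obtains C \<kappa> where "0 < C" "0 < \<kappa>"
    "\<And>\<beta> i. 0 \<le> \<beta> \<Longrightarrow> (\<E> y. ennreal (R \<beta> i y)) \<le> ennreal (C * exp (- \<kappa> * real (nat \<bar>i\<bar>) powr stretch))"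
proof -
  obtain C \<kappa> where C: "0 < C" "0 < \<kappa>" "\<And>B. finite B \<Longrightarrow>
      (\<E> y. ennreal (exp (- 1 * (\<Sum>k\<in>B. gap y k) powr \<alpha>)))
      \<le> ennreal (C * exp (- \<kappa> * real (card B) powr stretch))"
    using sum_gaps_decay[of 1] by auto
  have "(\<E> y. ennreal (R \<beta> i y)) \<le> ennreal (C * exp (- \<kappa> * real (nat \<bar>i\<bar>) powr stretch))"
    if "0 \<le> \<beta>" for \<beta> i
  proof -
    have "(\<E> y. ennreal (R \<beta> i y)) \<le> (\<E> y. ennreal (exp (- 1 * (\<Sum>k\<in>crossed i. gap y k) powr \<alpha>)))"
      using gaps_pos marks_range
    proof (intro nn_integral_mono_AE, eventually_elim)
      case (elim y)
      show ?case using rate_le_exp_sum[OF elim(3,4) that, of i] by (simp add: ennreal_leI)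
    qed
    also have "\<dots> \<le> ennreal (C * exp (- \<kappa> * real (nat \<bar>i\<bar>) powr stretch))"
      using C(3)[of "crossed i"] by (simp add: card_crossed)
    finally show ?thesis .
  qed
  with C(1,2) show thesis by (rule that)
qed

definition decay_sum :: "real \<Rightarrow> real" where
  "decay_sum \<kappa> = enn2real (\<integral>\<^sup>+ i. ennreal ((real_of_int i)\<^sup>2 * exp (- \<kappa> * real (nat \<bar>i\<bar>) powr stretch)) \<partial>count_space UNIV)"

lemma decay_sum:
  assumes "0 < \<kappa>"
  shows "(\<integral>\<^sup>+ i. ennreal ((real_of_int i)\<^sup>2 * exp (- \<kappa> * real (nat \<bar>i\<bar>) powr stretch)) \<partial>count_space UNIV)
      = ennreal (decay_sum \<kappa>)"
    and "0 \<le> decay_sum \<kappa>"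
  using nn_integral_int_stretched_exp_finite[OF assms stretch_pos] by (simp_all add: decay_sum_def)

lemma crossing_energy_le_decay:
  assumes [measurable]: "h \<in> borel_measurable gap_seqs" and "0 < \<kappa>" "0 \<le> A"
    and decay: "\<And>i k. k \<in> crossed i \<Longrightarrow> (\<E> y. ennreal (R \<beta> i y * (h (seq_shift k y))\<^sup>2))
      \<le> ennreal (A * exp (- \<kappa> * real (nat \<bar>i\<bar>) powr stretch))"
  shows "crossing_energy \<beta> h \<le> ennreal (A * decay_sum \<kappa>)"
proof -
  let ?E = "\<lambda>i. exp (- \<kappa> * real (nat \<bar>i\<bar>) powr stretch)"
  have "crossing_energy \<beta> h \<le> (\<integral>\<^sup>+ i. ennreal ((real_of_int i)\<^sup>2) * ennreal (A * ?E i) \<partial>count_space UNIV)"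
    by (rule crossing_energy_le[OF decay]) simp_all
  also have "\<dots> = (\<integral>\<^sup>+ i. ennreal A * ennreal ((real_of_int i)\<^sup>2 * ?E i) \<partial>count_space UNIV)"
    using assms(3) by (simp add: mult_ac flip: ennreal_mult)
  also have "\<dots> = ennreal A * ennreal (decay_sum \<kappa>)"
    by (subst nn_integral_cmult, simp, subst decay_sum[OF assms(2)], rule refl)
  also have "\<dots> = ennreal (A * decay_sum \<kappa>)"
    using assms(3) decay_sum[OF assms(2)] by (intro ennreal_mult[symmetric])
  finally show ?thesis .
qed

text \<open>Each of the terms in the crossing energy tends to zero because the rates are at most one. The terms
  are dominated by a summable sequence because of the decay of the rates.\<close>

lemma crossing_energy_cesaro_tendsto_0:
  assumes [measurable]: "f \<in> borel_measurable gap_seqs" and F: "\<And>y. \<bar>f y\<bar> \<le> F"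
    and van: "cesaro_null f" and \<beta>: "0 \<le> \<beta>"
  shows "(\<lambda>n. crossing_energy \<beta> (cesaro f n)) \<longlonglongrightarrow> 0"
proof -
  obtain C \<kappa> where C: "0 < C" "0 < \<kappa>"
    "\<And>i. (\<E> y. ennreal (R \<beta> i y)) \<le> ennreal (C * exp (- \<kappa> * real (nat \<bar>i\<bar>) powr stretch))"
    using rate_decay \<beta> by metis
  let ?T = "\<lambda>n i. (\<Sum>k\<in>crossed i.
     \<E> y. ennreal (real_of_int \<bar>i\<bar> * (R \<beta> i y * (cesaro f n (seq_shift k y))\<^sup>2)))"
  let ?I = "\<lambda>n. \<E> y. ennreal ((cesaro f n y)\<^sup>2)"
  have "(\<lambda>n. \<integral>\<^sup>+ i. ?T n i \<partial>count_space UNIV) \<longlonglongrightarrow> (\<integral>\<^sup>+ i. 0 \<partial>count_space (UNIV :: int set))"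
  proof (rule nn_integral_dominated_convergence)
    let ?w = "\<lambda>i. ennreal (F\<^sup>2 * C) * ennreal ((real_of_int i)\<^sup>2 * exp (- \<kappa> * real (nat \<bar>i\<bar>) powr stretch))"
    show "(\<integral>\<^sup>+ i. ?w i \<partial>count_space UNIV) < \<infinity>"
      using nn_integral_int_stretched_exp_finite[OF C(2) stretch_pos]
      by (subst nn_integral_cmult) (simp_all add: ennreal_mult_less_top)
    show "AE i in count_space UNIV. ?T n i \<le> ?w i" for n
    proof (rule AE_I2)
      fix i :: int
      have "?T n i \<le> (\<Sum>k\<in>crossed i. ennreal (real_of_int \<bar>i\<bar> * F\<^sup>2 * (C * exp (- \<kappa> * real (nat \<bar>i\<bar>) powr stretch))))"
      proof (rule sum_mono)
        fix k
        have "(cesaro f n (seq_shift k y))\<^sup>2 \<le> F\<^sup>2" for y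
          using abs_cesaro_le[of f F n "seq_shift k y"] F
          by (metis abs_ge_zero abs_le_square_iff abs_of_nonneg order_trans)
        then have "(\<E> y. ennreal (real_of_int \<bar>i\<bar> * (R \<beta> i y * (cesaro f n (seq_shift k y))\<^sup>2)))
            \<le> (\<E> y. ennreal (real_of_int \<bar>i\<bar> * F\<^sup>2) * ennreal (R \<beta> i y))"
          by (intro nn_integral_mono)
             (auto simp: ennreal_mult[symmetric] rate_nonneg mult.assoc mult.commute[of "F\<^sup>2"]
               intro!: ennreal_leI mult_left_mono)
        also have "\<dots> \<le> ennreal (real_of_int \<bar>i\<bar> * F\<^sup>2) * ennreal (C * exp (- \<kappa> * real (nat \<bar>i\<bar>) powr stretch))"
          using C(3)[of i] by (subst nn_integral_cmult) (auto intro: mult_left_mono)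
        also have "\<dots> = ennreal (real_of_int \<bar>i\<bar> * F\<^sup>2 * (C * exp (- \<kappa> * real (nat \<bar>i\<bar>) powr stretch)))"
          using C by (simp add: ennreal_mult)
        finally show "(\<E> y. ennreal (real_of_int \<bar>i\<bar> * (R \<beta> i y * (cesaro f n (seq_shift k y))\<^sup>2))) \<le> \<dots>" .
      qed
      also have "\<dots> = ennreal (real_of_int \<bar>i\<bar>) * ennreal (real_of_int \<bar>i\<bar> * F\<^sup>2 * (C * exp (- \<kappa> * real (nat \<bar>i\<bar>) powr stretch)))"
        by (simp add: card_crossed ennreal_of_nat_eq_real_of_nat)
      also have "\<dots> = ?w i"
      proof -
        let ?E = "exp (- \<kappa> * real (nat \<bar>i\<bar>) powr stretch)"
        have "ennreal (real_of_int \<bar>i\<bar>) * ennreal (real_of_int \<bar>i\<bar> * F\<^sup>2 * (C * ?E))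
            = ennreal (real_of_int \<bar>i\<bar> * (real_of_int \<bar>i\<bar> * F\<^sup>2 * (C * ?E)))"
          using C by (intro ennreal_mult[symmetric]) simp_all
        also have "real_of_int \<bar>i\<bar> * (real_of_int \<bar>i\<bar> * F\<^sup>2 * (C * ?E))
            = (real_of_int \<bar>i\<bar>)\<^sup>2 * (F\<^sup>2 * (C * ?E))"
          by (simp only: power2_eq_square mult.assoc)
        also have "\<dots> = F\<^sup>2 * C * ((real_of_int i)\<^sup>2 * ?E)" by simp
        also have "ennreal \<dots> = ?w i" using C by (intro ennreal_mult) simp_all
        finally show ?thesis .
      qed
      finally show "?T n i \<le> ?w i" .
    qed
    show "AE i in count_space UNIV. (\<lambda>n. ?T n i) \<longlonglongrightarrow> 0"
    proof (rule AE_I2)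
      fix i :: int
      have "(\<lambda>n. \<E> y. ennreal (real_of_int \<bar>i\<bar> * (R \<beta> i y * (cesaro f n (seq_shift k y))\<^sup>2))) \<longlonglongrightarrow> 0" for k
      proof (rule tendsto_sandwich[where f = "\<lambda>_. 0"])
        have "(\<lambda>n. ennreal (real_of_int \<bar>i\<bar>) * ?I n) \<longlonglongrightarrow> ennreal (real_of_int \<bar>i\<bar>) * 0"
          using van unfolding cesaro_null_def by (intro ennreal_tendsto_cmult) simp_all
        then show "(\<lambda>n. ennreal (real_of_int \<bar>i\<bar>) * ?I n) \<longlonglongrightarrow> 0" by simp
        show "\<forall>\<^sub>F n in sequentially. (\<E> y. ennreal (real_of_int \<bar>i\<bar> * (R \<beta> i y * (cesaro f n (seq_shift k y))\<^sup>2)))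
            \<le> ennreal (real_of_int \<bar>i\<bar>) * ?I n"
        proof (rule always_eventually, rule allI)
          fix n
          have "(\<E> y. ennreal (real_of_int \<bar>i\<bar> * (R \<beta> i y * (cesaro f n (seq_shift k y))\<^sup>2)))
              \<le> (\<E> y. ennreal (real_of_int \<bar>i\<bar>) * ennreal ((cesaro f n (seq_shift k y))\<^sup>2))"
            using rate_le_1[OF \<beta>, of i]
          proof (intro nn_integral_mono_AE, eventually_elim)
            case (elim y)
            have "R \<beta> i y * (cesaro f n (seq_shift k y))\<^sup>2 \<le> 1 * (cesaro f n (seq_shift k y))\<^sup>2"
              using elim by (intro mult_right_mono) simp_all
            then show ?case
              by (subst ennreal_mult[symmetric]) (auto intro!: ennreal_leI mult_left_mono)
          qed
          also have "\<dots> = ennreal (real_of_int \<bar>i\<bar>) * (\<E> y. ennreal ((cesaro f n (seq_shift k y))\<^sup>2))"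
            by (rule nn_integral_cmult) simp
          also have "\<dots> = ennreal (real_of_int \<bar>i\<bar>) * ?I n"
            using nn_integral_shift[of "\<lambda>y. ennreal ((cesaro f n y)\<^sup>2)" k] by simp
          finally show "(\<E> y. ennreal (real_of_int \<bar>i\<bar> * (R \<beta> i y * (cesaro f n (seq_shift k y))\<^sup>2)))
              \<le> ennreal (real_of_int \<bar>i\<bar>) * ?I n" .
        qed
      qed simp_all
      then have "(\<lambda>n. ?T n i) \<longlonglongrightarrow> (\<Sum>k\<in>crossed i. 0)" by (intro tendsto_sum)
      then show "(\<lambda>n. ?T n i) \<longlonglongrightarrow> 0" by simp
    qed
  qed simp_all
  then show ?thesis by (simp add: crossing_energy_def)
qed

text \<open>A jump over a gap longer than \<open>N\<close> is itself longer than \<open>N\<close>, so a fraction of its rate yields a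
  factor that tends to zero while the rest still controls the square of the gap.\<close>

lemma crossing_energy_long_gaps_tendsto_0:
  assumes \<beta>: "0 \<le> \<beta>"
  shows "(\<lambda>N. crossing_energy \<beta> (\<lambda>y. gap y 0 - min (gap y 0) (real N))) \<longlonglongrightarrow> 0"
proof -
  obtain C1 where C1: "0 < C1" "\<And>x. 0 \<le> x \<Longrightarrow> x ^ 2 * exp (- (1 / 2) * x powr \<alpha>) \<le> C1"
    using power_times_stretched_exp_bounded[of "1 / 2" \<alpha> 2] exponent_pos by auto
  obtain C2 \<kappa> where C2: "0 < C2" "0 < \<kappa>" "\<And>B. finite B \<Longrightarrow>
      (\<E> y. ennreal (exp (- (1 / 4) * (\<Sum>k\<in>B. gap y k) powr \<alpha>)))
      \<le> ennreal (C2 * exp (- \<kappa> * real (card B) powr stretch))"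
    using sum_gaps_decay[of "1 / 4"] by auto
  let ?q = "\<lambda>N. exp (- (1 / 4) * real N powr \<alpha>)"
  let ?E = "\<lambda>i. exp (- \<kappa> * real (nat \<bar>i\<bar>) powr stretch)"
  let ?h = "\<lambda>N y. gap y 0 - min (gap y 0) (real N)"
  have bound: "crossing_energy \<beta> (?h N) \<le> ennreal (C1 * C2 * ?q N * decay_sum \<kappa>)" for N
  proof -
    have "(\<E> y. ennreal (R \<beta> i y * (?h N (seq_shift k y))\<^sup>2)) \<le> ennreal (C1 * C2 * ?q N * ?E i)"
      if k: "k \<in> crossed i" for i k
    proof -
      let ?X = "\<lambda>y. \<Sum>k\<in>crossed i. gap y k"
      have "(\<E> y. ennreal (R \<beta> i y * (?h N (seq_shift k y))\<^sup>2))
          \<le> (\<E> y. ennreal (C1 * ?q N) * ennreal (exp (- (1 / 4) * ?X y powr \<alpha>)))"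
        using gaps_pos marks_range
      proof (intro nn_integral_mono_AE, eventually_elim)
        case (elim y)
        have gX: "gap y k \<le> ?X y"
          using k elim(3) by (intro member_le_sum) (simp_all add: less_imp_le)
        have X0: "0 < gap y k" using elim by simp
        show ?case
        proof (cases "gap y k \<le> real N")
          case True
          then show ?thesis by (simp add: seq_shift_apply)
        next
          case False
          have "(?h N (seq_shift k y))\<^sup>2 \<le> (?X y)\<^sup>2"
            using False gX X0 by (intro power_mono) (simp_all add: seq_shift_apply)
          then have "R \<beta> i y * (?h N (seq_shift k y))\<^sup>2 \<le> exp (- (?X y powr \<alpha>)) * (?X y)\<^sup>2"
            using rate_le_exp_sum[OF elim(3,4) \<beta>, of i] by (intro mult_mono) simp_all
          also have "\<dots> = ((?X y)\<^sup>2 * exp (- (1 / 2) * ?X y powr \<alpha>)) * exp (- (1 / 4) * ?X y powr \<alpha>) * exp (- (1 / 4) * ?X y powr \<alpha>)"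
            by (simp add: mult.assoc exp_add[symmetric])
          also have "\<dots> \<le> C1 * ?q N * exp (- (1 / 4) * ?X y powr \<alpha>)"
          proof (intro mult_right_mono mult_mono)
            show "(?X y)\<^sup>2 * exp (- (1 / 2) * ?X y powr \<alpha>) \<le> C1" using gX X0 by (intro C1) simp
            have "real N powr \<alpha> \<le> ?X y powr \<alpha>" using False gX exponent_pos by (intro powr_mono2) simp_all
            then show "exp (- (1 / 4) * ?X y powr \<alpha>) \<le> ?q N" by simp
          qed (use C1 in simp_all)
          finally show ?thesis using C1 by (simp add: ennreal_leI flip: ennreal_mult)
        qed
      qed
      also have "\<dots> = ennreal (C1 * ?q N) * (\<E> y. ennreal (exp (- (1 / 4) * ?X y powr \<alpha>)))"
        by (rule nn_integral_cmult) simp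
      also have "\<dots> \<le> ennreal (C1 * ?q N) * ennreal (C2 * ?E i)"
        using C2(3)[of "crossed i"] by (intro mult_left_mono) (simp_all add: card_crossed)
      also have "\<dots> = ennreal (C1 * C2 * ?q N * ?E i)"
        using C1 C2 by (simp add: mult_ac flip: ennreal_mult)
      finally show ?thesis .
    qed
    then show ?thesis using C1 C2 by (intro crossing_energy_le_decay) simp_all
  qed
  have "?q \<longlonglongrightarrow> 0"
  proof -
    obtain C3 where C3: "\<And>x. 0 \<le> x \<Longrightarrow> x ^ 1 * exp (- (1 / 4) * x powr \<alpha>) \<le> C3"
      using power_times_stretched_exp_bounded[of "1 / 4" \<alpha> 1] exponent_pos by auto
    have le: "?q N \<le> C3 / real N" if "1 \<le> N" for N
      using C3[of "real N"] that by (simp add: field_simps)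
    show ?thesis
    proof (rule tendsto_sandwich[where f = "\<lambda>_. 0"])
      show "\<forall>\<^sub>F N in sequentially. ?q N \<le> C3 / real N"
        by (rule eventually_sequentiallyI[of 1]) (rule le)
      show "(\<lambda>N. C3 / real N) \<longlonglongrightarrow> 0" by (rule lim_const_over_n)
    qed simp_all
  qed
  then have "(\<lambda>N. ennreal (C1 * C2 * ?q N * decay_sum \<kappa>)) \<longlonglongrightarrow> ennreal (C1 * C2 * 0 * decay_sum \<kappa>)"
    by (intro tendsto_ennrealI tendsto_mult_left tendsto_mult_right)
  then have lim: "(\<lambda>N. ennreal (C1 * C2 * ?q N * decay_sum \<kappa>)) \<longlonglongrightarrow> 0" by simp
  show ?thesis
    by (rule tendsto_sandwich[where f = "\<lambda>_. 0", OF _ _ tendsto_const lim]) (use bound in simp_all)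
qed

lemma cesaro_null_function_of_gap:
  assumes [measurable]: "h \<in> borel_measurable borel" and H: "\<And>x. \<bar>h x\<bar> \<le> H"
    and mean: "(\<integral>y. h (gap y 0) \<partial>Q) = 0"
  shows "cesaro_null (\<lambda>y. h (gap y 0))"
proof (rule cesaro_null_if_uncorrelated[where F = H and r = 1])
  show "(\<integral>y. h (gap (seq_shift (int k) y) 0) * h (gap (seq_shift (int l) y) 0) \<partial>Q) = 0"
    if "k + 1 \<le> l" for k l :: nat
  proof -
    let ?B = "{int k, int l}"
    have "indep_vars (\<lambda>_. borel) (\<lambda>k y. h (gap y k)) ?B"
      using indep_vars_compose2[OF indep_vars_subset[OF gaps_indep], of ?B "\<lambda>_. h" "\<lambda>_. borel"] by simp
    then have "(\<integral>y. (\<Prod>k\<in>?B. h (gap y k)) \<partial>Q) = (\<Prod>k\<in>?B. \<integral>y. h (gap y k) \<partial>Q)"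
      using H by (intro indep_vars_lebesgue_integral integrable_const_bound[of _ H]) simp_all
    moreover have "(\<integral>y. h (gap y k) \<partial>Q) = 0" for k
      using integral_shift[of "\<lambda>y. h (gap y 0)" k] mean by (simp add: seq_shift_apply)
    ultimately show ?thesis using that by (simp add: seq_shift_apply)
  qed
qed (use H in simp_all)

lemma crossing_energy_cong_AE:
  assumes [measurable]: "h \<in> borel_measurable gap_seqs" "h' \<in> borel_measurable gap_seqs"
    and eq: "AE y in Q. h y = h' y"
  shows "crossing_energy \<beta> h = crossing_energy \<beta> h'"
  unfolding crossing_energy_def
proof (rule nn_integral_cong, rule sum.cong[OF refl], rule nn_integral_cong_AE)
  fix i k :: int
  have "AE y in Q. h (seq_shift k y) = h' (seq_shift k y)"
    by (rule AE_shift[OF eq]) (simp add: pred_def)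
  then show "AE y in Q. ennreal (real_of_int \<bar>i\<bar> * (R \<beta> i y * (h (seq_shift k y))\<^sup>2))
      = ennreal (real_of_int \<bar>i\<bar> * (R \<beta> i y * (h' (seq_shift k y))\<^sup>2))"
    by eventually_elim simp
qed

text \<open>Arbitrary stationary increments \<open>\<psi>\<close> with the right mean are nearly increments of correctors: with
  \<open>f = Z\<^sub>0 - \<psi>\<close> and \<open>G\<close> the average of the partial sums \<open>f + f \<circ> \<tau> + \<dots> + f \<circ> \<tau>\<^sup>p\<^sup>-\<^sup>1\<close> over \<open>p < n\<close>, the
  increment of \<open>G\<close> is \<open>\<psi>\<close> plus the ergodic average of \<open>f\<close> over \<open>n\<close> shifts, and this average tends
  to zero. The corrector has to be bounded, which is why gaps are truncated at \<open>N\<close> and \<open>\<psi>\<close> is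
  rescaled to the mean of the truncated gap. The two errors disappear in the limits \<open>n \<rightarrow> \<infinity>\<close> and
  then \<open>N \<rightarrow> \<infinity>\<close>.\<close>

theorem D_le_crossing_energy:
  assumes [measurable]: "\<psi> \<in> borel_measurable gap_seqs" and F: "\<And>y. \<bar>\<psi> y\<bar> \<le> F"
    and mean: "(\<integral>y. \<psi> y \<partial>Q) = mean_gap"
    and van: "cesaro_null (\<lambda>y. \<psi> y - mean_gap)" and \<beta>: "0 \<le> \<beta>"
  shows "D \<beta> \<le> 3 * crossing_energy \<beta> \<psi>"
proof -
  let ?r = "\<lambda>N y. gap y 0 - min (gap y 0) (real N)"
  define m where "m N = (\<integral>y. min (gap y 0) (real N) \<partial>Q)" for N :: nat
  define \<psi>' where "\<psi>' N y = m N / mean_gap * \<psi> y" for N y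
  \<comment> \<open>The lower cut-off at \<open>0\<close> makes the truncation bounded everywhere; gaps are positive almost surely.\<close>
  define h where "h N x = max 0 (min x (real N))" for N x
  define f where "f N y = h N (gap y 0) - \<psi>' N y" for N y
  have [measurable]: "f N \<in> borel_measurable gap_seqs" "\<psi>' N \<in> borel_measurable gap_seqs"
     "h N \<in> borel_measurable borel" for N
    unfolding f_def \<psi>'_def h_def by measurable
  have F0: "0 \<le> F" using F[of undefined] by simp
  have h_AE: "AE y in Q. h N (gap y 0) = min (gap y 0) (real N)" for N
    using gaps_pos by eventually_elim (simp add: h_def less_imp_le)
  have h_bd: "\<bar>h N x\<bar> \<le> real N" for N x by (simp add: h_def)
  have h_int: "integrable Q (\<lambda>y. h N (gap y 0))" for N
    using h_bd by (intro integrable_const_bound[of _ "real N"]) simp_all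
  have m_eq: "m N = (\<integral>y. h N (gap y 0) \<partial>Q)" for N
    unfolding m_def using h_AE[of N] by (intro integral_cong_AE) (auto elim!: eventually_mono)
  have m_nonneg: "0 \<le> m N" for N
    unfolding m_eq by (intro Bochner_Integration.integral_nonneg) (simp add: h_def)
  have m_le: "m N \<le> mean_gap" for N
    unfolding m_eq mean_gap_def
    using gap_integrable h_int h_AE[of N] by (intro integral_mono_AE) (auto elim!: eventually_mono)
  have ratio: "0 \<le> m N / mean_gap" "m N / mean_gap \<le> 1" for N
    using m_nonneg m_le mean_gap_pos by simp_all
  have \<psi>'_le: "\<bar>\<psi>' N y\<bar> \<le> \<bar>\<psi> y\<bar>" for N y
    using ratio[of N] by (simp only: \<psi>'_def abs_mult) (rule mult_left_le_one_le, simp_all)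
  have f_bd: "\<bar>f N y\<bar> \<le> real N + F" for N y
    using \<psi>'_le[of N y] F[of y] h_bd[of N "gap y 0"] unfolding f_def by linarith
  have f_van: "cesaro_null (f N)" for N
  proof -
    have "cesaro_null (\<lambda>y. (h N (gap y 0) - m N) - m N / mean_gap * (\<psi> y - mean_gap))"
    proof (rule cesaro_null_diff[OF _ van])
      show "cesaro_null (\<lambda>y. h N (gap y 0) - m N)"
      proof (rule cesaro_null_function_of_gap[where h = "\<lambda>x. h N x - m N" and H = "real N + m N"])
        show "\<bar>h N x - m N\<bar> \<le> real N + m N" for x
          using h_bd[of N x] m_nonneg[of N] by linarith
        show "(\<integral>y. h N (gap y 0) - m N \<partial>Q) = 0"
          using h_int by (simp add: m_eq[symmetric] prob_space)
      qed simp
    qed simp_all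
    then show ?thesis
      using mean_gap_pos by (simp add: f_def[abs_def] \<psi>'_def right_diff_distrib)
  qed
  have step: "D \<beta> \<le> 3 * (crossing_energy \<beta> \<psi> + crossing_energy \<beta> (cesaro (f N) n) + crossing_energy \<beta> (?r N))"
    if n: "0 < n" for N n
  proof -
    define G where "G y = (\<Sum>p<n. \<Sum>k<p. f N (seq_shift (int k) y)) / real n" for y
    have [measurable]: "G \<in> borel_measurable gap_seqs" unfolding G_def by measurable
    have G_bd: "\<bar>G y\<bar> \<le> real n * (real N + F)" for y
    proof -
      have "\<bar>\<Sum>p<n. \<Sum>k<p. f N (seq_shift (int k) y)\<bar> \<le> (\<Sum>p<n. \<Sum>k<p. real N + F)"
        by (intro order_trans[OF sum_abs] sum_mono f_bd)
      also have "\<dots> \<le> (\<Sum>p<n. real n * (real N + F))"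
        using F0 by (intro sum_mono) (auto intro!: mult_right_mono)
      finally show ?thesis using n by (simp add: G_def field_simps)
    qed
    have "AE y in Q. \<bar>G y\<bar> \<le> real n * (real N + F)" using G_bd by simp
    moreover have "G \<in> borel_measurable Q" by simp
    ultimately have G: "G \<in> L_infinity Q"
      unfolding L_infinity_def by blast
    have "G (seq_shift 1 y) - G y = cesaro (f N) n y - f N y" for y
    proof -
      have "(\<Sum>k<p. f N (seq_shift (int k) (seq_shift 1 y))) - (\<Sum>k<p. f N (seq_shift (int k) y))
          = f N (seq_shift (int p) y) - f N y" for p
        by (induction p) (simp_all add: add.commute)
      then have "(\<Sum>p<n. \<Sum>k<p. f N (seq_shift (int k) (seq_shift 1 y))) - (\<Sum>p<n. \<Sum>k<p. f N (seq_shift (int k) y))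
          = (\<Sum>p<n. f N (seq_shift (int p) y)) - real n * f N y"
        by (simp only: sum_subtractf[symmetric]) (simp add: sum_subtractf)
      then have "G (seq_shift 1 y) - G y = ((\<Sum>p<n. f N (seq_shift (int p) y)) - real n * f N y) / real n"
        unfolding G_def by (simp only: diff_divide_distrib[symmetric])
      then show ?thesis using n by (simp add: cesaro_def diff_divide_distrib)
    qed
    then have incr: "increment G y = (\<psi>' N y + cesaro (f N) n y) + (gap y 0 - h N (gap y 0))" for y
      by (simp add: increment_def f_def algebra_simps)
    have "D \<beta> \<le> energy Q \<alpha> u \<beta> G" unfolding D_def by (rule INF_lower[OF G])
    also have "\<dots> \<le> crossing_energy \<beta> (increment G)" by (rule energy_le_crossing_energy) simp
    also have "\<dots> = crossing_energy \<beta> (\<lambda>y. \<psi>' N y + cesaro (f N) n y + ?r N y)"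
      using h_AE[of N] by (intro crossing_energy_cong_AE) (auto simp: incr elim!: eventually_mono)
    also have "\<dots> \<le> 3 * (crossing_energy \<beta> (\<psi>' N) + crossing_energy \<beta> (cesaro (f N) n) + crossing_energy \<beta> (?r N))"
      by (rule crossing_energy_add3) simp_all
    also have "\<dots> \<le> 3 * (crossing_energy \<beta> \<psi> + crossing_energy \<beta> (cesaro (f N) n) + crossing_energy \<beta> (?r N))"
      by (intro mult_left_mono add_right_mono crossing_energy_mono \<psi>'_le) simp
    finally show ?thesis .
  qed
  have lim_n: "D \<beta> \<le> 3 * (crossing_energy \<beta> \<psi> + 0 + crossing_energy \<beta> (?r N))" for N
  proof (rule LIMSEQ_le_const)
    show "(\<lambda>n. 3 * (crossing_energy \<beta> \<psi> + crossing_energy \<beta> (cesaro (f N) n) + crossing_energy \<beta> (?r N)))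
        \<longlonglongrightarrow> 3 * (crossing_energy \<beta> \<psi> + 0 + crossing_energy \<beta> (?r N))"
      using crossing_energy_cesaro_tendsto_0[OF _ f_bd f_van \<beta>]
      by (intro ennreal_tendsto_cmult tendsto_add tendsto_const) simp_all
    show "\<exists>M. \<forall>n\<ge>M. D \<beta> \<le> 3 * (crossing_energy \<beta> \<psi> + crossing_energy \<beta> (cesaro (f N) n) + crossing_energy \<beta> (?r N))"
      using step by (intro exI[of _ 1]) auto
  qed
  have "D \<beta> \<le> 3 * (crossing_energy \<beta> \<psi> + 0 + 0)"
  proof (rule LIMSEQ_le_const)
    show "(\<lambda>N. 3 * (crossing_energy \<beta> \<psi> + 0 + crossing_energy \<beta> (?r N))) \<longlonglongrightarrow> 3 * (crossing_energy \<beta> \<psi> + 0 + 0)"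
      using crossing_energy_long_gaps_tendsto_0[OF \<beta>]
      by (intro ennreal_tendsto_cmult tendsto_add tendsto_const) simp_all
    show "\<exists>M. \<forall>N\<ge>M. D \<beta> \<le> 3 * (crossing_energy \<beta> \<psi> + 0 + crossing_energy \<beta> (?r N))"
      using lim_n by blast
  qed
  then show ?thesis by simp
qed

end

section \<open>Test functions that concentrate on long gaps\<close>

lemma powr_superadditive:
  fixes a b \<alpha> :: real
  assumes "1 \<le> \<alpha>" "0 \<le> a" "0 \<le> b"
  shows "a powr \<alpha> + b powr \<alpha> \<le> (a + b) powr \<alpha>"
proof (cases "a + b = 0")
  case False
  then have S: "0 < a + b" using assms by simp
  have part: "x powr \<alpha> \<le> x / (a + b) * (a + b) powr \<alpha>" if x: "0 \<le> x" "x \<le> a + b" for x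
  proof -
    have "(x / (a + b)) powr \<alpha> \<le> (x / (a + b)) powr 1"
      using x S assms powr_mono'[of 1 \<alpha> "x / (a + b)"] by (cases "x = 0") simp_all
    then have "(x / (a + b)) powr \<alpha> * (a + b) powr \<alpha> \<le> x / (a + b) * (a + b) powr \<alpha>"
      using x S by (intro mult_right_mono) (simp_all add: powr_one)
    moreover have "(x / (a + b)) powr \<alpha> * (a + b) powr \<alpha> = x powr \<alpha>"
      using x S by (subst powr_mult[symmetric]) simp_all
    ultimately show ?thesis by simp
  qed
  have "a powr \<alpha> + b powr \<alpha> \<le> a / (a + b) * (a + b) powr \<alpha> + b / (a + b) * (a + b) powr \<alpha>"
    using part[of a] part[of b] assms by (intro add_mono) simp_all
  also have "\<dots> = (a + b) powr \<alpha>"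
    using S by (simp add: distrib_right[symmetric] add_divide_distrib[symmetric])
  finally show ?thesis .
qed (use assms add_nonneg_eq_0_iff[of a b] in simp)

lemma powr_add_one_le:
  fixes x a :: real
  assumes "0 < a" "a \<le> 1" "0 \<le> x"
  shows "(x + 1) powr a \<le> x powr a + 1"
proof -
  have part: "t / (x + 1) * (x + 1) powr a \<le> t powr a" if t: "0 \<le> t" "t \<le> x + 1" for t
  proof -
    have "t / (x + 1) \<le> (t / (x + 1)) powr a"
      using t assms powr_mono'[of a 1 "t / (x + 1)"] by (cases "t = 0") simp_all
    then have "t / (x + 1) * (x + 1) powr a \<le> (t / (x + 1)) powr a * (x + 1) powr a"
      by (rule mult_right_mono) simp
    also have "\<dots> = t powr a"
      using t assms by (subst powr_mult[symmetric]) simp_all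
    finally show ?thesis .
  qed
  have "(x + 1) powr a = x / (x + 1) * (x + 1) powr a + 1 / (x + 1) * (x + 1) powr a"
    using assms by (simp only: distrib_right[symmetric] add_divide_distrib[symmetric]) simp
  also have "\<dots> \<le> x powr a + 1 powr a"
    using part[of x] part[of 1] assms by (intro add_mono) simp_all
  finally show ?thesis by simp
qed

lemma one_minus_ge_exp:
  fixes x :: real
  assumes "0 \<le> x" "x \<le> 1 / 2"
  shows "exp (- 2 * x) \<le> 1 - x"
proof -
  have "x * (2 * x) \<le> x * 1" using assms by (intro mult_left_mono) simp_all
  then have "- 2 * x \<le> - x - 2 * x\<^sup>2" by (simp add: power2_eq_square)
  also have "\<dots> \<le> ln (1 - x)" using assms by (rule ln_one_minus_pos_lower_bound)
  finally have "exp (- 2 * x) \<le> exp (ln (1 - x))" by simp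
  then show ?thesis using assms by simp
qed

context iid_gaps
begin

lemma nn_integral_gap_mult_other_gaps:
  assumes "finite B" "k \<notin> B" and [measurable]: "f \<in> borel_measurable borel" "g \<in> borel_measurable borel"
  shows "(\<E> y. f (gap y k) * g (\<Sum>j\<in>B. gap y j))
    = (\<E> y. f (gap y 0)) * (\<E> y. g (\<Sum>j\<in>B. gap y j))"
proof -
  have "indep_var (Pi\<^sub>M {k} (\<lambda>_. borel)) (\<lambda>y. restrict (\<lambda>i. gap y i) {k})
      (Pi\<^sub>M B (\<lambda>_. borel)) (\<lambda>y. restrict (\<lambda>i. gap y i) B)"
    using assms(2) by (intro indep_var_restrict[OF gaps_indep]) auto
  moreover have [measurable]: "(\<lambda>v. f (v k)) \<in> borel_measurable (Pi\<^sub>M {k} (\<lambda>_. borel))"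
    by measurable
  moreover have "(\<lambda>v. g (\<Sum>j\<in>B. v j)) \<in> borel_measurable (Pi\<^sub>M B (\<lambda>_. borel))"
    by measurable
  ultimately have "(\<E> y. f (restrict (gap y) {k} k) * g (\<Sum>j\<in>B. restrict (gap y) B j))
      = (\<E> y. f (restrict (gap y) {k} k)) * (\<E> y. g (\<Sum>j\<in>B. restrict (gap y) B j))"
    by (rule indep_var_nn_integral_mult)
  then show ?thesis using nn_integral_gap[OF assms(3), of k] by simp
qed

text \<open>The splitting hypothesis separates the rate of a jump over the gap \<open>k\<close> into a factor
  \<open>exp (- \<gamma> Z\<^sub>k\<^sup>\<alpha>)\<close> and a factor that depends on the other gaps only. The increment \<open>l w(Z\<^sub>k)\<close>, where
  \<open>w\<close> is \<open>exp (\<gamma> Z\<^sub>k\<^sup>\<alpha>)\<close> cut off at \<open>N + 1\<close> and \<open>l = \<E> Z / \<E> w\<close>, then costs at most a constant times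
  \<open>l\<^sup>2 \<E> w = (\<E> Z)\<^sup>2 / \<E> w\<close>, and \<open>\<E> w\<close> tends to infinity with \<open>N\<close>.\<close>

theorem D_eq_0_if_long_gaps:
  assumes \<gamma>s: "0 < \<gamma>" "0 < s"
    and split: "\<And>a b. 0 \<le> a \<Longrightarrow> 0 \<le> b \<Longrightarrow> \<gamma> * a powr \<alpha> + s * b powr \<alpha> \<le> (a + b) powr \<alpha>"
    and inf: "(\<E> y. ennreal (exp (\<gamma> * gap y 0 powr \<alpha>))) = \<infinity>"
    and \<beta>: "0 \<le> \<beta>"
  shows "D \<beta> = 0"
proof -
  obtain C \<kappa> where C: "0 < C" "0 < \<kappa>" "\<And>B. finite B \<Longrightarrow>
      (\<E> y. ennreal (exp (- s * (\<Sum>k\<in>B. gap y k) powr \<alpha>)))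
      \<le> ennreal (C * exp (- \<kappa> * real (card B) powr stretch))"
    using sum_gaps_decay[OF \<gamma>s(2)] by blast
  let ?E = "\<lambda>i. exp (- \<kappa> * real (nat \<bar>i\<bar>) powr stretch)"
  define S where "S = decay_sum \<kappa>"
  have S: "0 \<le> S" using decay_sum(2)[OF C(2)] by (simp add: S_def)
  define w where "w N x = min (exp (\<gamma> * x powr \<alpha>)) (real (Suc N))" for N x
  have [measurable]: "w N \<in> borel_measurable borel" for N unfolding w_def by measurable
  have w_bd: "0 < w N x" "w N x \<le> real (Suc N)" "w N x \<le> exp (\<gamma> * x powr \<alpha>)" for N x
    by (simp_all add: w_def)
  have w_int: "integrable Q (\<lambda>y. w N (gap y 0))" for N
    using w_bd(1,2)[of N] by (intro integrable_const_bound[of _ "real (Suc N)"]) (auto simp: less_imp_le)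
  define e where "e N = (\<integral>y. w N (gap y 0) \<partial>Q)" for N
  have e_nn: "(\<E> y. ennreal (w N (gap y 0))) = ennreal (e N)" for N
    unfolding e_def using w_int w_bd(1) by (intro nn_integral_eq_integral) (auto simp: less_imp_le)
  have e_pos: "0 < e N" for N
    unfolding e_def
    using w_int by (rule integral_less_AE_space[of "\<lambda>_. 0", simplified]) (simp_all add: emeasure_space_1 w_bd)
  let ?K = "3 * (mean_gap\<^sup>2 * C * exp \<kappa> * S)"
  have bound: "D \<beta> \<le> ennreal (?K / e N)" for N
  proof -
    define l where "l = mean_gap / e N"
    have l: "0 < l" using mean_gap_pos e_pos by (simp add: l_def)
    have D_le: "D \<beta> \<le> 3 * crossing_energy \<beta> (\<lambda>y. l * w N (gap y 0))"
    proof (rule D_le_crossing_energy[OF _ _ _ _ \<beta>])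
      show "\<bar>l * w N (gap y 0)\<bar> \<le> l * real (Suc N)" for y
        using l w_bd(1,2)[of N "gap y 0"] by (simp add: abs_mult)
      show mean: "(\<integral>y. l * w N (gap y 0) \<partial>Q) = mean_gap"
        using e_pos[of N] by (simp add: e_def[symmetric] l_def)
      show "cesaro_null (\<lambda>y. l * w N (gap y 0) - mean_gap)"
      proof (rule cesaro_null_function_of_gap[where h = "\<lambda>x. l * w N x - mean_gap" and H = "l * real (Suc N) + mean_gap"])
        show "\<bar>l * w N x - mean_gap\<bar> \<le> l * real (Suc N) + mean_gap" for x
        proof -
          have "0 \<le> l * w N x" "l * w N x \<le> l * real (Suc N)"
            using l w_bd(1,2)[of N x] by (simp_all add: less_imp_le)
          then show ?thesis using mean_gap_pos by linarith
        qed
        show "(\<integral>y. l * w N (gap y 0) - mean_gap \<partial>Q) = 0"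
          using w_int mean by (simp add: prob_space)
      qed simp
    qed simp
    have term_le: "(\<E> y. ennreal (R \<beta> i y * (l * w N (gap (seq_shift k y) 0))\<^sup>2))
        \<le> ennreal (l\<^sup>2 * e N * C * exp \<kappa> * ?E i)" if k: "k \<in> crossed i" for i k
    proof -
      let ?B = "crossed i - {k}"
      have "(\<E> y. ennreal (R \<beta> i y * (l * w N (gap (seq_shift k y) 0))\<^sup>2))
          \<le> (\<E> y. ennreal (l\<^sup>2 * w N (gap y k)) * ennreal (exp (- s * (\<Sum>j\<in>?B. gap y j) powr \<alpha>)))"
        using gaps_pos marks_range
      proof (intro nn_integral_mono_AE, eventually_elim)
        case (elim y)
        let ?z = "gap y k" and ?b = "\<Sum>j\<in>?B. gap y j"
        have zb: "0 \<le> ?z" "0 \<le> ?b" using elim(3) by (auto intro!: sum_nonneg simp: less_imp_le)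
        have "(\<Sum>j\<in>crossed i. gap y j) = ?z + ?b" using k by (simp add: sum.remove)
        then have "exp (- ((\<Sum>j\<in>crossed i. gap y j) powr \<alpha>)) \<le> exp (- (\<gamma> * ?z powr \<alpha> + s * ?b powr \<alpha>))"
          using split[OF zb] by simp
        then have "R \<beta> i y \<le> exp (- (\<gamma> * ?z powr \<alpha> + s * ?b powr \<alpha>))"
          by (rule order_trans[OF rate_le_exp_sum[OF elim(3,4) \<beta>]])
        then have "R \<beta> i y * (l * w N ?z)\<^sup>2
            \<le> exp (- (\<gamma> * ?z powr \<alpha> + s * ?b powr \<alpha>)) * (l * w N ?z)\<^sup>2"
          by (rule mult_right_mono) simp
        also have "\<dots> = l\<^sup>2 * w N ?z * (exp (- (\<gamma> * ?z powr \<alpha>)) * w N ?z) * exp (- s * ?b powr \<alpha>)"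
        proof -
          have "exp (- (\<gamma> * ?z powr \<alpha> + s * ?b powr \<alpha>)) = exp (- (\<gamma> * ?z powr \<alpha>)) * exp (- s * ?b powr \<alpha>)"
            by (simp add: exp_add[symmetric])
          then show ?thesis by (simp only: power2_eq_square mult_ac)
        qed
        also have "\<dots> \<le> l\<^sup>2 * w N ?z * 1 * exp (- s * ?b powr \<alpha>)"
        proof (intro mult_right_mono mult_left_mono)
          have "exp (- (\<gamma> * ?z powr \<alpha>)) * w N ?z \<le> exp (- (\<gamma> * ?z powr \<alpha>)) * exp (\<gamma> * ?z powr \<alpha>)"
            by (intro mult_left_mono w_bd) simp
          then show "exp (- (\<gamma> * ?z powr \<alpha>)) * w N ?z \<le> 1" by (simp add: exp_add[symmetric])
        qed (use w_bd(1)[of N ?z] in simp_all)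
        finally show ?case
          using w_bd(1)[of N ?z] by (simp add: seq_shift_apply ennreal_leI flip: ennreal_mult)
      qed
      also have "\<dots> = (\<E> y. ennreal (l\<^sup>2 * w N (gap y 0))) * (\<E> y. ennreal (exp (- s * (\<Sum>j\<in>?B. gap y j) powr \<alpha>)))"
        using nn_integral_gap_mult_other_gaps[of ?B k "\<lambda>x. ennreal (l\<^sup>2 * w N x)" "\<lambda>x. ennreal (exp (- s * x powr \<alpha>))"]
        by simp
      also have "(\<E> y. ennreal (l\<^sup>2 * w N (gap y 0))) = ennreal (l\<^sup>2 * e N)"
        using w_bd(1)[of N] e_pos[of N]
        by (simp add: ennreal_mult less_imp_le nn_integral_cmult e_nn)
      also have "ennreal (l\<^sup>2 * e N) * (\<E> y. ennreal (exp (- s * (\<Sum>j\<in>?B. gap y j) powr \<alpha>)))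
          \<le> ennreal (l\<^sup>2 * e N) * ennreal (C * (exp \<kappa> * ?E i))"
      proof (rule mult_left_mono[OF order_trans[OF C(3) ennreal_leI]])
        have pos: "0 < nat \<bar>i\<bar>" using k by (auto simp: crossed_def)
        have "card ?B = nat \<bar>i\<bar> - 1" using k by (simp add: card_crossed)
        then have "real (nat \<bar>i\<bar>) = real (card ?B) + 1" using pos by simp
        then have "real (nat \<bar>i\<bar>) powr stretch \<le> real (card ?B) powr stretch + 1"
          using powr_add_one_le[of stretch "real (card ?B)"] stretch_pos stretch_le by simp
        then have "\<kappa> * real (nat \<bar>i\<bar>) powr stretch \<le> \<kappa> * (real (card ?B) powr stretch + 1)"
          using C(2) by (intro mult_left_mono) simp_all
        then have "exp (- \<kappa> * real (card ?B) powr stretch) \<le> exp \<kappa> * ?E i"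
          by (simp add: exp_add[symmetric] algebra_simps)
        then show "C * exp (- \<kappa> * real (card ?B) powr stretch) \<le> C * (exp \<kappa> * ?E i)"
          using C(1) by (intro mult_left_mono) simp_all
      qed simp_all
      also have "\<dots> = ennreal (l\<^sup>2 * e N * C * exp \<kappa> * ?E i)"
        using C e_pos[of N] by (simp add: mult.assoc flip: ennreal_mult)
      finally show ?thesis .
    qed
    have "crossing_energy \<beta> (\<lambda>y. l * w N (gap y 0)) \<le> ennreal (l\<^sup>2 * e N * C * exp \<kappa> * S)"
      unfolding S_def using C e_pos[of N] term_le by (intro crossing_energy_le_decay) simp_all
    then have "3 * crossing_energy \<beta> (\<lambda>y. l * w N (gap y 0)) \<le> 3 * ennreal (l\<^sup>2 * e N * C * exp \<kappa> * S)"
      by (intro mult_left_mono) simp_all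
    also have "3 * ennreal (l\<^sup>2 * e N * C * exp \<kappa> * S) = ennreal (3 * (l\<^sup>2 * e N * C * exp \<kappa> * S))"
      by (subst ennreal_mult') simp_all
    also have "3 * (l\<^sup>2 * e N * C * exp \<kappa> * S) = ?K / e N"
      using e_pos[of N] by (simp add: l_def power2_eq_square)
    finally show ?thesis using D_le by (rule order_trans[rotated])
  qed
  have K: "0 \<le> ?K" using C S by simp
  have "(\<lambda>N. \<E> y. ennreal (w N (gap y 0))) \<longlonglongrightarrow> (\<E> y. ennreal (exp (\<gamma> * gap y 0 powr \<alpha>)))"
  proof (rule nn_integral_LIMSEQ)
    show "incseq (\<lambda>N y. ennreal (w N (gap y 0)))"
      by (auto simp: incseq_def le_fun_def w_def intro!: ennreal_leI)
    show "(\<lambda>N. ennreal (w N (gap y 0))) \<longlonglongrightarrow> ennreal (exp (\<gamma> * gap y 0 powr \<alpha>))" for y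
    proof (rule tendsto_eventually)
      obtain N0 where "exp (\<gamma> * gap y 0 powr \<alpha>) \<le> real N0" using real_arch_simple by blast
      then show "\<forall>\<^sub>F N in sequentially. ennreal (w N (gap y 0)) = ennreal (exp (\<gamma> * gap y 0 powr \<alpha>))"
        by (intro eventually_sequentiallyI[of N0]) (simp add: w_def min_def)
    qed
  qed simp
  then have e_lim: "(\<lambda>N. ennreal (e N)) \<longlonglongrightarrow> \<infinity>" by (simp add: e_nn inf)
  have "D \<beta> \<le> ennreal \<epsilon>" if \<epsilon>: "0 < \<epsilon>" for \<epsilon>
  proof -
    have "\<forall>\<^sub>F N in sequentially. ennreal (?K / \<epsilon>) < ennreal (e N)"
      using e_lim by (rule order_tendstoD) simp
    then obtain N where "ennreal (?K / \<epsilon>) < ennreal (e N)" by (auto simp: eventually_sequentially)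
    then have "?K / \<epsilon> < e N" using K \<epsilon> by (subst (asm) ennreal_less_iff) simp_all
    then have "?K / e N \<le> \<epsilon>" using \<epsilon> e_pos[of N] by (simp add: field_simps)
    then show ?thesis by (rule order_trans[OF bound[of N] ennreal_leI])
  qed
  then have "D \<beta> \<le> 0" using ennreal_le_epsilon[of 0 "D \<beta>"] by simp
  then show ?thesis by simp
qed

section \<open>Test functions that concentrate on runs of energetic marks\<close>

definition low_prob :: "real \<Rightarrow> real" where
  "low_prob e = prob {y \<in> space Q. \<bar>gmark y 0\<bar> \<le> e}"

lemma low_prob_bounds: "0 \<le> low_prob e" "low_prob e \<le> 1"
  by (simp_all add: low_prob_def)

lemma prob_high_marks:
  assumes "finite J"
  shows "(\<integral>y. (\<Prod>j\<in>J. of_bool (e < \<bar>gmark y j\<bar>)) \<partial>Q) = (1 - low_prob e) ^ card J"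
proof -
  let ?I = "\<lambda>x. of_bool (e < \<bar>x\<bar>) :: real"
  have "indep_vars (\<lambda>_. borel) (\<lambda>k y. ?I (gmark y k)) J"
    using indep_vars_compose2[OF indep_vars_subset[OF marks_indep], of J "\<lambda>_. ?I" "\<lambda>_. borel"] by simp
  then have "(\<integral>y. (\<Prod>j\<in>J. ?I (gmark y j)) \<partial>Q) = (\<Prod>j\<in>J. \<integral>y. ?I (gmark y j) \<partial>Q)"
    using assms by (intro indep_vars_lebesgue_integral integrable_const_bound[of _ 1]) simp_all
  moreover have "(\<integral>y. ?I (gmark y j) \<partial>Q) = 1 - low_prob e" for j
  proof -
    have "(\<integral>y. ?I (gmark y j) \<partial>Q) = (\<integral>y. ?I (gmark y 0) \<partial>Q)"
      using integral_shift[of "\<lambda>y. ?I (gmark y 0)" j] by (simp add: seq_shift_apply)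
    also have "\<dots> = (\<integral>y. 1 - indicator {y \<in> space Q. \<bar>gmark y 0\<bar> \<le> e} y \<partial>Q)"
      by (intro Bochner_Integration.integral_cong) (auto simp: indicator_def)
    also have "\<dots> = 1 - low_prob e"
      by (subst Bochner_Integration.integral_diff) (simp_all add: prob_space low_prob_def emeasure_eq_measure)
    finally show ?thesis .
  qed
  ultimately show ?thesis by simp
qed

lemma rate_le_high_mark:
  assumes pos: "\<forall>k. 0 < gap y k" and marks: "\<forall>k. gmark y k \<in> {-1..1}" and \<beta>: "0 \<le> \<beta>"
    and high: "e < \<bar>gmark y 0\<bar>"
  shows "R \<beta> i y \<le> exp (- (\<beta> * (c\<^sub>1 * e))) * exp (- ((\<Sum>k\<in>crossed i. gap y k) powr \<alpha>))"
proof -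
  have "c\<^sub>1 * e \<le> c\<^sub>1 * (\<bar>gmark y 0\<bar> + \<bar>gmark y i\<bar>)"
    using high c\<^sub>1_pos by (intro mult_left_mono) simp_all
  also have "\<dots> \<le> u (gmark y 0) (gmark y i)" using marks by (intro u_lower) blast+
  finally have "\<beta> * (c\<^sub>1 * e) \<le> \<beta> * u (gmark y 0) (gmark y i)" using \<beta> by (rule mult_left_mono)
  then show ?thesis by (simp add: rate_eq abs_points_eq_sum[OF pos] exp_add[symmetric])
qed

text \<open>The increment is put on the gap in the middle of a run of \<open>2 m\<close> marks above the level \<open>e\<close>. A
  jump over at most \<open>m\<close> gaps that crosses the middle of such a run starts inside the run and pays
  \<open>\<beta> c\<^sub>1 e\<close>; longer jumps are rare. The normalisation of the mean costs the inverse square of the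
  probability of a run.\<close>

lemma D_le_runs:
  obtains K \<kappa> where "0 < K" "0 < \<kappa>"
    "\<And>\<beta> e m. 0 \<le> \<beta> \<Longrightarrow> low_prob e < 1 \<Longrightarrow>
      D \<beta> \<le> ennreal (K / (1 - low_prob e) ^ (4 * m) * (exp (- (\<beta> * (c\<^sub>1 * e))) + exp (- \<kappa> * real m powr stretch)))"
proof -
  obtain C \<kappa> where C: "0 < C" "0 < \<kappa>" "\<And>B. finite B \<Longrightarrow>
      (\<E> y. ennreal (exp (- 1 * (\<Sum>k\<in>B. gap y k) powr \<alpha>)))
      \<le> ennreal (C * exp (- \<kappa> * real (card B) powr stretch))"
    using sum_gaps_decay[of 1] by auto
  let ?E = "\<lambda>i. exp (- (\<kappa> / 2) * real (nat \<bar>i\<bar>) powr stretch)"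
  define S where "S = decay_sum (\<kappa> / 2)"
  have S: "0 \<le> S" using decay_sum(2)[of "\<kappa> / 2"] C(2) by (simp add: S_def)
  define K where "K = 3 * (mean_gap\<^sup>2 * C * S) + 1"
  have K: "0 < K" using C S by (simp add: K_def add_nonneg_pos)
  have "D \<beta> \<le> ennreal (K / (1 - low_prob e) ^ (4 * m) * (exp (- (\<beta> * (c\<^sub>1 * e))) + exp (- (\<kappa> / 2) * real m powr stretch)))"
    if \<beta>: "0 \<le> \<beta>" and q: "low_prob e < 1" for \<beta> e m
  proof -
    define p where "p = 1 - low_prob e"
    have p: "0 < p" using q by (simp add: p_def)
    define J where "J k = {1 - int m + k..int m + k}" for k
    have J: "finite (J k)" "card (J k) = 2 * m" for k by (simp_all add: J_def)
    define \<eta> where "\<eta> y = ((\<Prod>j\<in>J 0. of_bool (e < \<bar>gmark y j\<bar>)) :: real)" for y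
    have [measurable]: "\<eta> \<in> borel_measurable gap_seqs" unfolding \<eta>_def by measurable
    have \<eta>_shift: "\<eta> (seq_shift k y) = (\<Prod>j\<in>J k. of_bool (e < \<bar>gmark y j\<bar>))" for k y
    proof -
      have "J k = (\<lambda>j. j + k) ` J 0" by (simp add: J_def)
      then show ?thesis by (simp add: \<eta>_def seq_shift_apply prod.reindex)
    qed
    have \<eta>_bd: "0 \<le> \<eta> y" "\<eta> y \<le> 1" for y
      unfolding \<eta>_def by (rule prod_nonneg, simp) (rule prod_le_1, simp)
    have \<eta>_int: "integrable Q (\<lambda>y. \<eta> (seq_shift k y))" for k
      using \<eta>_bd by (intro integrable_const_bound[of _ 1]) simp_all
    have \<eta>2_int: "integrable Q (\<lambda>y. \<eta> (seq_shift k y) * \<eta> (seq_shift l y))" for k l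
      using \<eta>_bd by (intro integrable_const_bound[of _ 1]) (simp_all add: abs_mult mult_le_one)
    have \<eta>_mean: "(\<integral>y. \<eta> (seq_shift k y) \<partial>Q) = p ^ (2 * m)" for k
      using prob_high_marks[OF J(1)] J(2) by (simp add: \<eta>_shift p_def)
    define l where "l = mean_gap / p ^ (2 * m)"
    have l: "0 < l" using mean_gap_pos p by (simp add: l_def)
    have D_le: "D \<beta> \<le> 3 * crossing_energy \<beta> (\<lambda>y. l * \<eta> y)"
    proof (rule D_le_crossing_energy[OF _ _ _ _ \<beta>])
      show "\<bar>l * \<eta> y\<bar> \<le> l" for y
        using l \<eta>_bd[of y] by (simp add: abs_mult)
      show "(\<integral>y. l * \<eta> y \<partial>Q) = mean_gap"
        using \<eta>_mean[of 0] p by (simp add: l_def)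
      show "cesaro_null (\<lambda>y. l * \<eta> y - mean_gap)"
      proof (rule cesaro_null_if_uncorrelated[where F = "l + mean_gap" and r = "2 * m"])
        show "\<bar>l * \<eta> y - mean_gap\<bar> \<le> l + mean_gap" for y
        proof -
          have "0 \<le> l * \<eta> y" "l * \<eta> y \<le> l" using l \<eta>_bd[of y] by simp_all
          then show ?thesis using mean_gap_pos by linarith
        qed
        show "(\<integral>y. (l * \<eta> (seq_shift (int k) y) - mean_gap) * (l * \<eta> (seq_shift (int k') y) - mean_gap) \<partial>Q) = 0"
          if kk: "k + 2 * m \<le> k'" for k k'
        proof -
          have disj: "J (int k) \<inter> J (int k') = {}" using kk by (auto simp: J_def)
          have "\<eta> (seq_shift (int k) y) * \<eta> (seq_shift (int k') y)
              = (\<Prod>j\<in>J (int k) \<union> J (int k'). of_bool (e < \<bar>gmark y j\<bar>))" for y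
            unfolding \<eta>_shift by (rule prod.union_disjoint[symmetric]) (simp_all add: J disj)
          then have "(\<integral>y. \<eta> (seq_shift (int k) y) * \<eta> (seq_shift (int k') y) \<partial>Q) = p ^ card (J (int k) \<union> J (int k'))"
            using prob_high_marks[of "J (int k) \<union> J (int k')" e] by (simp add: J p_def)
          also have "card (J (int k) \<union> J (int k')) = 2 * m + 2 * m"
            by (subst card_Un_disjoint) (simp_all add: J disj)
          also have "p ^ (2 * m + 2 * m) = p ^ (2 * m) * p ^ (2 * m)" by (rule power_add)
          finally have cov: "(\<integral>y. \<eta> (seq_shift (int k) y) * \<eta> (seq_shift (int k') y) \<partial>Q) = p ^ (2 * m) * p ^ (2 * m)" .
          have lp: "l * p ^ (2 * m) = mean_gap" using p by (simp add: l_def)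
          have "(\<integral>y. (l * \<eta> (seq_shift (int k) y) - mean_gap) * (l * \<eta> (seq_shift (int k') y) - mean_gap) \<partial>Q)
              = (\<integral>y. l\<^sup>2 * (\<eta> (seq_shift (int k) y) * \<eta> (seq_shift (int k') y))
                  - l * mean_gap * \<eta> (seq_shift (int k) y) - l * mean_gap * \<eta> (seq_shift (int k') y) + mean_gap\<^sup>2 \<partial>Q)"
            by (simp add: power2_eq_square algebra_simps)
          also have "\<dots> = l\<^sup>2 * (p ^ (2 * m) * p ^ (2 * m)) - l * mean_gap * p ^ (2 * m) - l * mean_gap * p ^ (2 * m) + mean_gap\<^sup>2"
            using \<eta>_int \<eta>2_int by (simp add: cov \<eta>_mean prob_space)
          also have "\<dots> = (l * p ^ (2 * m))\<^sup>2 - 2 * mean_gap * (l * p ^ (2 * m)) + mean_gap\<^sup>2"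
            by (simp add: power2_eq_square algebra_simps)
          also have "\<dots> = 0" unfolding lp by (simp add: power2_eq_square)
          finally show ?thesis .
        qed
      qed simp
    qed simp
    let ?x = "exp (- (\<beta> * (c\<^sub>1 * e)))" and ?y = "exp (- (\<kappa> / 2) * real m powr stretch)"
    \<comment> \<open>Half of the decay of the rate is spent on the long jumps, the other half makes the sum over \<open>i\<close> converge.\<close>
    have term_le: "(\<E> y. ennreal (R \<beta> i y * (l * \<eta> (seq_shift k y))\<^sup>2))
        \<le> ennreal (l\<^sup>2 * C * (?x + ?y) * ?E i)" if k: "k \<in> crossed i" for i k
    proof -
      define t where "t = (if nat \<bar>i\<bar> \<le> m then ?x else 1)"
      have t: "0 \<le> t" by (simp add: t_def)
      have "(\<E> y. ennreal (R \<beta> i y * (l * \<eta> (seq_shift k y))\<^sup>2))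
          \<le> (\<E> y. ennreal (l\<^sup>2 * t) * ennreal (exp (- 1 * (\<Sum>k\<in>crossed i. gap y k) powr \<alpha>)))"
        using gaps_pos marks_range
      proof (intro nn_integral_mono_AE, eventually_elim)
        case (elim y)
        let ?X = "\<Sum>k\<in>crossed i. gap y k"
        have "R \<beta> i y * (l * \<eta> (seq_shift k y))\<^sup>2 \<le> l\<^sup>2 * t * exp (- (?X powr \<alpha>))"
        proof (cases "\<eta> (seq_shift k y) = 0")
          case True
          then show ?thesis using t by simp
        next
          case False
          have "R \<beta> i y \<le> t * exp (- (?X powr \<alpha>))"
          proof (cases "nat \<bar>i\<bar> \<le> m")
            case True
            have "0 \<in> J k" using k True by (auto simp: crossed_def J_def)
            then have "e < \<bar>gmark y 0\<bar>"
              using False J(1) unfolding \<eta>_shift by (auto simp: prod_zero_iff)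
            then show ?thesis
              using True rate_le_high_mark[OF elim(3,4) \<beta>] by (simp add: t_def)
          next
            case False
            then show ?thesis using rate_le_exp_sum[OF elim(3,4) \<beta>, of i] by (simp add: t_def)
          qed
          moreover have "(l * \<eta> (seq_shift k y))\<^sup>2 \<le> l\<^sup>2"
            using l \<eta>_bd[of "seq_shift k y"] by (intro power_mono) (simp_all add: mult_left_le)
          ultimately have "R \<beta> i y * (l * \<eta> (seq_shift k y))\<^sup>2 \<le> t * exp (- (?X powr \<alpha>)) * l\<^sup>2"
            using t by (intro mult_mono) simp_all
          then show ?thesis by (simp add: mult_ac)
        qed
        then show ?case using t by (simp add: ennreal_leI flip: ennreal_mult)
      qed
      also have "\<dots> = ennreal (l\<^sup>2 * t) * (\<E> y. ennreal (exp (- 1 * (\<Sum>k\<in>crossed i. gap y k) powr \<alpha>)))"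
        by (rule nn_integral_cmult) simp
      also have "\<dots> \<le> ennreal (l\<^sup>2 * t) * ennreal (C * exp (- \<kappa> * real (nat \<bar>i\<bar>) powr stretch))"
        using C(3)[of "crossed i"] by (intro mult_left_mono) (simp_all add: card_crossed)
      also have "\<dots> = ennreal (l\<^sup>2 * C * (t * exp (- \<kappa> * real (nat \<bar>i\<bar>) powr stretch)))"
        using t C by (simp add: mult_ac flip: ennreal_mult)
      also have "\<dots> \<le> ennreal (l\<^sup>2 * C * ((?x + ?y) * ?E i))"
      proof (intro ennreal_leI mult_left_mono)
        have E2: "exp (- \<kappa> * real (nat \<bar>i\<bar>) powr stretch) = ?E i * ?E i"
          by (simp add: exp_add[symmetric])
        have "t * ?E i \<le> ?x + ?y"
        proof (cases "nat \<bar>i\<bar> \<le> m")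
          case True
          have "?x * ?E i \<le> ?x * 1" using C by (intro mult_left_mono) simp_all
          also have "\<dots> \<le> ?x + ?y" by simp
          finally show ?thesis using True by (simp only: t_def if_True)
        next
          case False
          then have "real m powr stretch \<le> real (nat \<bar>i\<bar>) powr stretch"
            using stretch_pos by (intro powr_mono2) simp_all
          then have "(\<kappa> / 2) * real m powr stretch \<le> (\<kappa> / 2) * real (nat \<bar>i\<bar>) powr stretch"
            using C by (intro mult_left_mono) simp_all
          then have "?E i \<le> ?y" by simp
          also have "\<dots> \<le> ?x + ?y" by simp
          finally show ?thesis using False by (simp only: t_def if_False mult_1)
        qed
        then have "t * ?E i * ?E i \<le> (?x + ?y) * ?E i" by (rule mult_right_mono) simp
        then show "t * exp (- \<kappa> * real (nat \<bar>i\<bar>) powr stretch) \<le> (?x + ?y) * ?E i"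
          unfolding E2 by (simp only: mult.assoc)
      qed (use C in simp)
      finally show ?thesis by (simp add: mult.assoc)
    qed
    have "crossing_energy \<beta> (\<lambda>y. l * \<eta> y) \<le> ennreal (l\<^sup>2 * C * (?x + ?y) * S)"
      unfolding S_def using C term_le by (intro crossing_energy_le_decay) (simp_all add: add_nonneg_nonneg)
    then have "3 * crossing_energy \<beta> (\<lambda>y. l * \<eta> y) \<le> 3 * ennreal (l\<^sup>2 * C * (?x + ?y) * S)"
      by (intro mult_left_mono) simp_all
    also have "3 * ennreal (l\<^sup>2 * C * (?x + ?y) * S) = ennreal (3 * (l\<^sup>2 * C * (?x + ?y) * S))"
      by (subst ennreal_mult') simp_all
    also have "\<dots> \<le> ennreal (K / p ^ (4 * m) * (?x + ?y))"
    proof (rule ennreal_leI)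
      have "(p ^ (2 * m))\<^sup>2 = p ^ (4 * m)" by (simp flip: power_mult)
      then have l2: "l\<^sup>2 = mean_gap\<^sup>2 / p ^ (4 * m)" by (simp add: l_def power_divide)
      have "3 * (l\<^sup>2 * C * (?x + ?y) * S) = (3 * (mean_gap\<^sup>2 * C * S)) / p ^ (4 * m) * (?x + ?y)"
        by (simp add: l2)
      also have "\<dots> \<le> K / p ^ (4 * m) * (?x + ?y)"
        using p by (intro mult_right_mono divide_right_mono) (simp_all add: K_def add_nonneg_nonneg)
      finally show "3 * (l\<^sup>2 * C * (?x + ?y) * S) \<le> K / p ^ (4 * m) * (?x + ?y)" .
    qed
    finally show ?thesis using D_le unfolding p_def by (rule order_trans[rotated])
  qed
  with K C(2) show thesis by (intro that[of K "\<kappa> / 2"]) simp_all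
qed

text \<open>The bound for runs of real length \<open>x\<close>, where \<open>1 - q \<ge> exp (- 2 q)\<close> turns the probability of a run into an
  exponential. The constant absorbs the rounding of \<open>x\<close>.\<close>

theorem D_le_high_marks:
  obtains K \<kappa> where "0 < K" "0 < \<kappa>"
    "\<And>\<beta> e x. 0 \<le> \<beta> \<Longrightarrow> low_prob e \<le> 1 / 2 \<Longrightarrow> 0 \<le> x \<Longrightarrow>
      D \<beta> \<le> ennreal (K * exp (8 * low_prob e * x) * (exp (- (\<beta> * (c\<^sub>1 * e))) + exp (- \<kappa> * x powr stretch)))"
proof -
  obtain K \<kappa> where K: "0 < K" "0 < \<kappa>" "\<And>\<beta> e m. 0 \<le> \<beta> \<Longrightarrow> low_prob e < 1 \<Longrightarrow>
      D \<beta> \<le> ennreal (K / (1 - low_prob e) ^ (4 * m) * (exp (- (\<beta> * (c\<^sub>1 * e))) + exp (- \<kappa> * real m powr stretch)))"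
    using D_le_runs by blast
  have "D \<beta> \<le> ennreal (K * exp \<kappa> * exp (8 * low_prob e * x) * (exp (- (\<beta> * (c\<^sub>1 * e))) + exp (- \<kappa> * x powr stretch)))"
    if \<beta>: "0 \<le> \<beta>" and q: "low_prob e \<le> 1 / 2" and x: "0 \<le> x" for \<beta> e x
  proof -
    define m where "m = nat \<lfloor>x\<rfloor>"
    have m: "real m \<le> x" "x \<le> real m + 1" using x by (simp_all add: m_def)
    let ?q = "low_prob e" and ?b = "exp (- (\<beta> * (c\<^sub>1 * e)))"
    have "exp (- (8 * ?q * real m)) = exp (- 2 * ?q) ^ (4 * m)"
      by (simp add: mult_ac flip: exp_of_nat_mult)
    also have "\<dots> \<le> (1 - ?q) ^ (4 * m)"
      using q low_prob_bounds[of e] by (intro power_mono one_minus_ge_exp) simp_all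
    finally have "1 / (1 - ?q) ^ (4 * m) \<le> 1 / exp (- (8 * ?q * real m))"
      using q by (intro divide_left_mono) simp_all
    also have "\<dots> = exp (8 * ?q * real m)" by (simp add: exp_minus inverse_eq_divide)
    also have "\<dots> \<le> exp (8 * ?q * x)" using m low_prob_bounds[of e] by (simp add: mult_left_mono)
    finally have runs: "1 / (1 - ?q) ^ (4 * m) \<le> exp (8 * ?q * x)" .
    have "x powr stretch \<le> (real m + 1) powr stretch"
      using m x stretch_pos by (intro powr_mono2) simp_all
    also have "\<dots> \<le> real m powr stretch + 1"
      using stretch_pos stretch_le by (intro powr_add_one_le) simp_all
    finally have "\<kappa> * x powr stretch \<le> \<kappa> * (real m powr stretch + 1)"
      using K by (intro mult_left_mono) simp_all
    then have jumps: "exp (- \<kappa> * real m powr stretch) \<le> exp \<kappa> * exp (- \<kappa> * x powr stretch)"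
      by (simp add: algebra_simps flip: exp_add)
    have "1 * ?b \<le> exp \<kappa> * ?b" using K by (intro mult_right_mono) simp_all
    then have sum: "?b + exp (- \<kappa> * real m powr stretch) \<le> exp \<kappa> * (?b + exp (- \<kappa> * x powr stretch))"
      using jumps by (simp only: distrib_left mult_1_left add_mono)
    have "K / (1 - ?q) ^ (4 * m) * (?b + exp (- \<kappa> * real m powr stretch))
        = K * (1 / (1 - ?q) ^ (4 * m) * (?b + exp (- \<kappa> * real m powr stretch)))" by simp
    also have "\<dots> \<le> K * (exp (8 * ?q * x) * (exp \<kappa> * (?b + exp (- \<kappa> * x powr stretch))))"
      using K by (intro mult_left_mono mult_mono runs sum) (simp_all add: add_nonneg_nonneg)
    also have "\<dots> = K * exp \<kappa> * exp (8 * ?q * x) * (?b + exp (- \<kappa> * x powr stretch))"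
      by (simp only: mult_ac)
    finally have le: "K / (1 - ?q) ^ (4 * m) * (?b + exp (- \<kappa> * real m powr stretch))
        \<le> K * exp \<kappa> * exp (8 * ?q * x) * (?b + exp (- \<kappa> * x powr stretch))" .
    have "?q < 1" using q by simp
    from K(3)[OF \<beta> this] le show ?thesis by (rule order_trans[OF _ ennreal_leI])
  qed
  with K(1,2) show thesis by (intro that[of "K * exp \<kappa>" \<kappa>]) simp_all
qed

end

section \<open>The flow through points with small marks\<close>

lemma unique_pair_sum:
  fixes k\<^sub>0 n\<^sub>0 N :: nat
  assumes "k\<^sub>0 < n\<^sub>0"
  shows "(\<Sum>n\<in>{1..N}. \<Sum>k<n. (of_bool (k = k\<^sub>0 \<and> n = n\<^sub>0) :: real)) = of_bool (n\<^sub>0 \<le> N)"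
proof -
  have "(\<Sum>k<n. (of_bool (k = k\<^sub>0 \<and> n = n\<^sub>0) :: real)) = (if n = n\<^sub>0 then 1 else 0)" for n
  proof (cases "n = n\<^sub>0")
    case True
    then have "(\<Sum>k<n. (of_bool (k = k\<^sub>0 \<and> n = n\<^sub>0) :: real)) = (\<Sum>k\<in>{k\<^sub>0}. 1)"
      using assms by (intro sum.mono_neutral_cong_right) auto
    then show ?thesis using True by simp
  qed simp
  then show ?thesis using assms by simp
qed

definition excursion :: "(int \<Rightarrow> bool) \<Rightarrow> nat \<Rightarrow> bool" where
  "excursion P n \<longleftrightarrow> P 0 \<and> P (int n) \<and> (\<forall>j\<in>{0<..<int n}. \<not> P j)"

text \<open>The gap between the labels 0 and 1 lies in exactly one of the intervals between consecutive labels
  that satisfy \<open>P\<close>, namely the one from the last such label \<open>\<le> 0\<close> to the first such label \<open>\<ge> 1\<close>. This is the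
  reason why jumps along these intervals form a flow.\<close>

lemma excursion_partition:
  fixes P :: "int \<Rightarrow> bool"
  assumes "\<exists>j\<le>0. P j" "\<exists>j\<ge>1. P j"
  obtains k\<^sub>0 n\<^sub>0 where "k\<^sub>0 < n\<^sub>0"
    "\<And>k n. k < n \<Longrightarrow> excursion (\<lambda>j. P (j - int k)) n \<longleftrightarrow> k = k\<^sub>0 \<and> n = n\<^sub>0"
proof -
  obtain a :: nat where a: "P (- int a)" "\<And>i. i < a \<Longrightarrow> \<not> P (- int i)"
  proof -
    obtain j where "j \<le> 0" "P j" using assms(1) by blast
    then have "P (- int (nat (- j)))" by simp
    then have "P (- int (LEAST i. P (- int i)))" by (rule LeastI)
    moreover have "\<not> P (- int i)" if "i < (LEAST i. P (- int i))" for i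
      using not_less_Least[OF that] .
    ultimately show thesis by (rule that)
  qed
  obtain b :: nat where b: "P (1 + int b)" "\<And>i. i < b \<Longrightarrow> \<not> P (1 + int i)"
  proof -
    obtain j where "1 \<le> j" "P j" using assms(2) by blast
    then have "P (1 + int (nat (j - 1)))" by simp
    then have "P (1 + int (LEAST i. P (1 + int i)))" by (rule LeastI)
    moreover have "\<not> P (1 + int i)" if "i < (LEAST i. P (1 + int i))" for i
      using not_less_Least[OF that] .
    ultimately show thesis by (rule that)
  qed
  have between: "\<not> P j" if "- int a < j" "j < 1 + int b" for j
  proof (cases "j \<le> 0")
    case True
    then show ?thesis using a(2)[of "nat (- j)"] that by simp
  next
    case False
    then show ?thesis using b(2)[of "nat (j - 1)"] that by simp
  qed
  have "excursion (\<lambda>j. P (j - int k)) n \<longleftrightarrow> k = a \<and> n = Suc (a + b)" if kn: "k < n" for k n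
  proof
    assume ex: "excursion (\<lambda>j. P (j - int k)) n"
    have in_between: "\<not> P j" if "- int k < j" "j < int n - int k" for j
      using ex that unfolding excursion_def by (auto dest!: bspec[of _ _ "j + int k"])
    have ends: "P (- int k)" "P (int n - int k)" using ex by (simp_all add: excursion_def)
    have "- int k \<le> - int a"
      using between[of "- int k"] ends(1) by linarith
    moreover have "- int a \<le> - int k"
      using in_between[of "- int a"] a(1) kn by linarith
    moreover have "1 + int b \<le> int n - int k"
      using between[of "int n - int k"] ends(2) kn by linarith
    moreover have "int n - int k \<le> 1 + int b"
      using in_between[of "1 + int b"] b(1) by linarith
    ultimately show "k = a \<and> n = Suc (a + b)" by linarith
  next
    assume "k = a \<and> n = Suc (a + b)"
    then show "excursion (\<lambda>j. P (j - int k)) n"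
      using a(1) b(1) between by (auto simp: excursion_def)
  qed
  then show thesis using that[of a "Suc (a + b)"] by simp
qed

text \<open>Either \<open>x\<^sup>a \<le> s x\<close>, or \<open>x\<^sup>1\<^sup>-\<^sup>a < 1 / s\<close>, and then \<open>x\<^sup>a\<close> is at most the last term.\<close>

lemma stretched_le_linear:
  fixes x s a :: real
  assumes "0 < a" "a < 1" "0 < s" "0 \<le> x"
  shows "x powr a \<le> s * x + s powr (- (a / (1 - a)))"
proof (cases "x powr a \<le> s * x")
  case False
  then have x: "0 < x" using assms by (cases "x = 0") simp_all
  have "s * (x powr (1 - a) * x powr a) < 1 * x powr a"
    using False x by (simp flip: powr_add)
  then have "s * x powr (1 - a) < 1" using x by (simp add: mult.assoc[symmetric])
  then have "x powr (1 - a) < s powr (- 1)" using assms by (simp add: powr_minus field_simps)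
  then have "(x powr (1 - a)) powr (a / (1 - a)) \<le> (s powr (- 1)) powr (a / (1 - a))"
    using assms by (intro powr_mono2) simp_all
  moreover have "(x powr (1 - a)) powr (a / (1 - a)) = x powr a"
    using assms by (simp add: powr_powr)
  moreover have "(s powr (- 1)) powr (a / (1 - a)) = s powr (- (a / (1 - a)))"
    by (subst powr_powr) simp
  ultimately have "x powr a \<le> s powr (- (a / (1 - a)))" by simp
  moreover have "0 \<le> s * x" using assms by simp
  ultimately show ?thesis by linarith
qed (simp add: add_increasing2)

context iid_gaps
begin

lemma AE_low_mark_exists:
  assumes q: "0 < low_prob e" and J: "infinite J"
  shows "AE y in Q. \<exists>j\<in>J. \<bar>gmark y j\<bar> \<le> e"
proof -
  let ?A = "{y \<in> space Q. \<forall>j\<in>J. e < \<bar>gmark y j\<bar>}"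
  have [measurable]: "?A \<in> sets Q" by measurable
  have le: "prob ?A \<le> (1 - low_prob e) ^ n" for n
  proof -
    obtain F where F: "F \<subseteq> J" "finite F" "card F = n" using infinite_arbitrarily_large[OF J] by blast
    have "prob ?A = (\<integral>y. indicator ?A y \<partial>Q)" by simp
    also have "\<dots> \<le> (\<integral>y. (\<Prod>j\<in>F. of_bool (e < \<bar>gmark y j\<bar>)) \<partial>Q)"
    proof (rule integral_mono)
      show "integrable Q (indicator ?A :: _ \<Rightarrow> real)" by (simp add: emeasure_eq_measure)
      show "integrable Q (\<lambda>y. (\<Prod>j\<in>F. of_bool (e < \<bar>gmark y j\<bar>)) :: real)"
        by (intro integrable_const_bound[of _ 1]) (auto simp: abs_prod intro!: prod_le_1)
      show "indicator ?A y \<le> ((\<Prod>j\<in>F. of_bool (e < \<bar>gmark y j\<bar>)) :: real)" for y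
      proof (cases "y \<in> ?A")
        case True
        then have "((\<Prod>j\<in>F. of_bool (e < \<bar>gmark y j\<bar>)) :: real) = 1" using F by (intro prod.neutral) auto
        then show ?thesis using True by simp
      qed (auto intro!: prod_nonneg)
    qed
    also have "\<dots> = (1 - low_prob e) ^ n" using prob_high_marks[OF F(2)] F(3) by simp
    finally show ?thesis .
  qed
  have "(\<lambda>n. (1 - low_prob e) ^ n) \<longlonglongrightarrow> 0"
    using q low_prob_bounds[of e] by (intro LIMSEQ_power_zero) simp
  then have "prob ?A \<le> 0" by (rule LIMSEQ_le_const) (use le in blast)
  then have "emeasure Q ?A = 0" by (simp add: emeasure_eq_measure measure_le_0_iff)
  then have "AE y in Q. y \<notin> ?A" by (intro AE_not_in) (simp add: null_setsI)
  then show ?thesis by (rule AE_mp) (auto intro!: AE_I2 simp: not_less)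
qed

text \<open>For \<open>n > 0\<close> an excursion consists of two low marks and \<open>n - 1\<close> high marks, all independent.\<close>

lemma nn_integral_excursion:
  assumes n: "0 < n"
  shows "(\<E> y. of_bool (excursion (\<lambda>j. \<bar>gmark y j\<bar> \<le> e) n))
    \<le> ennreal ((low_prob e)\<^sup>2 * (1 - low_prob e) ^ (n - 1))"
proof -
  let ?f = "\<lambda>j x. (if j \<in> {0, int n} then of_bool (\<bar>x\<bar> \<le> e) else of_bool (e < \<bar>x\<bar>)) :: ennreal"
  let ?J = "{0..int n}"
  have [measurable]: "?f j \<in> borel_measurable borel" for j by measurable
  have meas: "(\<E> y. f (gmark y j)) = (\<E> y. f (gmark y 0))"
    if [measurable]: "f \<in> borel_measurable borel" for f :: "real \<Rightarrow> ennreal" and j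
    using nn_integral_shift[of "\<lambda>y. f (gmark y 0)" j] by (simp add: seq_shift_apply)
  have low: "(\<E> y. of_bool (\<bar>gmark y j\<bar> \<le> e)) = ennreal (low_prob e)" for j
  proof -
    have "(\<E> y. of_bool (\<bar>gmark y j\<bar> \<le> e)) = (\<E> y. of_bool (\<bar>gmark y 0\<bar> \<le> e))"
      by (rule meas) measurable
    also have "\<dots> = (\<E> y. indicator {y \<in> space Q. \<bar>gmark y 0\<bar> \<le> e} y)"
      by (intro nn_integral_cong) (simp add: indicator_def)
    also have "\<dots> = ennreal (low_prob e)" by (simp add: low_prob_def emeasure_eq_measure)
    finally show ?thesis .
  qed
  have high: "(\<E> y. of_bool (e < \<bar>gmark y j\<bar>)) = ennreal (1 - low_prob e)" for j
  proof -
    have "(\<E> y. of_bool (e < \<bar>gmark y j\<bar>)) = (\<E> y. ennreal (of_bool (e < \<bar>gmark y j\<bar>)))"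
      by (intro nn_integral_cong) simp
    also have "\<dots> = ennreal (\<integral>y. of_bool (e < \<bar>gmark y j\<bar>) \<partial>Q)"
      by (intro nn_integral_eq_integral integrable_const_bound[of _ 1]) simp_all
    also have "\<dots> = ennreal (1 - low_prob e)" using prob_high_marks[of "{j}" e] by simp
    finally show ?thesis .
  qed
  have "indep_vars (\<lambda>_. borel) (\<lambda>j y. ?f j (gmark y j)) ?J"
    by (rule indep_vars_compose2[OF indep_vars_subset[OF marks_indep]]) simp_all
  then have "(\<E> y. (\<Prod>j\<in>?J. ?f j (gmark y j))) = (\<Prod>j\<in>?J. \<E> y. ?f j (gmark y j))"
    by (intro indep_vars_nn_integral) simp_all
  also have "\<dots> = (\<Prod>j\<in>?J. if j \<in> {0, int n} then ennreal (low_prob e) else ennreal (1 - low_prob e))"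
  proof (rule prod.cong[OF refl])
    fix j
    show "(\<E> y. ?f j (gmark y j))
        = (if j \<in> {0, int n} then ennreal (low_prob e) else ennreal (1 - low_prob e))"
      by (cases "j \<in> {0, int n}") (simp_all only: if_True if_False low high)
  qed
  also have "\<dots> = (\<Prod>j\<in>{0, int n}. ennreal (low_prob e)) * (\<Prod>j\<in>{0<..<int n}. ennreal (1 - low_prob e))"
  proof -
    have "?J = {0, int n} \<union> {0<..<int n}" using n by auto
    then show ?thesis
      by (simp only:) (subst prod.union_disjoint, auto intro!: arg_cong2[of _ _ _ _ "(*)"] prod.cong)
  qed
  also have "\<dots> = ennreal ((low_prob e)\<^sup>2 * (1 - low_prob e) ^ (n - 1))"
  proof -
    have "card {0<..<int n} = n - 1" using n by (simp add: nat_diff_distrib)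
    then show ?thesis
      using n low_prob_bounds[of e]
      by (simp add: power2_eq_square ennreal_power flip: ennreal_mult)
  qed
  also have "(\<E> y. (\<Prod>j\<in>?J. ?f j (gmark y j)))
      = (\<E> y. of_bool (excursion (\<lambda>j. \<bar>gmark y j\<bar> \<le> e) n))"
  proof (intro nn_integral_cong)
    fix y
    show "(\<Prod>j\<in>?J. ?f j (gmark y j)) = of_bool (excursion (\<lambda>j. \<bar>gmark y j\<bar> \<le> e) n)"
    proof (cases "excursion (\<lambda>j. \<bar>gmark y j\<bar> \<le> e) n")
      case True
      then have "(\<Prod>j\<in>?J. ?f j (gmark y j)) = 1"
        by (intro prod.neutral) (auto simp: excursion_def not_le)
      then show ?thesis using True by simp
    next
      case False
      then consider "e < \<bar>gmark y 0\<bar>" | "e < \<bar>gmark y (int n)\<bar>"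
        | j where "j \<in> {0<..<int n}" "\<bar>gmark y j\<bar> \<le> e"
        unfolding excursion_def by force
      then have "\<exists>j\<in>?J. ?f j (gmark y j) = 0"
      proof cases
        case 1
        then show ?thesis by (intro bexI[of _ 0]) simp_all
      next
        case 2
        then show ?thesis by (intro bexI[of _ "int n"]) simp_all
      next
        case 3
        then show ?thesis by (intro bexI[of _ j]) simp_all
      qed
      then have "(\<Prod>j\<in>?J. ?f j (gmark y j)) = 0" by (intro prod_zero) auto
      then show ?thesis using False by simp
    qed
  qed
  finally show ?thesis by simp
qed

lemma nn_integral_marks_mult_gaps:
  assumes [measurable]: "f \<in> borel_measurable (Pi\<^sub>M UNIV (\<lambda>_. borel))" "g \<in> borel_measurable (Pi\<^sub>M UNIV (\<lambda>_. borel))"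
  shows "(\<E> y. f (gap y) * g (gmark y)) = (\<E> y. f (gap y)) * (\<E> y. g (gmark y))"
  using indep_var_nn_integral_mult[OF gaps_marks_indep assms] .

text \<open>By convexity of the exponential function between \<open>0\<close> and \<open>\<epsilon>\<close>, the moment is at most \<open>1 + K s\<close>.\<close>

lemma linear_exp_moment:
  assumes eps: "0 < \<epsilon>" "(\<E> y. ennreal (exp (\<epsilon> * gap y 0))) < \<infinity>"
  obtains K where "1 / \<epsilon> \<le> K"
    "\<And>s. 0 \<le> s \<Longrightarrow> s \<le> \<epsilon> \<Longrightarrow> (\<E> y. ennreal (exp (s * gap y 0))) \<le> ennreal (exp (K * s))"
proof -
  define L where "L = enn2real (\<E> y. ennreal (exp (\<epsilon> * gap y 0)))"
  have L: "(\<E> y. ennreal (exp (\<epsilon> * gap y 0))) = ennreal L" "0 \<le> L"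
    using eps(2) by (simp_all add: L_def)
  define K where "K = (L + 1) / \<epsilon>"
  have "(\<E> y. ennreal (exp (s * gap y 0))) \<le> ennreal (exp (K * s))" if s: "0 \<le> s" "s \<le> \<epsilon>" for s
  proof -
    have pt: "exp (s * x) \<le> 1 + s / \<epsilon> * exp (\<epsilon> * x)" for x
    proof -
      have "exp ((1 - s / \<epsilon>) *\<^sub>R 0 + (s / \<epsilon>) *\<^sub>R (\<epsilon> * x)) \<le> (1 - s / \<epsilon>) * exp 0 + (s / \<epsilon>) * exp (\<epsilon> * x)"
        using s eps by (intro convex_onD[OF exp_convex]) simp_all
      then have "exp (s * x) \<le> (1 - s / \<epsilon>) + s / \<epsilon> * exp (\<epsilon> * x)" using eps by simp
      moreover have "0 \<le> s / \<epsilon>" using s eps by simp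
      ultimately show ?thesis by linarith
    qed
    have "(\<E> y. ennreal (exp (s * gap y 0))) \<le> (\<E> y. 1 + ennreal (s / \<epsilon>) * ennreal (exp (\<epsilon> * gap y 0)))"
    proof (rule nn_integral_mono)
      fix y
      have "ennreal (exp (s * gap y 0)) \<le> ennreal (1 + s / \<epsilon> * exp (\<epsilon> * gap y 0))"
        by (rule ennreal_leI) (rule pt)
      also have "\<dots> = ennreal 1 + ennreal (s / \<epsilon> * exp (\<epsilon> * gap y 0))"
        using s eps by (intro ennreal_plus) simp_all
      also have "\<dots> = 1 + ennreal (s / \<epsilon>) * ennreal (exp (\<epsilon> * gap y 0))"
        using s eps by (subst ennreal_mult) simp_all
      finally show "ennreal (exp (s * gap y 0)) \<le> \<dots>" .
    qed
    also have "\<dots> = ennreal 1 + ennreal (s / \<epsilon>) * ennreal L"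
      using L by (simp add: nn_integral_add nn_integral_cmult emeasure_space_1)
    also have "\<dots> = ennreal 1 + ennreal (s / \<epsilon> * L)"
      using s eps L by (subst ennreal_mult) simp_all
    also have "\<dots> = ennreal (1 + s / \<epsilon> * L)"
      using s eps L by (intro ennreal_plus[symmetric]) simp_all
    also have "\<dots> \<le> ennreal (exp (K * s))"
    proof (rule ennreal_leI)
      have "1 + s / \<epsilon> * L \<le> 1 + K * s" using s eps by (simp add: K_def field_simps)
      also have "\<dots> \<le> exp (K * s)" by (rule exp_ge_add_one_self)
      finally show "1 + s / \<epsilon> * L \<le> exp (K * s)" .
    qed
    finally show ?thesis .
  qed
  moreover have "1 / \<epsilon> \<le> K" using L eps by (simp add: K_def divide_right_mono)
  ultimately show thesis by (intro that)
qed

text \<open>The flow goes through consecutive points with marks below the level \<open>e\<close>. Let \<open>q\<close> be the probability of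
  such a mark. With \<open>s\<close> proportional to \<open>q\<close>, the resistance of a jump over \<open>n\<close> gaps is at most
  \<open>exp (s x\<^sub>n)\<close> up to a factor \<open>A\<close>. Its mean is at most \<open>exp (q n / 2)\<close>, which is absorbed by the
  probability \<open>q\<^sup>2 (1 - q)\<^sup>n\<^sup>-\<^sup>1\<close> of the jump. The geometric series contributes a factor of order \<open>1 / q\<close>,
  so that the total resistance is at most \<open>8 A\<close>.\<close>

theorem D_ge_low_marks:
  assumes \<alpha>1: "\<alpha> < 1"
    and eps: "0 < \<epsilon>" "(\<E> y. ennreal (exp (\<epsilon> * gap y 0))) < \<infinity>"
  obtains C M where "0 < C" "0 < M"
    "\<And>\<beta> e. 0 \<le> \<beta> \<Longrightarrow> 0 < low_prob e \<Longrightarrow>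
      ennreal (C * exp (- (2 * c\<^sub>2 * (\<beta> * e)) - M * low_prob e powr (- (\<alpha> / (1 - \<alpha>))))) \<le> D \<beta>"
proof -
  obtain K where K: "1 / \<epsilon> \<le> K"
    "\<And>s. 0 \<le> s \<Longrightarrow> s \<le> \<epsilon> \<Longrightarrow> (\<E> y. ennreal (exp (s * gap y 0))) \<le> ennreal (exp (K * s))"
    using linear_exp_moment[OF eps] by blast
  have K0: "0 < K" using K(1) eps(1) by (meson divide_pos_pos less_le_trans zero_less_one)
  define M where "M = (2 * K) powr (\<alpha> / (1 - \<alpha>))"
  have M: "0 < M" using K0 by (simp add: M_def)
  define C where "C = mean_gap\<^sup>2 / 8"
  have C: "0 < C" using mean_gap_pos by (simp add: C_def)
  have "ennreal (C * exp (- (2 * c\<^sub>2 * (\<beta> * e)) - M * low_prob e powr (- (\<alpha> / (1 - \<alpha>))))) \<le> D \<beta>"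
    if \<beta>: "0 \<le> \<beta>" and q0: "0 < low_prob e" for \<beta> e
  proof -
    define q where "q = low_prob e"
    have q: "0 < q" "q \<le> 1" using q0 low_prob_bounds[of e] by (simp_all add: q_def)
    define s where "s = q / (2 * K)"
    have s: "0 < s" using q K0 by (simp add: s_def)
    have "s \<le> \<epsilon>"
    proof -
      have "q / (2 * K) \<le> 1 / K" using q K0 by (simp add: field_simps)
      also have "\<dots> \<le> \<epsilon>" using K(1) K0 eps(1) by (simp add: field_simps)
      finally show ?thesis by (simp add: s_def)
    qed
    note s_le = this
    define P where "P y j \<longleftrightarrow> \<bar>gmark y j\<bar> \<le> e" for y :: "int \<Rightarrow> real \<times> real" and j
    define \<theta> where "\<theta> n y = (of_bool (excursion (P y) n) :: real)" for n y
    define A where "A = exp (2 * c\<^sub>2 * (\<beta> * e) + s powr (- (\<alpha> / (1 - \<alpha>))))"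
    have A: "0 < A" by (simp add: A_def)
    have [measurable]: "\<theta> n \<in> borel_measurable gap_seqs" for n
      unfolding \<theta>_def P_def excursion_def by measurable
    have shifted: "P (seq_shift (- int k) y) = (\<lambda>j. P y (j - int k))" for k y
      by (simp add: P_def fun_eq_iff seq_shift_apply)
    have both: "AE y in Q. (\<exists>j\<le>0. P y j) \<and> (\<exists>j\<ge>1. P y j)"
    proof -
      have "AE y in Q. \<exists>j\<in>{..0}. \<bar>gmark y j\<bar> \<le> e"
        by (rule AE_low_mark_exists[OF q0]) (rule infinite_Iic)
      moreover have "AE y in Q. \<exists>j\<in>{1..}. \<bar>gmark y j\<bar> \<le> e"
        by (rule AE_low_mark_exists[OF q0]) (rule infinite_Ici)
      ultimately show ?thesis by eventually_elim (simp add: P_def Bex_def)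
    qed
    have part: "\<exists>n\<^sub>0. \<forall>N. (\<Sum>n\<in>{1..N}. \<Sum>k<n. \<theta> n (seq_shift (- int k) y)) = of_bool (n\<^sub>0 \<le> N)"
      if "(\<exists>j\<le>0. P y j) \<and> (\<exists>j\<ge>1. P y j)" for y
    proof (rule excursion_partition[OF conjunct1[OF that] conjunct2[OF that]])
      fix k\<^sub>0 n\<^sub>0
      assume kn: "k\<^sub>0 < n\<^sub>0"
        "\<And>k n. k < n \<Longrightarrow> excursion (\<lambda>j. P y (j - int k)) n \<longleftrightarrow> k = k\<^sub>0 \<and> n = n\<^sub>0"
      have "(\<Sum>n\<in>{1..N}. \<Sum>k<n. \<theta> n (seq_shift (- int k) y))
          = (\<Sum>n\<in>{1..N}. \<Sum>k<n. of_bool (k = k\<^sub>0 \<and> n = n\<^sub>0))" for N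
        unfolding \<theta>_def shifted by (intro sum.cong refl) (simp add: kn(2))
      then show ?thesis using unique_pair_sum[OF kn(1)] by (intro exI[of _ n\<^sub>0] allI) simp
    qed
    have cost: "(\<Sum>n\<in>{1..N}. \<E> y. ennreal (\<theta> n y / R \<beta> (int n) y)) \<le> ennreal (8 * A)" for N
    proof -
      have one: "(\<E> y. ennreal (\<theta> n y / R \<beta> (int n) y))
          \<le> ennreal (A * (q\<^sup>2 * exp (1 / 2)) * exp (- q / 2) ^ (n - 1))" if n: "n \<in> {1..N}" for n
      proof -
        let ?X = "\<lambda>v. \<Sum>k\<in>crossed (int n). v k"
        have "(\<E> y. ennreal (\<theta> n y / R \<beta> (int n) y))
            \<le> (\<E> y. ennreal A * (ennreal (exp (s * ?X (gap y))) * of_bool (excursion (\<lambda>j. \<bar>gmark y j\<bar> \<le> e) n)))"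
          using gaps_pos marks_range
        proof (intro nn_integral_mono_AE, eventually_elim)
          case (elim y)
          show ?case
          proof (cases "excursion (P y) n")
            case True
            have X0: "0 \<le> ?X (gap y)" using elim(3) by (intro sum_nonneg) (simp add: less_imp_le)
            have "1 / R \<beta> (int n) y \<le> exp (\<bar>points (gap y) (int n)\<bar> powr \<alpha> + 2 * c\<^sub>2 * (\<beta> * e))"
              using True n elim(4) by (intro inverse_rate_le[OF \<beta>]) (simp_all add: excursion_def P_def)
            also have "\<bar>points (gap y) (int n)\<bar> = ?X (gap y)" by (rule abs_points_eq_sum[OF elim(3)])
            also have "exp (?X (gap y) powr \<alpha> + 2 * c\<^sub>2 * (\<beta> * e)) \<le> A * exp (s * ?X (gap y))"
              using stretched_le_linear[OF exponent_pos \<alpha>1 s X0]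
              by (simp add: A_def flip: exp_add)
            finally have "\<theta> n y / R \<beta> (int n) y \<le> A * exp (s * ?X (gap y))"
              using True by (simp add: \<theta>_def)
            then show ?thesis
              using True A unfolding P_def by (simp add: ennreal_leI flip: ennreal_mult)
          next
            case False
            then show ?thesis by (simp add: \<theta>_def)
          qed
        qed
        also have "\<dots> = ennreal A * ((\<E> y. ennreal (exp (s * ?X (gap y))))
            * (\<E> y. of_bool (excursion (\<lambda>j. \<bar>gmark y j\<bar> \<le> e) n)))"
        proof -
          have "(\<E> y. ennreal (exp (s * ?X (gap y))) * of_bool (excursion (\<lambda>j. \<bar>gmark y j\<bar> \<le> e) n))
              = (\<E> y. ennreal (exp (s * ?X (gap y)))) * (\<E> y. of_bool (excursion (\<lambda>j. \<bar>gmark y j\<bar> \<le> e) n))"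
            by (rule nn_integral_marks_mult_gaps[where f = "\<lambda>v. ennreal (exp (s * ?X v))"
                and g = "\<lambda>v. of_bool (excursion (\<lambda>j. \<bar>v j\<bar> \<le> e) n)"])
               (simp_all add: excursion_def)
          then show ?thesis
            by (subst nn_integral_cmult) (simp_all add: excursion_def)
        qed
        also have "\<dots> \<le> ennreal A * (ennreal (exp (K * s)) ^ n * ennreal (q\<^sup>2 * (1 - q) ^ (n - 1)))"
        proof (intro mult_left_mono mult_mono)
          show "(\<E> y. ennreal (exp (s * ?X (gap y)))) \<le> ennreal (exp (K * s)) ^ n"
            using nn_integral_exp_sum_gaps[of "crossed (int n)" s] K(2)[OF less_imp_le[OF s] s_le]
            by (simp add: card_crossed power_mono)
          show "(\<E> y. of_bool (excursion (\<lambda>j. \<bar>gmark y j\<bar> \<le> e) n)) \<le> ennreal (q\<^sup>2 * (1 - q) ^ (n - 1))"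
            unfolding q_def using n by (intro nn_integral_excursion) simp
        qed simp_all
        also have "\<dots> = ennreal (A * (exp (K * s) ^ n * (q\<^sup>2 * (1 - q) ^ (n - 1))))"
          using A q by (simp add: ennreal_power flip: ennreal_mult)
        also have "\<dots> \<le> ennreal (A * (q\<^sup>2 * exp (1 / 2)) * exp (- q / 2) ^ (n - 1))"
        proof (rule ennreal_leI)
          obtain m where m: "n = Suc m" using n by (cases n) simp_all
          have Ks: "K * s = q / 2" using K0 by (simp add: s_def)
          have "1 - q \<le> exp (- q)" using exp_ge_add_one_self[of "- q"] by simp
          then have "(1 - q) ^ m \<le> exp (- q) ^ m" using q by (intro power_mono) simp_all
          then have "exp (K * s) ^ n * (q\<^sup>2 * (1 - q) ^ (n - 1)) \<le> exp (q / 2) * exp (q / 2) ^ m * (q\<^sup>2 * exp (- q) ^ m)"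
            unfolding Ks m using q by (intro mult_mono) simp_all
          also have "\<dots> = q\<^sup>2 * exp (q / 2) * (exp (q / 2) * exp (- q)) ^ m"
            by (simp add: power_mult_distrib)
          also have "exp (q / 2) * exp (- q) = exp (- q / 2)" by (simp flip: exp_add)
          also have "q\<^sup>2 * exp (q / 2) * exp (- q / 2) ^ m \<le> q\<^sup>2 * exp (1 / 2) * exp (- q / 2) ^ m"
            using q by (intro mult_right_mono mult_left_mono) simp_all
          finally have "exp (K * s) ^ n * (q\<^sup>2 * (1 - q) ^ (n - 1)) \<le> q\<^sup>2 * exp (1 / 2) * exp (- q / 2) ^ m" .
          then have "A * (exp (K * s) ^ n * (q\<^sup>2 * (1 - q) ^ (n - 1))) \<le> A * (q\<^sup>2 * exp (1 / 2) * exp (- q / 2) ^ m)"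
            using A by (intro mult_left_mono) simp_all
          then show "A * (exp (K * s) ^ n * (q\<^sup>2 * (1 - q) ^ (n - 1))) \<le> A * (q\<^sup>2 * exp (1 / 2)) * exp (- q / 2) ^ (n - 1)"
            by (simp add: m mult.assoc)
        qed
        finally show ?thesis .
      qed
      have "(\<Sum>n\<in>{1..N}. \<E> y. ennreal (\<theta> n y / R \<beta> (int n) y))
          \<le> (\<Sum>n\<in>{1..N}. ennreal (A * (q\<^sup>2 * exp (1 / 2)) * exp (- q / 2) ^ (n - 1)))"
        by (intro sum_mono one)
      also have "\<dots> = ennreal (\<Sum>n\<in>{1..N}. A * (q\<^sup>2 * exp (1 / 2)) * exp (- q / 2) ^ (n - 1))"
        using A by (intro sum_ennreal) simp
      also have "\<dots> \<le> ennreal (8 * A)"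
      proof (rule ennreal_leI)
        let ?r = "exp (- q / 2)"
        have r: "0 \<le> ?r" "?r < 1" using q by simp_all
        have "(\<Sum>n\<in>{1..N}. ?r ^ (n - 1)) = (\<Sum>n<N. ?r ^ n)"
          by (rule sum.reindex_bij_witness[of _ Suc "\<lambda>n. n - 1"]) auto
        also have "\<dots> \<le> (\<Sum>n. ?r ^ n)"
          using r by (intro sum_le_suminf summable_geometric) simp_all
        also have "\<dots> = 1 / (1 - ?r)" using r by (intro suminf_geometric) simp
        also have "\<dots> \<le> 4 / q"
        proof -
          have "1 + q / 2 \<le> exp (q / 2)" by (rule exp_ge_add_one_self)
          then have "?r \<le> 1 / (1 + q / 2)" using q by (simp add: exp_minus field_simps)
          also have "\<dots> \<le> 1 - q / 4"
          proof -
            have "1 \<le> (1 - q / 4) * (1 + q / 2)"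
              using q mult_left_mono[of q 1 q] by (simp add: algebra_simps)
            then show ?thesis using q by (simp add: field_simps)
          qed
          finally have "q / 4 \<le> 1 - ?r" by simp
          then have "1 / (1 - ?r) \<le> 1 / (q / 4)" using q by (intro divide_left_mono mult_pos_pos) simp_all
          then show ?thesis by simp
        qed
        finally have geo: "(\<Sum>n\<in>{1..N}. ?r ^ (n - 1)) \<le> 4 / q" .
        have "exp (1 / 2) \<le> (2 :: real)"
        proof -
          have "exp (1 / 2 :: real) \<le> 1 + 1 / 2 + (1 / 2)\<^sup>2" by (rule exp_bound) simp_all
          also have "\<dots> \<le> 2" by (simp add: power2_eq_square)
          finally show ?thesis .
        qed
        have "(\<Sum>n\<in>{1..N}. A * (q\<^sup>2 * exp (1 / 2)) * ?r ^ (n - 1))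
            = A * (q\<^sup>2 * exp (1 / 2)) * (\<Sum>n\<in>{1..N}. ?r ^ (n - 1))" by (rule sum_distrib_left[symmetric])
        also have "\<dots> \<le> A * (q\<^sup>2 * 2) * (4 / q)"
          using A q geo \<open>exp (1 / 2) \<le> (2 :: real)\<close> r by (intro mult_mono) (auto intro!: sum_nonneg)
        also have "\<dots> = A * (8 * q)" using q by (simp add: power2_eq_square)
        also have "\<dots> \<le> A * 8" using A q by (intro mult_left_mono) simp_all
        finally show "(\<Sum>n\<in>{1..N}. A * (q\<^sup>2 * exp (1 / 2)) * ?r ^ (n - 1)) \<le> 8 * A" by simp
      qed
      finally show ?thesis .
    qed
    have "ennreal (mean_gap\<^sup>2 / (8 * A)) \<le> D \<beta>"
    proof (rule D_ge_flow[where \<theta> = \<theta>])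
      show "AE y in Q. (\<Sum>n\<in>{1..N}. \<Sum>k<n. \<theta> n (seq_shift (- int k) y)) \<le> 1" for N
        using both
      proof eventually_elim
        case (elim y)
        then obtain n\<^sub>0 where "\<forall>N. (\<Sum>n\<in>{1..N}. \<Sum>k<n. \<theta> n (seq_shift (- int k) y)) = of_bool (n\<^sub>0 \<le> N)"
          using part[OF elim] by (elim exE)
        then show ?case by simp
      qed
      show "AE y in Q. (\<lambda>N. \<Sum>n\<in>{1..N}. \<Sum>k<n. \<theta> n (seq_shift (- int k) y)) \<longlonglongrightarrow> 1"
        using both
      proof eventually_elim
        case (elim y)
        then obtain n\<^sub>0 where "\<forall>N. (\<Sum>n\<in>{1..N}. \<Sum>k<n. \<theta> n (seq_shift (- int k) y)) = of_bool (n\<^sub>0 \<le> N)"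
          using part[OF elim] by (elim exE)
        then show ?case
          by (intro tendsto_eventually eventually_sequentiallyI[of n\<^sub>0]) simp
      qed
      show "0 < 8 * A" using A by simp
      show "0 \<le> \<theta> n y" "\<theta> n y \<le> 1" for n y by (simp_all add: \<theta>_def)
    qed (use cost in simp_all)
    also have "mean_gap\<^sup>2 / (8 * A) = C * exp (- (2 * c\<^sub>2 * (\<beta> * e)) - M * low_prob e powr (- (\<alpha> / (1 - \<alpha>))))"
    proof -
      have "s powr (- (\<alpha> / (1 - \<alpha>))) = M * q powr (- (\<alpha> / (1 - \<alpha>)))"
        using q K0 by (simp add: s_def M_def powr_divide powr_minus field_simps)
      then show ?thesis
        by (simp add: A_def C_def q_def exp_diff exp_minus exp_add field_simps)
    qed
    finally show ?thesis .
  qed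
  then show thesis using that C M by blast
qed

end

section \<open>Optimising over the level of the marks\<close>

context iid_gaps
begin

text \<open>Fix a level \<open>e\<close> so small that the entropic factor \<open>exp (8 q x)\<close> uses up at most half of the decay
  \<open>exp (- \<kappa> x)\<close> of the jumps over a run, and let the length \<open>x\<close> of the runs grow linearly in \<open>\<beta>\<close>.\<close>

theorem D_le_exp:
  assumes \<alpha>: "1 \<le> \<alpha>" and lim: "(low_prob \<longlongrightarrow> 0) (at_right 0)"
  shows "\<exists>C>0. \<exists>\<kappa>>0. \<forall>\<beta>\<ge>0. D \<beta> \<le> ennreal (C * exp (- \<kappa> * \<beta>))"
proof -
  obtain K \<kappa> where K: "0 < K" "0 < \<kappa>" "\<And>\<beta> e x. 0 \<le> \<beta> \<Longrightarrow> low_prob e \<le> 1 / 2 \<Longrightarrow> 0 \<le> x \<Longrightarrow>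
      D \<beta> \<le> ennreal (K * exp (8 * low_prob e * x) * (exp (- (\<beta> * (c\<^sub>1 * e))) + exp (- \<kappa> * x powr stretch)))"
    using D_le_high_marks by blast
  have "0 < min (1 / 2) (\<kappa> / 16)" using K by simp
  then have "\<forall>\<^sub>F e in at_right 0. low_prob e < min (1 / 2) (\<kappa> / 16)"
    using lim by (intro order_tendstoD)
  then obtain b where b: "0 < b" "\<And>e. 0 < e \<Longrightarrow> e < b \<Longrightarrow> low_prob e < min (1 / 2) (\<kappa> / 16)"
    by (auto simp: eventually_at_right_field)
  define e where "e = b / 2"
  have e: "0 < e" "low_prob e \<le> 1 / 2" "8 * low_prob e \<le> \<kappa> / 2"
    using b(1) b(2)[of e] by (simp_all add: e_def)
  let ?\<kappa> = "c\<^sub>1 * e / 2"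
  have "D \<beta> \<le> ennreal (2 * K * exp (- ?\<kappa> * \<beta>))" if \<beta>: "0 \<le> \<beta>" for \<beta>
  proof -
    \<comment> \<open>With this run length, jumping over the run costs as much as landing in it.\<close>
    define x where "x = \<beta> * (c\<^sub>1 * e) / \<kappa>"
    have x: "0 \<le> x" "\<kappa> * x = \<beta> * (c\<^sub>1 * e)" using \<beta> K c\<^sub>1_pos e by (simp_all add: x_def)
    have "8 * low_prob e * x \<le> \<kappa> / 2 * x" using e x by (intro mult_right_mono) simp_all
    also have "\<dots> = ?\<kappa> * \<beta>" using x(2) by simp
    finally have "exp (8 * low_prob e * x) \<le> exp (?\<kappa> * \<beta>)" by simp
    then have "K * exp (8 * low_prob e * x) * (2 * exp (- (\<beta> * (c\<^sub>1 * e)))) \<le> K * exp (?\<kappa> * \<beta>) * (2 * exp (- (\<beta> * (c\<^sub>1 * e))))"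
      using K by (intro mult_right_mono mult_left_mono) simp_all
    also have "\<dots> = 2 * K * (exp (?\<kappa> * \<beta>) * exp (- (\<beta> * (c\<^sub>1 * e))))" by (simp only: mult_ac)
    also have "exp (?\<kappa> * \<beta>) * exp (- (\<beta> * (c\<^sub>1 * e))) = exp (- ?\<kappa> * \<beta>)" by (simp flip: exp_add)
    finally have "K * exp (8 * low_prob e * x) * (2 * exp (- (\<beta> * (c\<^sub>1 * e)))) \<le> 2 * K * exp (- ?\<kappa> * \<beta>)" .
    moreover have "D \<beta> \<le> ennreal (K * exp (8 * low_prob e * x) * (2 * exp (- (\<beta> * (c\<^sub>1 * e)))))"
      using K(3)[OF \<beta> e(2) x(1)] x \<alpha> by (simp add: stretch_def)
    ultimately show ?thesis by (rule order_trans[OF _ ennreal_leI, rotated])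
  qed
  moreover have "0 < 2 * K" "0 < ?\<kappa>" using K c\<^sub>1_pos e by simp_all
  ultimately show ?thesis by blast
qed

text \<open>The exponents in the optimisation: at the level \<open>e = \<beta> powr (- \<rho>)\<close> and with
  \<open>T = \<beta> powr (\<delta> a / d)\<close>, the cost \<open>\<beta> e\<close> of the marks equals \<open>T\<close>, a run of length \<open>T powr (1 / a)\<close> has
  entropic cost \<open>T\<close>, and the resistance of a jump between low marks has logarithm of order \<open>T\<close>.\<close>

lemma level_exponents:
  fixes a \<delta> \<beta> :: real
  assumes "0 < a" "a < 1" "0 < \<delta>" "0 < \<beta>"
  defines "d \<equiv> 1 - a + \<delta> * a" and "\<rho> \<equiv> (1 - a) / (1 - a + \<delta> * a)"
  shows "0 < \<rho>" "0 < \<delta> * a / d"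
    and "\<beta> * \<beta> powr (- \<rho>) = \<beta> powr (\<delta> * a / d)"
    and "(\<beta> powr (- \<rho>)) powr \<delta> * (\<beta> powr (\<delta> * a / d)) powr (1 / a) = \<beta> powr (\<delta> * a / d)"
    and "((\<beta> powr (- \<rho>)) powr \<delta>) powr (- (a / (1 - a))) = \<beta> powr (\<delta> * a / d)"
proof -
  have dd: "d - (1 - a) = \<delta> * a" by (simp add: d_def)
  have "0 < \<delta> * a" using assms(1,3) by simp
  then have d: "0 < d" using assms(2) dd by linarith
  have \<rho>d: "\<rho> = (1 - a) / d" by (simp add: \<rho>_def d_def)
  note a = assms(1-4)
  show \<rho>: "0 < \<rho>" using a d by (simp add: \<rho>d)
  show "0 < \<delta> * a / d" using d a by simp
  have "1 + - \<rho> = (d - (1 - a)) / d" using d by (simp add: \<rho>d diff_divide_distrib)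
  then have "1 + - \<rho> = \<delta> * a / d" by (simp only: dd)
  moreover have "\<beta> * \<beta> powr (- \<rho>) = \<beta> powr (1 + - \<rho>)"
    using a by (subst powr_add) simp
  ultimately show "\<beta> * \<beta> powr (- \<rho>) = \<beta> powr (\<delta> * a / d)" by simp
  have "- \<rho> * \<delta> + \<delta> * a / d * (1 / a) = \<delta> * a / d"
    using d a by (simp add: \<rho>d field_simps)
  then show "(\<beta> powr (- \<rho>)) powr \<delta> * (\<beta> powr (\<delta> * a / d)) powr (1 / a) = \<beta> powr (\<delta> * a / d)"
    by (simp only: powr_powr powr_add[symmetric])
  have "- \<rho> * \<delta> * - (a / (1 - a)) = \<delta> * a / d"
    using d a by (simp add: \<rho>d field_simps)
  then show "((\<beta> powr (- \<rho>)) powr \<delta>) powr (- (a / (1 - a))) = \<beta> powr (\<delta> * a / d)"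
    by (simp only: powr_powr)
qed

lemma level_le:
  fixes \<beta> e\<^sub>1 \<rho> :: real
  assumes "0 < e\<^sub>1" "0 < \<rho>" "e\<^sub>1 powr (- (1 / \<rho>)) \<le> \<beta>"
  shows "0 < \<beta>" "0 < \<beta> powr (- \<rho>)" "\<beta> powr (- \<rho>) \<le> e\<^sub>1"
proof -
  have "0 < e\<^sub>1 powr (- (1 / \<rho>))" using assms by simp
  then show \<beta>: "0 < \<beta>" using assms(3) by linarith
  then show "0 < \<beta> powr (- \<rho>)" by simp
  have "\<beta> powr (- \<rho>) \<le> (e\<^sub>1 powr (- (1 / \<rho>))) powr (- \<rho>)"
    using assms by (intro powr_mono2') simp_all
  also have "\<dots> = e\<^sub>1" using assms by (simp add: powr_powr)
  finally show "\<beta> powr (- \<rho>) \<le> e\<^sub>1" .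
qed

text \<open>Runs of length \<open>h T powr (1 / \<alpha>)\<close> cost \<open>8 a\<^sub>2 h T\<close> in probability and gain \<open>c\<^sub>1 T\<close> from the marks and
  \<open>\<kappa> h\<^sup>\<alpha> T\<close> from the distance. Since \<open>\<alpha> < 1\<close>, both gains win for small \<open>h\<close>. Below the threshold
  \<open>\<beta>\<^sub>0\<close>, where the level would leave the range of the hypothesis on the marks, it is enough that \<open>D\<close> is bounded.\<close>

theorem D_le_stretched_exp:
  assumes \<alpha>: "\<alpha> < 1" and \<delta>: "0 < \<delta>" and a\<^sub>2: "0 < a\<^sub>2"
    and ev: "\<forall>\<^sub>F e in at_right 0. low_prob e \<le> a\<^sub>2 * e powr \<delta>"
  shows "\<exists>C>0. \<exists>\<kappa>>0. \<forall>\<beta>\<ge>0.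
    D \<beta> \<le> ennreal (C * exp (- \<kappa> * \<beta> powr (\<delta> * \<alpha> / (1 - \<alpha> + \<delta> * \<alpha>))))"
proof -
  obtain K \<kappa> where K: "0 < K" "0 < \<kappa>" "\<And>\<beta> e x. 0 \<le> \<beta> \<Longrightarrow> low_prob e \<le> 1 / 2 \<Longrightarrow> 0 \<le> x \<Longrightarrow>
      D \<beta> \<le> ennreal (K * exp (8 * low_prob e * x) * (exp (- (\<beta> * (c\<^sub>1 * e))) + exp (- \<kappa> * x powr \<alpha>)))"
    using D_le_high_marks \<alpha> by (auto simp: stretch_def)
  note a0 = exponent_pos
  let ?\<theta> = "\<delta> * \<alpha> / (1 - \<alpha> + \<delta> * \<alpha>)"
  define \<rho> where "\<rho> = (1 - \<alpha>) / (1 - \<alpha> + \<delta> * \<alpha>)"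
  note ex = level_exponents[OF a0 \<alpha> \<delta>, folded \<rho>_def]
  obtain b where b: "0 < b" "\<And>e. 0 < e \<Longrightarrow> e < b \<Longrightarrow> low_prob e \<le> a\<^sub>2 * e powr \<delta>"
    using ev by (auto simp: eventually_at_right_field)
  define e\<^sub>1 where "e\<^sub>1 = min (b / 2) ((1 / (2 * a\<^sub>2)) powr (1 / \<delta>))"
  have e\<^sub>1: "0 < e\<^sub>1" "e\<^sub>1 < b" using b a\<^sub>2 by (auto simp: e\<^sub>1_def)
  have small: "low_prob e \<le> a\<^sub>2 * e powr \<delta>" "a\<^sub>2 * e powr \<delta> \<le> 1 / 2" if "0 < e" "e \<le> e\<^sub>1" for e
  proof -
    show "low_prob e \<le> a\<^sub>2 * e powr \<delta>" using b(2)[of e] that e\<^sub>1 by simp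
    have "e powr \<delta> \<le> ((1 / (2 * a\<^sub>2)) powr (1 / \<delta>)) powr \<delta>"
      using that \<delta> by (intro powr_mono2) (simp_all add: e\<^sub>1_def)
    also have "\<dots> = 1 / (2 * a\<^sub>2)" using \<delta> a\<^sub>2 by (simp add: powr_powr)
    finally show "a\<^sub>2 * e powr \<delta> \<le> 1 / 2" using a\<^sub>2 by (simp add: field_simps)
  qed
  define \<beta>\<^sub>0 where "\<beta>\<^sub>0 = e\<^sub>1 powr (- (1 / \<rho>))"
  have \<rho>: "0 < \<rho>" using ex(1)[of 1] by simp
  have \<theta>: "0 < ?\<theta>" using ex(2)[of 1] by simp
  define h where "h = min (c\<^sub>1 / (16 * a\<^sub>2)) ((\<kappa> / (16 * a\<^sub>2)) powr (1 / (1 - \<alpha>)))"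
  have h0: "0 < h" using c\<^sub>1_pos a\<^sub>2 K by (simp add: h_def)
  have h1: "8 * a\<^sub>2 * h \<le> c\<^sub>1 / 2"
  proof -
    have "h \<le> c\<^sub>1 / (16 * a\<^sub>2)" by (simp add: h_def)
    then show ?thesis using a\<^sub>2 by (simp add: field_simps)
  qed
  have h2: "8 * a\<^sub>2 * h \<le> \<kappa> / 2 * h powr \<alpha>"
  proof -
    have "h powr (1 - \<alpha>) \<le> ((\<kappa> / (16 * a\<^sub>2)) powr (1 / (1 - \<alpha>))) powr (1 - \<alpha>)"
      using h0 \<alpha> by (intro powr_mono2) (simp_all add: h_def)
    also have "\<dots> = \<kappa> / (16 * a\<^sub>2)" using \<alpha> K a\<^sub>2 by (simp add: powr_powr)
    finally have "8 * a\<^sub>2 * h powr (1 - \<alpha>) \<le> \<kappa> / 2" using a\<^sub>2 by (simp add: field_simps)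
    then have "8 * a\<^sub>2 * h powr (1 - \<alpha>) * h powr \<alpha> \<le> \<kappa> / 2 * h powr \<alpha>" by (rule mult_right_mono) simp
    then show ?thesis using h0 by (simp add: mult.assoc flip: powr_add)
  qed
  define \<kappa>' where "\<kappa>' = min (c\<^sub>1 / 2) (\<kappa> / 2 * h powr \<alpha>)"
  have \<kappa>': "0 < \<kappa>'" "\<kappa>' \<le> c\<^sub>1 / 2" "\<kappa>' \<le> \<kappa> / 2 * h powr \<alpha>"
    using c\<^sub>1_pos K h0 by (simp_all add: \<kappa>'_def)
  let ?C = "2 * K * exp (\<kappa>' * \<beta>\<^sub>0 powr ?\<theta>)"
  have \<kappa>\<beta>\<^sub>0: "0 \<le> \<kappa>' * \<beta>\<^sub>0 powr ?\<theta>" using \<kappa>' by simp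
  have "D \<beta> \<le> ennreal (?C * exp (- \<kappa>' * \<beta> powr ?\<theta>))" if \<beta>: "0 \<le> \<beta>" for \<beta>
  proof (cases "\<beta>\<^sub>0 \<le> \<beta>")
    case True
    define e where "e = \<beta> powr (- \<rho>)"
    define T where "T = \<beta> powr ?\<theta>"
    note le = level_le[OF e\<^sub>1(1) \<rho> True[unfolded \<beta>\<^sub>0_def], folded e_def]
    have T0: "0 < T" using le(1) by (simp add: T_def)
    have \<beta>e: "\<beta> * e = T" using ex(3)[OF le(1)] by (simp add: e_def T_def)
    have eT: "e powr \<delta> * T powr (1 / \<alpha>) = T" using ex(4)[OF le(1)] by (simp add: e_def T_def)
    define x where "x = h * T powr (1 / \<alpha>)"
    have x: "0 \<le> x" "x powr \<alpha> = h powr \<alpha> * T"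
      using h0 T0 a0 by (simp_all add: x_def powr_mult powr_powr)
    have "8 * low_prob e * x \<le> 8 * (a\<^sub>2 * e powr \<delta>) * x"
      using small(1)[OF le(2,3)] x by (intro mult_right_mono mult_left_mono) simp_all
    also have "\<dots> = 8 * a\<^sub>2 * h * (e powr \<delta> * T powr (1 / \<alpha>))" by (simp add: x_def)
    finally have runs: "exp (8 * low_prob e * x) \<le> exp (8 * a\<^sub>2 * h * T)" by (simp add: eT)
    have "K * exp (8 * low_prob e * x) * (exp (- (\<beta> * (c\<^sub>1 * e))) + exp (- \<kappa> * x powr \<alpha>))
        \<le> K * exp (8 * a\<^sub>2 * h * T) * (exp (- (c\<^sub>1 * T)) + exp (- (\<kappa> * h powr \<alpha> * T)))"
      using K runs by (intro mult_mono) (simp_all add: x \<beta>e[symmetric] mult_ac add_nonneg_nonneg)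
    also have "\<dots> = K * (exp (8 * a\<^sub>2 * h * T - c\<^sub>1 * T) + exp (8 * a\<^sub>2 * h * T - \<kappa> * h powr \<alpha> * T))"
      by (simp add: distrib_left mult.assoc flip: exp_add)
    also have "\<dots> \<le> K * (exp (- \<kappa>' * T) + exp (- \<kappa>' * T))"
    proof (intro mult_left_mono add_mono)
      have "8 * a\<^sub>2 * h * T \<le> c\<^sub>1 / 2 * T" using h1 T0 by (intro mult_right_mono) simp_all
      moreover have "\<kappa>' * T \<le> c\<^sub>1 / 2 * T" using \<kappa>' T0 by (intro mult_right_mono) simp_all
      ultimately show "exp (8 * a\<^sub>2 * h * T - c\<^sub>1 * T) \<le> exp (- \<kappa>' * T)" by simp
      have "8 * a\<^sub>2 * h * T \<le> \<kappa> / 2 * h powr \<alpha> * T" using h2 T0 by (intro mult_right_mono) simp_all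
      moreover have "\<kappa>' * T \<le> \<kappa> / 2 * h powr \<alpha> * T" using \<kappa>' T0 by (intro mult_right_mono) simp_all
      ultimately show "exp (8 * a\<^sub>2 * h * T - \<kappa> * h powr \<alpha> * T) \<le> exp (- \<kappa>' * T)" by simp
    qed (use K in simp)
    also have "\<dots> = 2 * K * 1 * exp (- \<kappa>' * T)" by simp
    also have "\<dots> \<le> ?C * exp (- \<kappa>' * T)" using K \<kappa>\<beta>\<^sub>0 by (intro mult_right_mono mult_left_mono) simp_all
    finally have fin: "K * exp (8 * low_prob e * x) * (exp (- (\<beta> * (c\<^sub>1 * e))) + exp (- \<kappa> * x powr \<alpha>)) \<le> ?C * exp (- \<kappa>' * T)" .
    have "low_prob e \<le> 1 / 2" using small[OF le(2,3)] by linarith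
    from K(3)[OF \<beta> this x(1)] fin show ?thesis
      unfolding T_def by (rule order_trans[OF _ ennreal_leI])
  next
    case False
    \<comment> \<open>Runs of length \<open>0\<close>, that is, the constant increment.\<close>
    have "low_prob e\<^sub>1 \<le> 1 / 2" using small[of e\<^sub>1] e\<^sub>1 by simp
    then have "D \<beta> \<le> ennreal (K * exp (8 * low_prob e\<^sub>1 * 0) * (exp (- (\<beta> * (c\<^sub>1 * e\<^sub>1))) + exp (- \<kappa> * 0 powr \<alpha>)))"
      using \<beta> by (intro K(3)) simp_all
    also have "\<dots> \<le> ennreal (?C * exp (- \<kappa>' * \<beta> powr ?\<theta>))"
    proof (rule ennreal_leI)
      have "\<beta> * (c\<^sub>1 * e\<^sub>1) \<ge> 0" using \<beta> c\<^sub>1_pos e\<^sub>1 by simp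
      then have "K * exp (8 * low_prob e\<^sub>1 * 0) * (exp (- (\<beta> * (c\<^sub>1 * e\<^sub>1))) + exp (- \<kappa> * 0 powr \<alpha>)) \<le> K * (1 + 1)"
        using K by simp
      also have "\<dots> \<le> 2 * K * exp (\<kappa>' * \<beta>\<^sub>0 powr ?\<theta> - \<kappa>' * \<beta> powr ?\<theta>)"
      proof -
        have "\<beta> powr ?\<theta> \<le> \<beta>\<^sub>0 powr ?\<theta>" using False \<beta> \<theta> by (intro powr_mono2) simp_all
        then show ?thesis using K \<kappa>' by simp
      qed
      also have "\<dots> = ?C * exp (- \<kappa>' * \<beta> powr ?\<theta>)"
        by (simp add: mult.assoc flip: exp_add)
      finally show "K * exp (8 * low_prob e\<^sub>1 * 0) * (exp (- (\<beta> * (c\<^sub>1 * e\<^sub>1))) + exp (- \<kappa> * 0 powr \<alpha>))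
          \<le> ?C * exp (- \<kappa>' * \<beta> powr ?\<theta>)" .
    qed
    finally show ?thesis .
  qed
  moreover have "0 < ?C" using K by simp
  ultimately show ?thesis using \<kappa>'(1) by (intro exI[of _ ?C] conjI exI[of _ \<kappa>']) auto
qed

text \<open>At the level \<open>e = \<beta> powr (- \<rho>)\<close> both costs in \<open>D_ge_low_marks\<close> are of order \<open>T\<close>; below the threshold \<open>\<beta>\<^sub>0\<close>
  the level is kept fixed.\<close>

theorem D_ge_stretched_exp:
  assumes \<alpha>: "\<alpha> < 1" and \<delta>: "0 < \<delta>" and a\<^sub>1: "0 < a\<^sub>1"
    and ev: "\<forall>\<^sub>F e in at_right 0. a\<^sub>1 * e powr \<delta> \<le> low_prob e"
    and eps: "0 < \<epsilon>" "(\<E> y. ennreal (exp (\<epsilon> * gap y 0))) < \<infinity>"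
  shows "\<exists>C>0. \<exists>\<kappa>>0. \<forall>\<beta>\<ge>0.
    ennreal (C * exp (- \<kappa> * \<beta> powr (\<delta> * \<alpha> / (1 - \<alpha> + \<delta> * \<alpha>)))) \<le> D \<beta>"
proof -
  let ?b = "\<alpha> / (1 - \<alpha>)"
  obtain C M where CM: "0 < C" "0 < M" "\<And>\<beta> e. 0 \<le> \<beta> \<Longrightarrow> 0 < low_prob e \<Longrightarrow>
      ennreal (C * exp (- (2 * c\<^sub>2 * (\<beta> * e)) - M * low_prob e powr (- ?b))) \<le> D \<beta>"
    using D_ge_low_marks[OF \<alpha> eps] by blast
  note a0 = exponent_pos
  let ?\<theta> = "\<delta> * \<alpha> / (1 - \<alpha> + \<delta> * \<alpha>)"
  define \<rho> where "\<rho> = (1 - \<alpha>) / (1 - \<alpha> + \<delta> * \<alpha>)"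
  note ex = level_exponents[OF a0 \<alpha> \<delta>, folded \<rho>_def]
  obtain b where b: "0 < b" "\<And>e. 0 < e \<Longrightarrow> e < b \<Longrightarrow> a\<^sub>1 * e powr \<delta> \<le> low_prob e"
    using ev by (auto simp: eventually_at_right_field)
  define e\<^sub>1 where "e\<^sub>1 = b / 2"
  have e\<^sub>1: "0 < e\<^sub>1" "e\<^sub>1 < b" using b by (simp_all add: e\<^sub>1_def)
  have low_pos: "0 < low_prob e" if "0 < e" "e \<le> e\<^sub>1" for e
  proof -
    have "0 < a\<^sub>1 * e powr \<delta>" using a\<^sub>1 that by simp
    then show ?thesis using b(2)[of e] that e\<^sub>1 by simp
  qed
  have \<rho>: "0 < \<rho>" using ex(1)[of 1] by simp
  have c2: "0 \<le> c\<^sub>2" using u_lower[of 1 1] u_upper[of 1 1] c\<^sub>1_pos by simp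
  define \<beta>\<^sub>0 where "\<beta>\<^sub>0 = e\<^sub>1 powr (- (1 / \<rho>))"
  define C' where "C' = C * exp (- (2 * c\<^sub>2 * (\<beta>\<^sub>0 * e\<^sub>1)) - M * low_prob e\<^sub>1 powr (- ?b))"
  define \<kappa> where "\<kappa> = 2 * c\<^sub>2 + M * a\<^sub>1 powr (- ?b)"
  have \<kappa>: "0 < \<kappa>" using c2 CM a\<^sub>1 by (simp add: \<kappa>_def add_nonneg_pos)
  have "ennreal (min C C' * exp (- \<kappa> * \<beta> powr ?\<theta>)) \<le> D \<beta>" if \<beta>: "0 \<le> \<beta>" for \<beta>
  proof (cases "\<beta>\<^sub>0 \<le> \<beta>")
    case True
    define e where "e = \<beta> powr (- \<rho>)"
    define T where "T = \<beta> powr ?\<theta>"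
    note le = level_le[OF e\<^sub>1(1) \<rho> True[unfolded \<beta>\<^sub>0_def], folded e_def]
    have \<beta>e: "\<beta> * e = T" using ex(3)[OF le(1)] by (simp add: e_def T_def)
    have eT: "(e powr \<delta>) powr (- ?b) = T" using ex(5)[OF le(1)] by (simp add: e_def T_def)
    have "low_prob e powr (- ?b) \<le> (a\<^sub>1 * e powr \<delta>) powr (- ?b)"
      using b(2)[of e] le e\<^sub>1 a\<^sub>1 \<alpha> a0 by (intro powr_mono2') simp_all
    also have "\<dots> = a\<^sub>1 powr (- ?b) * T" using a\<^sub>1 eT by (simp add: powr_mult)
    finally have "M * low_prob e powr (- ?b) \<le> M * (a\<^sub>1 powr (- ?b) * T)" using CM by (intro mult_left_mono) simp_all
    then have "- \<kappa> * T \<le> - (2 * c\<^sub>2 * (\<beta> * e)) - M * low_prob e powr (- ?b)"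
      by (simp add: \<kappa>_def \<beta>e algebra_simps)
    then have "min C C' * exp (- \<kappa> * T) \<le> C * exp (- (2 * c\<^sub>2 * (\<beta> * e)) - M * low_prob e powr (- ?b))"
      using CM by (intro mult_mono) simp_all
    then have "ennreal (min C C' * exp (- \<kappa> * T)) \<le> ennreal (C * exp (- (2 * c\<^sub>2 * (\<beta> * e)) - M * low_prob e powr (- ?b)))"
      by (rule ennreal_leI)
    also have "\<dots> \<le> D \<beta>" using \<beta> low_pos[OF le(2,3)] by (rule CM(3))
    finally show ?thesis by (simp add: T_def)
  next
    case False
    have "c\<^sub>2 * (\<beta> * e\<^sub>1) \<le> c\<^sub>2 * (\<beta>\<^sub>0 * e\<^sub>1)"
      using False e\<^sub>1 c2 by (intro mult_left_mono mult_right_mono) simp_all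
    then have "C' \<le> C * exp (- (2 * c\<^sub>2 * (\<beta> * e\<^sub>1)) - M * low_prob e\<^sub>1 powr (- ?b))"
      unfolding C'_def using CM by (intro mult_left_mono) simp_all
    moreover have "min C C' * exp (- \<kappa> * \<beta> powr ?\<theta>) \<le> C' * 1"
      using \<kappa> CM by (intro mult_mono) (simp_all add: C'_def)
    ultimately have "ennreal (min C C' * exp (- \<kappa> * \<beta> powr ?\<theta>))
        \<le> ennreal (C * exp (- (2 * c\<^sub>2 * (\<beta> * e\<^sub>1)) - M * low_prob e\<^sub>1 powr (- ?b)))"
      by (intro ennreal_leI) simp
    also have "\<dots> \<le> D \<beta>" using \<beta> low_pos[OF e\<^sub>1(1) order_refl] by (rule CM(3))
    finally show ?thesis .
  qed
  moreover have "0 < min C C'" using CM by (simp add: C'_def)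
  ultimately show ?thesis using \<kappa> by blast
qed

end

section \<open>The law of the marked gaps of an environment\<close>

lemma (in prob_space) indep_var_distrI:
  assumes [measurable]: "f \<in> M \<rightarrow>\<^sub>M N" "X \<in> N \<rightarrow>\<^sub>M S" "Y \<in> N \<rightarrow>\<^sub>M T"
    and "indep_var S (\<lambda>w. X (f w)) T (\<lambda>w. Y (f w))"
  shows "prob_space.indep_var (distr M N f) S X T Y"
proof -
  interpret D: prob_space "distr M N f" by (rule prob_space_distr) simp
  show ?thesis
    using assms(4) unfolding D.indep_var_distribution_eq indep_var_distribution_eq
    by (simp add: distr_distr comp_def)
qed

lemma (in prob_space) indep_vars_distrI:
  assumes [measurable]: "f \<in> M \<rightarrow>\<^sub>M N" "\<And>i. X i \<in> N \<rightarrow>\<^sub>M S"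
    and ind: "indep_vars (\<lambda>_. S) (\<lambda>i w. X i (f w)) UNIV"
  shows "prob_space.indep_vars (distr M N f) (\<lambda>_. S) X UNIV"
proof -
  interpret D: prob_space "distr M N f" by (rule prob_space_distr) simp
  have "distr M (Pi\<^sub>M UNIV (\<lambda>_. S)) (\<lambda>w i. X i (f w)) = Pi\<^sub>M UNIV (\<lambda>i. distr M S (\<lambda>w. X i (f w)))"
    using ind by (subst (asm) indep_vars_iff_distr_eq_PiM) (simp_all add: restrict_UNIV)
  moreover have "(\<lambda>w i. X i w) \<in> N \<rightarrow>\<^sub>M Pi\<^sub>M UNIV (\<lambda>_. S)"
    by (rule measurable_PiM_single') (auto intro: measurable_space[OF assms(2)])
  ultimately show ?thesis
    by (subst D.indep_vars_iff_distr_eq_PiM) (simp_all add: distr_distr comp_def restrict_UNIV)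
qed

lemma seq_shift_measurable_PiM [measurable]:
  "seq_shift i \<in> Pi\<^sub>M UNIV (\<lambda>_. S) \<rightarrow>\<^sub>M Pi\<^sub>M UNIV (\<lambda>_. S)"
  unfolding seq_shift_def
  by (rule measurable_PiM_single') (auto simp: space_PiM PiE_iff)

lemma distr_PiM_seq_shift:
  assumes "prob_space N"
  shows "distr (Pi\<^sub>M UNIV (\<lambda>_. N)) (Pi\<^sub>M UNIV (\<lambda>_. N)) (seq_shift i) = Pi\<^sub>M UNIV (\<lambda>_. N)"
  using distr_PiM_reindex[of UNIV "\<lambda>_. N" "\<lambda>k. k + i" UNIV] assms
  by (simp add: seq_shift_def[abs_def] restrict_UNIV)

context environment
begin

lemma E_measurable: "E k \<in> borel_measurable M"
  using E_iid by (auto simp: iid_seq_def indep_vars_def)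

lemmas [measurable] = Z_measurable E_measurable

abbreviation reals :: "(int \<Rightarrow> real) measure" where
  "reals \<equiv> Pi\<^sub>M UNIV (\<lambda>_. borel)"

lemma gap_seq_measurable [measurable]: "(\<lambda>w k. Z k w) \<in> M \<rightarrow>\<^sub>M reals"
  by (rule measurable_PiM_single') auto

lemma mark_seq_measurable [measurable]: "(\<lambda>w k. E k w) \<in> M \<rightarrow>\<^sub>M reals"
  by (rule measurable_PiM_single') auto

definition gap_law :: "(int \<Rightarrow> real \<times> real) measure" where
  "gap_law = distr M gap_seqs (\<lambda>w k. (Z k w, E k w))"

lemma marked_gaps_measurable [measurable]: "(\<lambda>w k. (Z k w, E k w)) \<in> M \<rightarrow>\<^sub>M gap_seqs"
  by (rule measurable_PiM_single') (auto simp: space_pair_measure)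

lemma sets_gap_law: "sets gap_law = sets gap_seqs"
  by (simp add: gap_law_def)

lemma prob_space_gap_law: "prob_space gap_law"
  unfolding gap_law_def by (rule prob_space_distr) simp

lemma env_law_eq: "env_law M Z E = distr gap_law gap_seqs env_of_gaps"
  unfolding env_law_def gap_law_def
  by (subst distr_distr) (simp_all add: comp_def env_of_def[abs_def] env_of_gaps_def)

lemma gaps_marks_indep: "indep_var reals (\<lambda>w k. Z k w) reals (\<lambda>w k. E k w)"
proof -
  have "(\<lambda>x j. x (j + 1) - x j) \<in> reals \<rightarrow>\<^sub>M reals"
    by (rule measurable_PiM_single') auto
  then have "indep_var reals ((\<lambda>x j. x (j + 1) - x j) \<circ> (\<lambda>w. points (\<lambda>j. Z j w)))
      reals ((\<lambda>x. x) \<circ> (\<lambda>w k. E k w))"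
    by (rule indep_var_compose[OF indep_points_marks]) simp
  then show ?thesis by (simp add: comp_def points_diff)
qed

lemma distr_mark_seq_shift: "distr M reals (\<lambda>w. seq_shift 1 (\<lambda>k. E k w)) = distr M reals (\<lambda>w k. E k w)"
proof -
  have "indep_vars (\<lambda>_. borel) E UNIV" using E_iid by (simp add: iid_seq_def)
  then have law: "distr M reals (\<lambda>w k. E k w) = Pi\<^sub>M UNIV (\<lambda>_. \<nu>)"
    by (subst (asm) indep_vars_iff_distr_eq_PiM) (simp_all add: E_law restrict_UNIV)
  have \<nu>: "prob_space \<nu>" "sets \<nu> = sets borel"
    using prob_space_distr[of "E 0" borel] by (auto simp: E_law[of 0, symmetric])
  have sets: "sets (Pi\<^sub>M UNIV (\<lambda>_. \<nu>)) = sets reals" by (rule sets_PiM_cong) (simp_all add: \<nu>)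
  have "distr M reals (\<lambda>w. seq_shift 1 (\<lambda>k. E k w)) = distr (distr M reals (\<lambda>w k. E k w)) reals (seq_shift 1)"
    by (subst distr_distr) (simp_all add: comp_def)
  also have "\<dots> = distr (Pi\<^sub>M UNIV (\<lambda>_. \<nu>)) (Pi\<^sub>M UNIV (\<lambda>_. \<nu>)) (seq_shift 1)"
    by (rule distr_cong) (simp_all add: law sets)
  also have "\<dots> = distr M reals (\<lambda>w k. E k w)"
    by (simp add: distr_PiM_seq_shift[OF \<nu>(1)] law)
  finally show ?thesis .
qed

text \<open>The gaps and the marks are separately stationary, and their joint law is the product of the two.\<close>

lemma gap_law_shift_invariant: "distr gap_law gap_seqs (seq_shift 1) = gap_law"
proof -
  let ?pr = "\<lambda>p k. (fst p k, snd p k) :: real \<times> real"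
  let ?Z = "\<lambda>w k. Z k w" and ?E = "\<lambda>w k. E k w"
  let ?Z' = "\<lambda>w. seq_shift 1 (\<lambda>k. Z k w)" and ?E' = "\<lambda>w. seq_shift 1 (\<lambda>k. E k w)"
  have [measurable]: "?pr \<in> reals \<Otimes>\<^sub>M reals \<rightarrow>\<^sub>M gap_seqs"
    by (rule measurable_PiM_single') (auto simp: space_pair_measure)
  have ind': "indep_var reals ?Z' reals ?E'"
    using indep_var_compose[OF gaps_marks_indep seq_shift_measurable_PiM seq_shift_measurable_PiM]
    by (simp add: comp_def)
  have joint: "distr M reals X \<Otimes>\<^sub>M distr M reals Y = distr M (reals \<Otimes>\<^sub>M reals) (\<lambda>w. (X w, Y w))"
    if "indep_var reals X reals Y" for X Y
    using that by (simp add: indep_var_distribution_eq)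
  have "distr M reals ?Z' = distr M reals ?Z"
    using Z_stationary unfolding stationary_seq_def seq_shift_def by blast
  then have eq: "distr M (reals \<Otimes>\<^sub>M reals) (\<lambda>w. (?Z' w, ?E' w)) = distr M (reals \<Otimes>\<^sub>M reals) (\<lambda>w. (?Z w, ?E w))"
    using joint[OF ind'] joint[OF gaps_marks_indep] distr_mark_seq_shift by simp
  have "distr gap_law gap_seqs (seq_shift 1) = distr (distr M (reals \<Otimes>\<^sub>M reals) (\<lambda>w. (?Z' w, ?E' w))) gap_seqs ?pr"
  proof -
    have m': "(\<lambda>w. (?Z' w, ?E' w)) \<in> M \<rightarrow>\<^sub>M reals \<Otimes>\<^sub>M reals"
      by (intro measurable_Pair indep_var_rv1[OF ind'] indep_var_rv2[OF ind'])
    have "distr gap_law gap_seqs (seq_shift 1) = distr M gap_seqs (\<lambda>w k. (Z (k + 1) w, E (k + 1) w))"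
      unfolding gap_law_def by (subst distr_distr) (simp_all add: comp_def seq_shift_def)
    moreover have "distr (distr M (reals \<Otimes>\<^sub>M reals) (\<lambda>w. (?Z' w, ?E' w))) gap_seqs ?pr
        = distr M gap_seqs (\<lambda>w k. (Z (k + 1) w, E (k + 1) w))"
      by (subst distr_distr[OF _ m']) (simp_all add: comp_def seq_shift_def)
    ultimately show ?thesis by simp
  qed
  also have "\<dots> = distr (distr M (reals \<Otimes>\<^sub>M reals) (\<lambda>w. (?Z w, ?E w))) gap_seqs ?pr"
    by (simp only: eq)
  also have "\<dots> = gap_law"
    unfolding gap_law_def by (subst distr_distr) (simp_all add: comp_def)
  finally show ?thesis .
qed

lemma nn_integral_gap_law:
  assumes [measurable]: "f \<in> borel_measurable borel"
  shows "(\<integral>\<^sup>+ y. f (gap y 0) \<partial>gap_law) = (\<integral>\<^sup>+ w. f (Z j w) \<partial>M)"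
proof -
  have "distr M borel (Z j) = distr M borel (Z 0)"
  proof -
    have "distr M reals (\<lambda>w k. Z (k + j) w) = distr M reals (\<lambda>w k. Z k w)"
      using Z_stationary unfolding stationary_seq_def by blast
    then have "distr (distr M reals (\<lambda>w k. Z (k + j) w)) borel (\<lambda>z. z 0) = distr (distr M reals (\<lambda>w k. Z k w)) borel (\<lambda>z. z 0)"
      by simp
    moreover have "(\<lambda>w k. Z (k + j) w) \<in> M \<rightarrow>\<^sub>M reals" by (rule measurable_PiM_single') auto
    ultimately show ?thesis by (simp add: distr_distr comp_def)
  qed
  then have "(\<integral>\<^sup>+ x. f x \<partial>distr M borel (Z j)) = (\<integral>\<^sup>+ x. f x \<partial>distr M borel (Z 0))" by simp
  then have "(\<integral>\<^sup>+ w. f (Z j w) \<partial>M) = (\<integral>\<^sup>+ w. f (Z 0 w) \<partial>M)"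
    by (simp add: nn_integral_distr)
  then show ?thesis
    unfolding gap_law_def by (subst nn_integral_distr) simp_all
qed

lemma stationary_gaps_gap_law:
  assumes "0 < \<alpha>" and v: "(\<lambda>(a, b). v a b) \<in> borel_measurable (borel \<Otimes>\<^sub>M borel)" and "0 < c\<^sub>1"
    and "\<And>a b. a \<in> {-1..1} \<Longrightarrow> b \<in> {-1..1} \<Longrightarrow> c\<^sub>1 * (\<bar>a\<bar> + \<bar>b\<bar>) \<le> v a b"
    and "\<And>a b. a \<in> {-1..1} \<Longrightarrow> b \<in> {-1..1} \<Longrightarrow> v a b \<le> c\<^sub>2 * (\<bar>a\<bar> + \<bar>b\<bar>)"
  shows "stationary_gaps gap_law \<alpha> v c\<^sub>1 c\<^sub>2"
proof (intro stationary_gaps.intro prob_space_gap_law stationary_gaps_axioms.intro)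
  have "AE w in M. \<forall>k. 0 < Z k w" using Z_pos by (simp add: AE_all_countable)
  then show "AE y in gap_law. \<forall>k. 0 < gap y k"
    unfolding gap_law_def by (subst AE_distr_iff) simp_all
  have "AE w in M. \<forall>k. E k w \<in> {-1..1}" using E_range by (simp add: AE_all_countable)
  then show "AE y in gap_law. \<forall>k. gmark y k \<in> {-1..1}"
    unfolding gap_law_def by (subst AE_distr_iff) simp_all
  show "integrable gap_law (\<lambda>y. gap y 0)"
    unfolding gap_law_def using Z_mean[of 0] by (subst integrable_distr_eq) simp_all
qed (use assms sets_gap_law gap_law_shift_invariant in simp_all)

lemma iid_gaps_gap_law:
  assumes "stationary_gaps gap_law \<alpha> v c\<^sub>1 c\<^sub>2" and Z: "iid_seq M Z"
  shows "iid_gaps gap_law \<alpha> v c\<^sub>1 c\<^sub>2"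
proof (intro iid_gaps.intro assms(1) iid_gaps_axioms.intro)
  show "prob_space.indep_vars gap_law (\<lambda>_. borel) (\<lambda>k y. gap y k) UNIV"
    unfolding gap_law_def using Z by (intro indep_vars_distrI) (simp_all add: iid_seq_def)
  show "prob_space.indep_vars gap_law (\<lambda>_. borel) (\<lambda>k y. gmark y k) UNIV"
    unfolding gap_law_def using E_iid by (intro indep_vars_distrI) (simp_all add: iid_seq_def)
  have "(\<lambda>y. gap y) \<in> gap_seqs \<rightarrow>\<^sub>M reals" "(\<lambda>y. gmark y) \<in> gap_seqs \<rightarrow>\<^sub>M reals"
    by (rule measurable_PiM_single'; auto)+
  then show "prob_space.indep_var gap_law reals (\<lambda>y. gap y) reals (\<lambda>y. gmark y)"
    unfolding gap_law_def using gaps_marks_indep by (intro indep_var_distrI) simp_all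
qed

lemma prob_small_mark: "measure gap_law {y \<in> space gap_law. \<bar>gmark y 0\<bar> \<le> e} = measure \<nu> {-e..e}"
proof -
  have S: "{y \<in> space gap_seqs. \<bar>gmark y 0\<bar> \<le> e} \<in> sets gap_seqs" by measurable
  have "measure gap_law {y \<in> space gap_law. \<bar>gmark y 0\<bar> \<le> e} = measure M {w \<in> space M. \<bar>E 0 w\<bar> \<le> e}"
    unfolding gap_law_def space_distr
    by (subst measure_distr[OF _ S])
       (auto intro!: arg_cong[where f = "measure M"] simp: space_PiM space_pair_measure)
  also have "\<dots> = measure (distr M borel (E 0)) {-e..e}"
    by (subst measure_distr) (auto intro!: arg_cong[where f = "measure M"])
  finally show ?thesis by (simp add: E_law)
qed

end

theorem theorem1p2:
  fixes M :: "'a measure" and Z E :: "int \<Rightarrow> 'a \<Rightarrow> real" and \<nu> :: "real measure"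
    and u :: "real \<Rightarrow> real \<Rightarrow> real" and \<alpha> :: real and j :: int
    and D :: "real \<Rightarrow> ennreal"
  assumes "environment M Z E \<nu>"
    and "mark_interaction u"
    and "0 < \<alpha>"
    and "\<And>\<beta>. D \<beta> = diffusion_coeff (env_law M Z E) \<alpha> u \<beta>"
    and "(\<integral>\<^sup>+ w. ennreal ((Z j w)\<^sup>2) \<partial>M) < \<infinity>"
  shows
    \<comment> \<open>(1)\<close>
    "((\<integral>\<^sup>+ w. ennreal (exp (Z j w powr \<alpha>)) \<partial>M) < \<infinity> \<longrightarrow>
        (\<exists>C>0. \<exists>\<kappa>>0. \<forall>\<beta>\<ge>0. D \<beta> \<ge> ennreal (C * exp (- \<kappa> * \<beta>))))
     \<and>
     \<comment> \<open>(2)\<close>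
     (1 \<le> \<alpha> \<and> iid_seq M Z \<longrightarrow>
        (\<forall>\<beta>\<ge>0. D \<beta> > 0 \<longleftrightarrow> (\<integral>\<^sup>+ w. ennreal (exp (Z j w powr \<alpha>)) \<partial>M) < \<infinity>) \<and>
        ((\<integral>\<^sup>+ w. ennreal (exp (Z j w powr \<alpha>)) \<partial>M) < \<infinity> \<and>
         ((\<lambda>e. measure \<nu> {-e..e}) \<longlongrightarrow> 0) (at_right 0) \<longrightarrow>
           (\<exists>C\<^sub>1>0. \<exists>C\<^sub>2>0. \<exists>\<kappa>\<^sub>1>0. \<exists>\<kappa>\<^sub>2>0. \<forall>\<beta>\<ge>0.
              ennreal (C\<^sub>1 * exp (- \<kappa>\<^sub>1 * \<beta>)) \<le> D \<beta> \<and>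
              D \<beta> \<le> ennreal (C\<^sub>2 * exp (- \<kappa>\<^sub>2 * \<beta>)))))
     \<and>
     \<comment> \<open>(3)\<close>
     (\<alpha> < 1 \<and> iid_seq M Z \<longrightarrow>
        \<comment> \<open>(i)\<close>
        ((\<exists>\<gamma>\<in>{0<..<1}. (\<integral>\<^sup>+ w. ennreal (exp (\<gamma> * Z j w powr \<alpha>)) \<partial>M) = \<infinity>) \<longrightarrow>
           (\<forall>\<beta>\<ge>0. D \<beta> = 0)) \<and>
        \<comment> \<open>(ii)\<close>
        (\<forall>\<delta>>0. (\<exists>\<epsilon>>0. (\<integral>\<^sup>+ w. ennreal (exp (\<epsilon> * Z j w)) \<partial>M) < \<infinity>) \<and>
           comparable_at_0 (\<lambda>e. measure \<nu> {-e..e}) (\<lambda>e. e powr \<delta>) \<longrightarrow>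
           (\<exists>C\<^sub>1>0. \<exists>C\<^sub>2>0. \<exists>\<kappa>\<^sub>1>0. \<exists>\<kappa>\<^sub>2>0. \<forall>\<beta>\<ge>0.
              ennreal (C\<^sub>1 * exp (- \<kappa>\<^sub>1 * \<beta> powr (\<delta> * \<alpha> / (1 - \<alpha> + \<delta> * \<alpha>)))) \<le> D \<beta> \<and>
              D \<beta> \<le> ennreal (C\<^sub>2 * exp (- \<kappa>\<^sub>2 * \<beta> powr (\<delta> * \<alpha> / (1 - \<alpha> + \<delta> * \<alpha>)))))))"
proof -
  interpret env: environment M Z E \<nu> by (rule assms(1))
  obtain c\<^sub>1 c\<^sub>2 where c: "0 < c\<^sub>1" "c\<^sub>1 \<le> c\<^sub>2"
    and u: "\<And>a b. a \<in> {-1..1} \<Longrightarrow> b \<in> {-1..1} \<Longrightarrow> c\<^sub>1 * (\<bar>a\<bar> + \<bar>b\<bar>) \<le> u a b"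
      "\<And>a b. a \<in> {-1..1} \<Longrightarrow> b \<in> {-1..1} \<Longrightarrow> u a b \<le> c\<^sub>2 * (\<bar>a\<bar> + \<bar>b\<bar>)"
    and u_meas: "(\<lambda>(a, b). u a b) \<in> borel_measurable (restrict_space (borel \<Otimes>\<^sub>M borel) ({-1..1} \<times> {-1..1}))"
    using assms(2) unfolding mark_interaction_def by blast
  define v where "v a b = (if (a, b) \<in> {-1..1} \<times> {-1..1} then u a b else 0)" for a b
  have uv: "u a b = v a b" if "a \<in> {-1..1}" "b \<in> {-1..1}" for a b using that by (simp add: v_def)
  have v_meas: "(\<lambda>(a, b). v a b) \<in> borel_measurable (borel \<Otimes>\<^sub>M borel)"
  proof -
    have sq: "({-1..1} \<times> {-1..1} :: (real \<times> real) set) \<inter> space (borel \<Otimes>\<^sub>M borel) \<in> sets (borel \<Otimes>\<^sub>M borel)"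
      by (auto simp: space_pair_measure intro!: pair_measureI)
    have "(\<lambda>x. if x \<in> {-1..1} \<times> {-1..1} then (\<lambda>(a, b). u a b) x else 0) \<in> borel_measurable (borel \<Otimes>\<^sub>M borel)"
      using u_meas measurable_restrict_space_iff[OF sq, of 0 borel "\<lambda>(a, b). u a b"] by simp
    also have "(\<lambda>x. if x \<in> {-1..1} \<times> {-1..1} then (\<lambda>(a, b). u a b) x else 0) = (\<lambda>(a, b). v a b)"
      by (auto simp: v_def fun_eq_iff)
    finally show ?thesis .
  qed
  have st: "stationary_gaps env.gap_law \<alpha> v c\<^sub>1 c\<^sub>2"
    using u uv by (intro env.stationary_gaps_gap_law assms(3) v_meas c) simp_all
  then interpret gaps: stationary_gaps env.gap_law \<alpha> v c\<^sub>1 c\<^sub>2 .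
  have D_eq: "D = gaps.D"
  proof
    fix \<beta>
    show "D \<beta> = gaps.D \<beta>"
      unfolding assms(4) env.env_law_eq gaps.D_def
      by (rule diffusion_coeff_eq_INF_energy[OF gaps.sets_Q gaps.marks_range v_meas uv])
  qed
  let ?F = "\<integral>\<^sup>+ w. ennreal (exp (Z j w powr \<alpha>)) \<partial>M"
  have exp_moment: "(\<integral>\<^sup>+ w. ennreal (exp (\<gamma> * Z j w powr a)) \<partial>M)
      = (\<integral>\<^sup>+ y. ennreal (exp (\<gamma> * gap y 0 powr a)) \<partial>env.gap_law)" for \<gamma> a
    by (rule env.nn_integral_gap_law[symmetric]) simp
  have iid_gaps: "iid_gaps env.gap_law \<alpha> v c\<^sub>1 c\<^sub>2" if "iid_seq M Z"
    by (rule env.iid_gaps_gap_law[OF st that])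
  have part1: "\<exists>C>0. \<exists>\<kappa>>0. \<forall>\<beta>\<ge>0. ennreal (C * exp (- \<kappa> * \<beta>)) \<le> D \<beta>" if "?F < \<infinity>"
    unfolding D_eq by (rule gaps.D_ge_nearest_neighbour) (use that exp_moment[of 1 \<alpha>] in simp)
  have two_sided: "\<exists>C\<^sub>1>0. \<exists>C\<^sub>2>0. \<exists>\<kappa>\<^sub>1>0. \<exists>\<kappa>\<^sub>2>0. \<forall>\<beta>\<ge>0.
      ennreal (C\<^sub>1 * exp (- \<kappa>\<^sub>1 * f \<beta>)) \<le> D \<beta> \<and> D \<beta> \<le> ennreal (C\<^sub>2 * exp (- \<kappa>\<^sub>2 * f \<beta>))"
    if lo: "\<exists>C>0. \<exists>\<kappa>>0. \<forall>\<beta>\<ge>0. ennreal (C * exp (- \<kappa> * f \<beta>)) \<le> D \<beta>"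
      and up: "\<exists>C>0. \<exists>\<kappa>>0. \<forall>\<beta>\<ge>0. D \<beta> \<le> ennreal (C * exp (- \<kappa> * f \<beta>))" for f :: "real \<Rightarrow> real"
  proof -
    obtain C\<^sub>1 \<kappa>\<^sub>1 where lower: "0 < C\<^sub>1" "0 < \<kappa>\<^sub>1"
      "\<And>\<beta>. 0 \<le> \<beta> \<Longrightarrow> ennreal (C\<^sub>1 * exp (- \<kappa>\<^sub>1 * f \<beta>)) \<le> D \<beta>" using lo by blast
    obtain C\<^sub>2 \<kappa>\<^sub>2 where upper: "0 < C\<^sub>2" "0 < \<kappa>\<^sub>2"
      "\<And>\<beta>. 0 \<le> \<beta> \<Longrightarrow> D \<beta> \<le> ennreal (C\<^sub>2 * exp (- \<kappa>\<^sub>2 * f \<beta>))" using up by blast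
    show ?thesis
      by (rule exI[of _ C\<^sub>1], rule conjI[OF lower(1)], rule exI[of _ C\<^sub>2], rule conjI[OF upper(1)],
          rule exI[of _ \<kappa>\<^sub>1], rule conjI[OF lower(2)], rule exI[of _ \<kappa>\<^sub>2], rule conjI[OF upper(2)])
         (intro allI impI conjI lower(3) upper(3))
  qed
  show ?thesis
  proof (intro conjI impI allI)
    assume "?F < \<infinity>"
    then show "\<exists>C>0. \<exists>\<kappa>>0. \<forall>\<beta>\<ge>0. ennreal (C * exp (- \<kappa> * \<beta>)) \<le> D \<beta>" by (rule part1)
  next
    fix \<beta> :: real
    assume H: "1 \<le> \<alpha> \<and> iid_seq M Z" and \<beta>: "0 \<le> \<beta>"
    interpret iid: iid_gaps env.gap_law \<alpha> v c\<^sub>1 c\<^sub>2 by (rule iid_gaps) (use H in simp)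
    have "D \<beta> = 0" if "\<not> ?F < \<infinity>"
    proof -
      have "(\<integral>\<^sup>+ y. ennreal (exp (1 * gap y 0 powr \<alpha>)) \<partial>env.gap_law) = \<infinity>"
        using that exp_moment[of 1 \<alpha>] by (simp add: not_less top_unique)
      then show ?thesis
        unfolding D_eq using powr_superadditive[of \<alpha>] H \<beta>
        by (intro iid.D_eq_0_if_long_gaps[of 1 1]) simp_all
    qed
    moreover have "0 < D \<beta>" if fin: "?F < \<infinity>"
    proof -
      obtain C \<kappa> where "0 < C" "\<forall>\<beta>\<ge>0. ennreal (C * exp (- \<kappa> * \<beta>)) \<le> D \<beta>"
        using part1[OF fin] by blast
      then have "0 < ennreal (C * exp (- \<kappa> * \<beta>))" "ennreal (C * exp (- \<kappa> * \<beta>)) \<le> D \<beta>"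
        using \<beta> by (simp_all add: ennreal_zero_less_mult_iff)
      then show ?thesis by (rule less_le_trans)
    qed
    ultimately show "0 < D \<beta> \<longleftrightarrow> ?F < \<infinity>" by (metis less_irrefl)
  next
    assume H: "1 \<le> \<alpha> \<and> iid_seq M Z"
      and fin: "?F < \<infinity> \<and> ((\<lambda>e. measure \<nu> {-e..e}) \<longlongrightarrow> 0) (at_right 0)"
    interpret iid: iid_gaps env.gap_law \<alpha> v c\<^sub>1 c\<^sub>2 by (rule iid_gaps) (use H in simp)
    have "(iid.low_prob \<longlongrightarrow> 0) (at_right 0)"
      using fin by (simp add: iid.low_prob_def[abs_def] env.prob_small_mark)
    then have "\<exists>C>0. \<exists>\<kappa>>0. \<forall>\<beta>\<ge>0. D \<beta> \<le> ennreal (C * exp (- \<kappa> * \<beta>))"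
      unfolding D_eq using H by (intro iid.D_le_exp) simp_all
    with part1 fin show "\<exists>C\<^sub>1>0. \<exists>C\<^sub>2>0. \<exists>\<kappa>\<^sub>1>0. \<exists>\<kappa>\<^sub>2>0. \<forall>\<beta>\<ge>0.
        ennreal (C\<^sub>1 * exp (- \<kappa>\<^sub>1 * \<beta>)) \<le> D \<beta> \<and> D \<beta> \<le> ennreal (C\<^sub>2 * exp (- \<kappa>\<^sub>2 * \<beta>))"
      by (intro two_sided) simp_all
  next
    fix \<beta> :: real
    assume H: "\<alpha> < 1 \<and> iid_seq M Z" and \<beta>: "0 \<le> \<beta>"
      and "\<exists>\<gamma>\<in>{0<..<1}. (\<integral>\<^sup>+ w. ennreal (exp (\<gamma> * Z j w powr \<alpha>)) \<partial>M) = \<infinity>"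
    then obtain \<gamma> where \<gamma>: "0 < \<gamma>" "\<gamma> < 1"
      and inf: "(\<integral>\<^sup>+ y. ennreal (exp (\<gamma> * gap y 0 powr \<alpha>)) \<partial>env.gap_law) = \<infinity>"
      by (auto simp: exp_moment)
    interpret iid: iid_gaps env.gap_law \<alpha> v c\<^sub>1 c\<^sub>2 by (rule iid_gaps) (use H in simp)
    \<comment> \<open>Both \<open>a\<close> and \<open>b\<close> are at most \<open>a + b\<close>, so a convex combination of the powers will do.\<close>
    have split: "\<gamma> * a powr \<alpha> + (1 - \<gamma>) * b powr \<alpha> \<le> (a + b) powr \<alpha>" if "0 \<le> a" "0 \<le> b" for a b
    proof -
      have "a powr \<alpha> \<le> (a + b) powr \<alpha>" "b powr \<alpha> \<le> (a + b) powr \<alpha>"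
        using that assms(3) by (auto intro!: powr_mono2)
      then have "\<gamma> * a powr \<alpha> + (1 - \<gamma>) * b powr \<alpha> \<le> \<gamma> * (a + b) powr \<alpha> + (1 - \<gamma>) * (a + b) powr \<alpha>"
        using \<gamma> by (intro add_mono mult_left_mono) simp_all
      then show ?thesis by (simp add: algebra_simps)
    qed
    show "D \<beta> = 0"
      unfolding D_eq using \<gamma> by (intro iid.D_eq_0_if_long_gaps[OF _ _ split inf \<beta>]) simp_all
  next
    fix \<delta> :: real
    assume H: "\<alpha> < 1 \<and> iid_seq M Z" and \<delta>: "0 < \<delta>"
      and hyp: "(\<exists>\<epsilon>>0. (\<integral>\<^sup>+ w. ennreal (exp (\<epsilon> * Z j w)) \<partial>M) < \<infinity>) \<and>
        comparable_at_0 (\<lambda>e. measure \<nu> {-e..e}) (\<lambda>e. e powr \<delta>)"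
    interpret iid: iid_gaps env.gap_law \<alpha> v c\<^sub>1 c\<^sub>2 by (rule iid_gaps) (use H in simp)
    have "(\<integral>\<^sup>+ w. ennreal (exp (\<epsilon> * Z j w)) \<partial>M) = (\<integral>\<^sup>+ y. ennreal (exp (\<epsilon> * gap y 0)) \<partial>env.gap_law)" for \<epsilon>
      by (rule env.nn_integral_gap_law[symmetric]) simp
    then obtain \<epsilon> where eps: "0 < \<epsilon>" "(\<integral>\<^sup>+ y. ennreal (exp (\<epsilon> * gap y 0)) \<partial>env.gap_law) < \<infinity>"
      using hyp by auto
    obtain a\<^sub>1 a\<^sub>2 where a: "0 < a\<^sub>1" "0 < a\<^sub>2"
      and ev: "\<forall>\<^sub>F e in at_right 0. a\<^sub>1 * e powr \<delta> \<le> iid.low_prob e \<and> iid.low_prob e \<le> a\<^sub>2 * e powr \<delta>"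
      using hyp unfolding comparable_at_0_def iid.low_prob_def env.prob_small_mark by blast
    have ev1: "\<forall>\<^sub>F e in at_right 0. a\<^sub>1 * e powr \<delta> \<le> iid.low_prob e"
      and ev2: "\<forall>\<^sub>F e in at_right 0. iid.low_prob e \<le> a\<^sub>2 * e powr \<delta>"
      using ev by (auto elim: eventually_mono)
    show "\<exists>C\<^sub>1>0. \<exists>C\<^sub>2>0. \<exists>\<kappa>\<^sub>1>0. \<exists>\<kappa>\<^sub>2>0. \<forall>\<beta>\<ge>0.
        ennreal (C\<^sub>1 * exp (- \<kappa>\<^sub>1 * \<beta> powr (\<delta> * \<alpha> / (1 - \<alpha> + \<delta> * \<alpha>)))) \<le> D \<beta> \<and>
        D \<beta> \<le> ennreal (C\<^sub>2 * exp (- \<kappa>\<^sub>2 * \<beta> powr (\<delta> * \<alpha> / (1 - \<alpha> + \<delta> * \<alpha>))))"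
    proof (rule two_sided)
      show "\<exists>C>0. \<exists>\<kappa>>0. \<forall>\<beta>\<ge>0. ennreal (C * exp (- \<kappa> * \<beta> powr (\<delta> * \<alpha> / (1 - \<alpha> + \<delta> * \<alpha>)))) \<le> D \<beta>"
        unfolding D_eq by (rule iid.D_ge_stretched_exp[OF conjunct1[OF H] \<delta> a(1) ev1 eps])
      show "\<exists>C>0. \<exists>\<kappa>>0. \<forall>\<beta>\<ge>0. D \<beta> \<le> ennreal (C * exp (- \<kappa> * \<beta> powr (\<delta> * \<alpha> / (1 - \<alpha> + \<delta> * \<alpha>))))"
        unfolding D_eq by (rule iid.D_le_stretched_exp[OF conjunct1[OF H] \<delta> a(2) ev2])
    qed
  qed
qed

end
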